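(* Let $\lambda/\mu$ be a basic skew diagram with $\delta(\lambda/\mu)=n$. Then $cc(\lambda/\mu)$ is at least $(p_n,f_n)$, where $p_n$ is the number of partitions of $n$ and $f_n$ is the number of standard Young tableaux with $n$ boxes. That is, the skew character $[\lambda/\mu]$ has at least $p_n$ components and at least $f_n$ constituents.
   Context: For a partition $\lambda$, $l(\lambda)$ is the number of positive parts and $dp(\lambda)$ is the number of different (positive) parts of $\lambda$. For $\mu\subseteq\lambda$ the skew diagram $\lambda/\mu$ is the set of boxes of the diagram of $\lambda$ not in $\mu$; it is basic if $\mu_i<\lambda_i$ and $\mu_i\le\lambda_{i+1}$ for each $1\le i\le l(\lambda)$ (no empty rows or columns). The $\delta$ value of a basic skew diagram is $\delta(\lambda/\mu)=\min\big(dp(\mu)+1,\,dp(\lambda)\big)$. $c(\lambda;\mu,\nu)$ is the Littlewood-Richardson coefficient (the number of semistandard tableaux of shape $\lambda/\mu$ and content $\nu$ whose reverse row word is a lattice word). The skew character is $[\lambda/\mu]=\sum_\nu c(\lambda;\mu,\nu)[\nu]$, where $[\nu]$ is the irreducible character of the symmetric group labeled by $\nu$. The number of components of $[\lambda/\mu]$ is $a=\#\{\nu: c(\lambda;\mu,\nu)\ne0\}$ and the number of constituents is $b=\sum_\nu c(\lambda;\mu,\nu)$; one writes $cc(\lambda/\mu)=(a,b)$. One says $cc(\lambda/\mu)=(a,b)$ is at least $(c,d)$ if $a\ge c$ and $b\ge d$. $f_n=\sum_{\lambda\vdash n}f^\lambda$, where $f^\lambda$ is the number of standard Young tableaux of shape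 $\lambda$. *)

theory Defs
  imports "HOL-Library.FuncSet"
begin

text \<open>
  Partitions are lists of positive parts in weakly decreasing order, so that \<open>length\<close> is the
  number of parts and \<open>sum_list\<close> the number partitioned. Rows, columns and parts are numbered
  from 0; entries of tableaux are positive, and the entry \<open>Suc k\<close> corresponds to part number \<open>k\<close>
  of the content.
\<close>

definition is_partition :: "nat list \<Rightarrow> bool" where
  "is_partition xs \<longleftrightarrow> sorted_wrt (\<ge>) xs \<and> (\<forall>x\<in>set xs. 0 < x)"

definition part :: "nat list \<Rightarrow> nat \<Rightarrow> nat" where
  "part xs i = (if i < length xs then xs ! i else 0)"

definition dp :: "nat list \<Rightarrow> nat" where
  "dp xs = card (set xs)"

definition partitions :: "nat \<Rightarrow> nat list set" where
  "partitions n = {xs. is_partition xs \<and> sum_list xs = n}"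

definition contained :: "nat list \<Rightarrow> nat list \<Rightarrow> bool" where
  "contained mu lam \<longleftrightarrow> (\<forall>i. part mu i \<le> part lam i)"

definition skew_diagram :: "nat list \<Rightarrow> nat list \<Rightarrow> (nat \<times> nat) set" where
  "skew_diagram lam mu = {(i, j). part mu i \<le> j \<and> j < part lam i}"

definition basic :: "nat list \<Rightarrow> nat list \<Rightarrow> bool" where
  "basic lam mu \<longleftrightarrow> contained mu lam \<and>
     (\<forall>i < length lam. part mu i < part lam i \<and> part mu i \<le> part lam (Suc i))"

definition delta :: "nat list \<Rightarrow> nat list \<Rightarrow> nat" where
  "delta lam mu = min (dp mu + 1) (dp lam)"

text \<open>
  A filling of \<open>D\<close> is \<open>undefined\<close> outside \<open>D\<close>, so that fillings with the same entries are equal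
  and can be counted by \<open>card\<close>.
\<close>

definition semistandard :: "(nat \<times> nat) set \<Rightarrow> (nat \<times> nat \<Rightarrow> nat) \<Rightarrow> bool" where
  "semistandard D T \<longleftrightarrow> T \<in> D \<rightarrow>\<^sub>E {0<..} \<and>
     (\<forall>i j j'. (i, j) \<in> D \<longrightarrow> (i, j') \<in> D \<longrightarrow> j < j' \<longrightarrow> T (i, j) \<le> T (i, j')) \<and>
     (\<forall>i i' j. (i, j) \<in> D \<longrightarrow> (i', j) \<in> D \<longrightarrow> i < i' \<longrightarrow> T (i, j) < T (i', j))"

definition has_content :: "(nat \<times> nat) set \<Rightarrow> (nat \<times> nat \<Rightarrow> nat) \<Rightarrow> nat list \<Rightarrow> bool" where
  "has_content D T nu \<longleftrightarrow> (\<forall>k. card {b \<in> D. T b = Suc k} = part nu k)"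

text \<open>The rows are read from top to bottom, each from right to left.\<close>

definition reverse_row_word ::
    "nat list \<Rightarrow> nat list \<Rightarrow> (nat \<times> nat \<Rightarrow> nat) \<Rightarrow> nat list" where
  "reverse_row_word lam mu T =
     concat (map (\<lambda>i. rev (map (\<lambda>j. T (i, j)) [part mu i..<part lam i])) [0..<length lam])"

definition lattice_word :: "nat list \<Rightarrow> bool" where
  "lattice_word w \<longleftrightarrow>
     (\<forall>m k. 0 < k \<longrightarrow> count_list (take m w) (Suc k) \<le> count_list (take m w) k)"

definition lr_coeff :: "nat list \<Rightarrow> nat list \<Rightarrow> nat list \<Rightarrow> nat" where
  "lr_coeff lam mu nu =
     card {T. semistandard (skew_diagram lam mu) T \<and> has_content (skew_diagram lam mu) T nu \<and>
              lattice_word (reverse_row_word lam mu T)}"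

text \<open>
  The irreducible characters \<open>[nu]\<close> form a basis of the class functions, so the skew character
  \<open>[lam/mu]\<close>, being the sum of the \<open>[nu]\<close> with multiplicities \<open>lr_coeff lam mu nu\<close>, enters
  only through these multiplicities.
\<close>

definition components :: "nat list \<Rightarrow> nat list \<Rightarrow> nat list set" where
  "components lam mu = {nu. is_partition nu \<and> lr_coeff lam mu nu \<noteq> 0}"

definition cc :: "nat list \<Rightarrow> nat list \<Rightarrow> nat \<times> nat" where
  "cc lam mu = (card (components lam mu), \<Sum>nu\<in>components lam mu. lr_coeff lam mu nu)"

definition at_least :: "nat \<times> nat \<Rightarrow> nat \<times> nat \<Rightarrow> bool" where
  "at_least ab cd \<longleftrightarrow> fst cd \<le> fst ab \<and> snd cd \<le> snd ab"

definition num_partitions :: "nat \<Rightarrow> nat" where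
  "num_partitions n = card (partitions n)"

text \<open>Bijectivity makes the weakly increasing rows strictly increasing.\<close>

definition standard_tableaux :: "nat list \<Rightarrow> (nat \<times> nat \<Rightarrow> nat) set" where
  "standard_tableaux lam =
     {T. semistandard (skew_diagram lam []) T \<and>
         bij_betw T (skew_diagram lam []) {1..sum_list lam}}"

definition num_standard_tableaux :: "nat \<Rightarrow> nat" where
  "num_standard_tableaux n = (\<Sum>lam\<in>partitions n. card (standard_tableaux lam))"

end

theory Submission
  imports Defs
begin

text \<open>
  Littlewood-Richardson coefficients do not decrease when a pair of columns of heights \<open>b \<le> a\<close> is
  added to \<open>mu\<close> and \<open>lam\<close> (add a fixed tableau row by row), nor when a pair of rows of lengths
  \<open>d \<le> c\<close> is added (insert a part into every content read off column by column). Adding an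
  isolated box multiplies the skew character by \<open>[1]\<close>; the inequality needed here comes from sliding
  a box of the final content back through the columns of a tableau. A nonempty basic diagram from which no
  pair of columns or rows can be removed while keeping the number of different parts has an isolated
  box. So \<open>[lam/mu]\<close> dominates \<open>[1]\<^sup>n\<close> up to an injection of partitions, and the components and
  constituents of \<open>[1]\<^sup>n\<close> are counted by \<open>p\<^sub>n\<close> and \<open>f\<^sub>n\<close>.
\<close>

section \<open>Basic shapes and the removal of columns and rows\<close>

text \<open>As a function with infinitely many zeros \<open>mu\<close> always takes the value 0,
  which accounts for the +1 in \<open>delta\<close>: the numbers to protect are the positive values
  of \<open>lam\<close> and all values of \<open>mu\<close>. A removal must leave the shape basic
  and keep both numbers at least \<open>n\<close>; an isolated box costs at most one value on either
  side, and the factor [1] it brings pays for this. Added columns and rows change the content, so a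
  partition \<open>\<nu>\<close> of \<open>n\<close> ends as a component \<open>\<phi> \<nu>\<close>
  that may be larger. The induction closes because these maps are injective and send the removal of
  a corner to the removal of a corner: the recursion over the corners of \<open>\<nu>\<close>, which
  counts standard tableaux, is thereby carried to \<open>\<phi> \<nu>\<close>. So
  \<open>\<phi> \<nu>\<close> occurs at least once and at least as often as there are standard
  tableaux of shape \<open>\<nu>\<close>, and different \<open>\<nu>\<close> give different
  components. Since entries increase weakly along rows but strictly down columns, adding a row
  cannot copy the argument for a column; this is why a tableau is also encoded by the contents of
  its final columns, in which a row is one inserted part.\<close>

definition fin_supp :: "(nat \<Rightarrow> nat) \<Rightarrow> bool" where
  "fin_supp f \<longleftrightarrow> (\<exists>N. \<forall>i\<ge>N. f i = 0)"

definition conj_fun :: "(nat \<Rightarrow> nat) \<Rightarrow> nat \<Rightarrow> nat" where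
  "conj_fun f y = card {i. y < f i}"

lemma antimono_Suc_iff: "antimono f \<longleftrightarrow> (\<forall>n. f (Suc n) \<le> f n)" for f :: "nat \<Rightarrow> nat"
proof
  assume "\<forall>n. f (Suc n) \<le> f n"
  then show "antimono f" by (auto intro!: antimonoI elim: lift_Suc_antimono_le[of f, rotated])
qed (simp add: antimonoD)

lemma antimono_SucI: "(\<And>n. f (Suc n) \<le> f n) \<Longrightarrow> antimono f" for f :: "nat \<Rightarrow> nat"
  by (simp add: antimono_Suc_iff)

lemma conj_fun_eqI:
  assumes "\<And>i. y < f i \<longleftrightarrow> i < n"
  shows "conj_fun f y = n"
proof -
  have "{i. y < f i} = {..<n}" using assms by auto
  then show ?thesis by (simp add: conj_fun_def)
qed

text \<open>Both sides say that the box \<open>(i, y)\<close> lies in the diagram; the set counted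
  by \<open>conj_fun\<close> is an initial segment of the rows.\<close>

lemma less_conj_fun_iff:
  assumes "antimono f" "fin_supp f"
  shows "i < conj_fun f y \<longleftrightarrow> y < f i"
proof -
  obtain N where N: "\<And>i. i \<ge> N \<Longrightarrow> f i = 0" using assms(2) by (auto simp: fin_supp_def)
  define n where "n = (LEAST n. f n \<le> y)"
  have ex: "f N \<le> y" using N by simp
  have n1: "f n \<le> y" unfolding n_def by (rule LeastI[where P="\<lambda>n. f n \<le> y", OF ex])
  have n2: "y < f i" if "i < n" for i
    using not_less_Least[of i "\<lambda>n. f n \<le> y"] that unfolding n_def by simp
  have n3: "f i \<le> y" if "n \<le> i" for i
    using n1 antimonoD[OF assms(1) that] by simp
  have "y < f i \<longleftrightarrow> i < n" for i using n2 n3 by (meson leD leI)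
  then have "conj_fun f y = n" by (rule conj_fun_eqI)
  with \<open>\<And>i. y < f i \<longleftrightarrow> i < n\<close> show ?thesis by simp
qed

lemma conj_fun_conj_fun:
  assumes "antimono f" "fin_supp f"
  shows "conj_fun (conj_fun f) = f"
  by (rule ext, rule conj_fun_eqI) (simp add: less_conj_fun_iff[OF assms])

lemma antimono_conj_fun:
  assumes "antimono f" "fin_supp f"
  shows "antimono (conj_fun f)"
  by (rule antimono_SucI)
    (meson Suc_lessD leI less_conj_fun_iff[OF assms] less_irrefl)

lemma fin_supp_conj_fun:
  assumes "antimono f" "fin_supp f"
  shows "fin_supp (conj_fun f)"
  unfolding fin_supp_def
proof (intro exI allI impI)
  fix y assume "f 0 \<le> y"
  then show "conj_fun f y = 0"
    using less_conj_fun_iff[OF assms, of 0 y] by simp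
qed

definition basic_fun :: "(nat \<Rightarrow> nat) \<Rightarrow> (nat \<Rightarrow> nat) \<Rightarrow> bool" where
  "basic_fun l m \<longleftrightarrow> antimono l \<and> antimono m \<and> fin_supp l \<and>
     (\<forall>i. m i \<le> l (Suc i)) \<and> (\<forall>i. 0 < l i \<longrightarrow> m i < l i)"

definition num_pos_vals :: "(nat \<Rightarrow> nat) \<Rightarrow> nat" where
  "num_pos_vals l = card (range l - {0})"

definition num_vals :: "(nat \<Rightarrow> nat) \<Rightarrow> nat" where
  "num_vals m = card (range m)"

text \<open>A lower bound with free \<open>n\<close>, instead of the exact minimum, lets the
  induction hypothesis apply to a reduced shape that has more corners than required.\<close>

definition enough_corners :: "nat \<Rightarrow> (nat \<Rightarrow> nat) \<Rightarrow> (nat \<Rightarrow> nat) \<Rightarrow> bool" where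
  "enough_corners n l m \<longleftrightarrow> basic_fun l m \<and> n \<le> num_pos_vals l \<and> n \<le> num_vals m"

text \<open>\<open>add_column a\<close> adds a column of height \<open>a\<close> to a shape given by its rows; on the conjugate
  shape it adds a row of length \<open>a\<close>.\<close>

definition add_column :: "nat \<Rightarrow> (nat \<Rightarrow> nat) \<Rightarrow> nat \<Rightarrow> nat" where
  "add_column a f i = f i + (if i < a then 1 else 0)"

definition column_move ::
    "(nat \<Rightarrow> nat) \<Rightarrow> (nat \<Rightarrow> nat) \<Rightarrow> (nat \<Rightarrow> nat) \<Rightarrow> (nat \<Rightarrow> nat) \<Rightarrow> bool" where
  "column_move l' m' l m \<longleftrightarrow> (\<exists>a b. b \<le> a \<and> 0 < a \<and> l = add_column a l' \<and> m = add_column b m')"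

definition row_move ::
    "(nat \<Rightarrow> nat) \<Rightarrow> (nat \<Rightarrow> nat) \<Rightarrow> (nat \<Rightarrow> nat) \<Rightarrow> (nat \<Rightarrow> nat) \<Rightarrow> bool" where
  "row_move l' m' l m \<longleftrightarrow> (\<exists>c d. d \<le> c \<and> 0 < c \<and> conj_fun l = add_column c (conj_fun l') \<and>
     conj_fun m = add_column d (conj_fun m'))"

text \<open>At a row \<open>r\<close> with \<open>touch l m r\<close> the two boundary paths of the diagram meet, so consecutive such
  rows delimit its connected components.\<close>

definition touch :: "(nat \<Rightarrow> nat) \<Rightarrow> (nat \<Rightarrow> nat) \<Rightarrow> nat \<Rightarrow> bool" where
  "touch l m r \<longleftrightarrow> r = 0 \<or> m (r - 1) = l r"

definition isolated_box :: "(nat \<Rightarrow> nat) \<Rightarrow> (nat \<Rightarrow> nat) \<Rightarrow> nat \<Rightarrow> bool" where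
  "isolated_box l m r \<longleftrightarrow> l r = Suc (m r) \<and> touch l m r \<and> touch l m (Suc r)"

lemma finite_range_antimono: "antimono f \<Longrightarrow> finite (range f)" for f :: "nat \<Rightarrow> nat"
  by (rule finite_subset[of _ "{..f 0}"]) (auto dest: antimonoD[of f 0])

lemma basic_funD:
  assumes "basic_fun l m"
  shows "antimono l" "antimono m" "fin_supp l" "fin_supp m" "m i \<le> l (Suc i)" "0 < l i \<Longrightarrow> m i < l i"
    "m i \<le> l i"
proof -
  have b: "m i \<le> l (Suc i)" for i using assms by (simp add: basic_fun_def)
  show 1: "antimono l" "antimono m" and fl: "fin_supp l" and "0 < l i \<Longrightarrow> m i < l i"
    using assms by (auto simp: basic_fun_def)
  have le: "m i \<le> l i" for i using b[of i] antimonoD[OF 1(1), of i "Suc i"] by simp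
  then show "fin_supp m" using fl unfolding fin_supp_def by (metis le_zero_eq)
  show "m i \<le> l i" by (rule le)
  show "m i \<le> l (Suc i)" by (rule b)
qed

text \<open>Rows above \<open>b\<close> are only shifted and rows from \<open>a\<close> on do not
  change. A row in between loses a box of the skew diagram, and the overlap of two consecutive such
  rows shrinks by one column; \<open>len\<close> and \<open>nt\<close> keep rows and columns
  nonempty. Cutting at corners keeps both functions weakly decreasing.\<close>

lemma column_removal_basic:
  assumes bas: "basic_fun l m" and ba: "b \<le> a" "0 < a"
    and la: "l a < l (a - 1)" and mb: "b = 0 \<or> m b < m (b - 1)"
    and len: "\<And>i. b \<le> i \<Longrightarrow> i < a \<Longrightarrow> m i + 2 \<le> l i"
    and nt: "\<And>i. b \<le> i \<Longrightarrow> Suc i < a \<Longrightarrow> m i < l (Suc i)"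
    and n: "n \<le> num_pos_vals (\<lambda>i. l i - (if i < a then 1 else 0))"
       "n \<le> num_vals (\<lambda>i. m i - (if i < b then 1 else 0))"
  shows "\<exists>l' m'. enough_corners n l' m' \<and> column_move l' m' l m"
proof -
  note B = basic_funD[OF bas]
  define l' where "l' = (\<lambda>i. l i - (if i < a then 1 else 0))"
  define m' where "m' = (\<lambda>i. m i - (if i < b then 1 else 0))"
  have lpos: "l a < l i" if "i < a" for i
    using la antimonoD[OF B(1), of i "a - 1", OF less_Suc_eq_le[THEN iffD1]] that by simp
  have mpos: "m b < m i" if "i < b" for i
    using mb antimonoD[OF B(2), of i "b - 1", OF less_Suc_eq_le[THEN iffD1]] that by auto
  have lS: "l (Suc i) \<le> l i" for i using B(1) by (simp add: antimono_Suc_iff)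
  have mS: "m (Suc i) \<le> m i" for i using B(2) by (simp add: antimono_Suc_iff)
  have "antimono l'"
  proof (rule antimono_SucI)
    fix i show "l' (Suc i) \<le> l' i" using lS[of i] lpos[of i]
      by (cases "Suc i = a") (auto simp: l'_def)
  qed
  moreover have "antimono m'"
  proof (rule antimono_SucI)
    fix i show "m' (Suc i) \<le> m' i" using mS[of i] mpos[of i]
      by (cases "Suc i = b") (auto simp: m'_def)
  qed
  moreover have "fin_supp l'"
    using B(3) unfolding fin_supp_def l'_def by (metis diff_is_0_eq' le0 le_trans)
  moreover have "m' i \<le> l' (Suc i)" for i
  proof -
    consider "i < b" "Suc i < a" | "i < b" "\<not> Suc i < a" | "b \<le> i" "Suc i < a" | "b \<le> i" "a \<le> Suc i" by linarith
    then show ?thesis using B(5)[of i] nt[of i] by cases (auto simp: l'_def m'_def)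
  qed
  moreover have "m' i < l' i" if "0 < l' i" for i
  proof -
    consider "i < b" | "b \<le> i" "i < a" | "a \<le> i" by linarith
    then show ?thesis
    proof cases
      case 1 then show ?thesis using B(6)[of i] mpos[of i] lpos[of i] ba by (auto simp: l'_def m'_def)
    next
      case 2 then show ?thesis using len[of i] by (auto simp: l'_def m'_def)
    next
      case 3 then show ?thesis using B(6)[of i] that ba by (auto simp: l'_def m'_def)
    qed
  qed
  ultimately have "basic_fun l' m'" by (auto simp: basic_fun_def)
  moreover have "l = add_column a l'" using lpos by (force simp: add_column_def l'_def)
  moreover have "m = add_column b m'" using mpos by (force simp: add_column_def m'_def)
  ultimately show ?thesis using n ba unfolding enough_corners_def column_move_def l'_def m'_def by blast
qed

text \<open>After a drop by one, a jump of at least 2 at \<open>b\<close> is still a jump, so no two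
  values merge and none becomes 0; \<open>h\<close> undoes the shift on values.\<close>

lemma num_vals_column_removal:
  assumes "antimono f" "b = 0 \<or> f b + 2 \<le> f (b - 1)"
  shows "num_pos_vals f \<le> num_pos_vals (\<lambda>i. f i - (if i < b then 1 else 0))"
    and "num_vals f \<le> num_vals (\<lambda>i. f i - (if i < b then 1 else 0))"
proof -
  define g where "g = (\<lambda>i. f i - (if i < b then 1 else 0))"
  define h where "h = (\<lambda>v. if f b < v then v + 1 else v)"
  have big: "f b + 2 \<le> f i" if "i < b" for i
    using assms(2) antimonoD[OF assms(1), of i "b - 1", OF less_Suc_eq_le[THEN iffD1]] that by auto
  have hg: "h (g i) = f i" for i
    using big[of i] antimonoD[OF assms(1), of b i] by (cases "i < b") (auto simp: h_def g_def)
  have fr: "finite (range g)"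
    by (rule finite_subset[of _ "{..f 0}"])
      (auto simp: g_def intro: le_trans[OF diff_le_self] antimonoD[OF assms(1)])
  have "range f = h ` range g" using hg by (auto simp: image_image)
  then show "num_vals f \<le> num_vals (\<lambda>i. f i - (if i < b then 1 else 0))"
    unfolding num_vals_def using card_image_le[OF fr, of h] g_def by metis
  have "range f - {0} \<subseteq> h ` (range g - {0})"
  proof
    fix v assume "v \<in> range f - {0}"
    then obtain i where i: "v = f i" "f i \<noteq> 0" by auto
    then have "g i \<noteq> 0" using hg[of i] big[of i] by (auto simp: g_def)
    then show "v \<in> h ` (range g - {0})" using i hg[of i] by (metis Diff_iff empty_iff image_eqI insert_iff rangeI)
  qed
  then have "card (range f - {0}) \<le> card (h ` (range g - {0}))"
    by (rule card_mono[rotated]) (use fr in auto)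
  also have "\<dots> \<le> card (range g - {0})" using fr by (intro card_image_le) auto
  finally show "num_pos_vals f \<le> num_pos_vals (\<lambda>i. f i - (if i < b then 1 else 0))"
    unfolding num_pos_vals_def g_def .
qed

lemma range_remove_duplicate:
  fixes f :: "nat \<Rightarrow> 'a"
  assumes "f i = f (Suc i)"
  shows "range (\<lambda>k. if k \<le> i then f k else f (Suc k)) = range f"
proof
  show "range f \<subseteq> range (\<lambda>k. if k \<le> i then f k else f (Suc k))"
  proof
    fix v assume "v \<in> range f"
    then obtain k where k: "v = f k" by auto
    show "v \<in> range (\<lambda>k. if k \<le> i then f k else f (Suc k))"
    proof (cases "k \<le> i")
      case True then show ?thesis using k by (intro image_eqI[of _ _ k]) auto
    next
      case False
      show ?thesis
      proof (cases "k = Suc i")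
        case True then show ?thesis using k assms by (intro image_eqI[of _ _ i]) auto
      next
        case F: False then show ?thesis using k False by (intro image_eqI[of _ _ "k - 1"]) auto
      qed
    qed
  qed
qed auto

lemma conj_fun_remove_duplicate:
  assumes "antimono f" "fin_supp f" "f i = f (Suc i)"
  shows "conj_fun f = add_column (f i) (conj_fun (\<lambda>k. if k \<le> i then f k else f (Suc k)))"
proof
  fix y
  define n where "n = conj_fun f y"
  have n: "y < f k \<longleftrightarrow> k < n" for k
    using less_conj_fun_iff[OF assms(1,2)] by (simp add: n_def)
  have "conj_fun (\<lambda>k. if k \<le> i then f k else f (Suc k)) y = n - (if y < f i then 1 else 0)"
  proof (rule conj_fun_eqI)
    fix k
    have 1: "y < f i \<longleftrightarrow> i < n" and 2: "i < n \<longleftrightarrow> Suc i < n"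
      using n[of i] n[of "Suc i"] assms(3) by auto
    have "y < (if k \<le> i then f k else f (Suc k)) \<longleftrightarrow> (if k \<le> i then k < n else Suc k < n)"
      by (simp add: n)
    then show "y < (if k \<le> i then f k else f (Suc k)) \<longleftrightarrow> k < n - (if y < f i then 1 else 0)"
      unfolding 1 using 2 by (cases "k \<le> i"; cases "i < n"; simp; linarith)
  qed
  then show "conj_fun f y = add_column (f i) (conj_fun (\<lambda>k. if k \<le> i then f k else f (Suc k))) y"
    using n[of i] by (auto simp: add_column_def n_def)
qed

text \<open>Only repeated rows are deleted, so no value is lost. Where the deletions are out of
  step, in the rows from \<open>i\<close> to \<open>j\<close>, row \<open>k\<close> of
  \<open>m\<close> comes to face rows one further down in \<open>l\<close>; \<open>cond\<close> and
  \<open>mj2\<close> are the basic conditions after this shift. If \<open>j < i\<close> the shift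
  goes the other way and monotonicity suffices.\<close>

lemma row_removal:
  assumes ec: "enough_corners n l m"
    and li: "l i = l (Suc i)" "0 < l i" and mj: "m j = m (Suc j)" and le: "m j \<le> l i"
    and cond: "\<And>k. i \<le> k \<Longrightarrow> k < j \<Longrightarrow> m k \<le> l (Suc (Suc k)) \<and> m k < l (Suc k)"
    and mj2: "i < j \<Longrightarrow> m j < l (Suc j)"
  shows "\<exists>l' m'. enough_corners n l' m' \<and> row_move l' m' l m"
proof -
  have bas: "basic_fun l m" using ec by (simp add: enough_corners_def)
  note B = basic_funD[OF bas]
  define l' where "l' = (\<lambda>k. if k \<le> i then l k else l (Suc k))"
  define m' where "m' = (\<lambda>k. if k \<le> j then m k else m (Suc k))"
  have lS: "l (Suc i) \<le> l i" for i using B(1) by (simp add: antimono_Suc_iff)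
  have mS: "m (Suc i) \<le> m i" for i using B(2) by (simp add: antimono_Suc_iff)
  have "antimono l'"
    by (rule antimono_SucI) (use lS in \<open>auto simp: l'_def intro: le_trans\<close>)
  moreover have "antimono m'"
    by (rule antimono_SucI) (use mS in \<open>auto simp: m'_def intro: le_trans\<close>)
  moreover have "fin_supp l'"
  proof -
    obtain N where "\<And>i. i \<ge> N \<Longrightarrow> l i = 0" using B(3) by (auto simp: fin_supp_def)
    then show ?thesis unfolding fin_supp_def by (intro exI[of _ N]) (auto simp: l'_def)
  qed
  moreover have "m' k \<le> l' (Suc k)" for k
  proof -
    consider "k \<le> j" "Suc k \<le> i" | "k < j" "i \<le> k" | "k = j" "i \<le> k" | "j < k" "Suc k \<le> i" | "j < k" "i \<le> k" by linarith
    then show ?thesis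
    proof cases
      case 3 then show ?thesis using mj B(5)[of "Suc k"] by (auto simp: l'_def m'_def)
    next
      case 4 then show ?thesis using mS[of k] B(5)[of k] by (auto simp: l'_def m'_def)
    qed (use B(5)[of k] B(5)[of "Suc k"] cond[of k] in \<open>auto simp: l'_def m'_def\<close>)
  qed
  moreover have "m' k < l' k" if "0 < l' k" for k
  proof -
    consider "k \<le> j" "k \<le> i" | "k < j" "i < k" | "k = j" "i < k" | "j < k" "k \<le> i" | "j < k" "i < k" by linarith
    then show ?thesis
    proof cases
      case 4 then show ?thesis using mS[of k] B(6)[of k] that by (auto simp: l'_def m'_def)
    qed (use B(6)[of k] B(6)[of "Suc k"] cond[of k] mj2 that in \<open>auto simp: l'_def m'_def\<close>)
  qed
  ultimately have "basic_fun l' m'" by (auto simp: basic_fun_def)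
  moreover have "range l' = range l" "range m' = range m"
    unfolding l'_def m'_def by (rule range_remove_duplicate, fact)+
  moreover have "conj_fun l = add_column (l i) (conj_fun l')" "conj_fun m = add_column (m j) (conj_fun m')"
    unfolding l'_def m'_def by (rule conj_fun_remove_duplicate, fact+)+
  ultimately have "enough_corners n l' m'" "row_move l' m' l m"
    using ec le li(2) unfolding enough_corners_def row_move_def num_pos_vals_def num_vals_def by auto
  then show ?thesis by blast
qed


section \<open>Counting steps along a boundary path\<close>

lemma telescope_strict:
  fixes f :: "nat \<Rightarrow> nat"
  assumes "p \<le> q" "\<And>i. p \<le> i \<Longrightarrow> i < q \<Longrightarrow> f (Suc i) < f i"
  shows "f q + (q - p) \<le> f p"
  using assms
proof (induction q)
  case (Suc q)
  show ?case
  proof (cases "p = Suc q")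
    case False
    with Suc.prems(1) have pq: "p \<le> q" by simp
    then have "f q + (q - p) \<le> f p" using Suc.prems(2) by (intro Suc.IH) auto
    with pq Suc.prems(2)[of q] show ?thesis by simp
  qed simp
qed simp

lemma telescope_le:
  fixes f :: "nat \<Rightarrow> nat"
  assumes "p \<le> q" "\<And>i. p \<le> i \<Longrightarrow> i < q \<Longrightarrow> f i \<le> Suc (f (Suc i))"
  shows "f p \<le> f q + (q - p)"
  using assms
proof (induction q)
  case (Suc q)
  show ?case
  proof (cases "p = Suc q")
    case False
    with Suc.prems(1) have pq: "p \<le> q" by simp
    then have "f p \<le> f q + (q - p)" using Suc.prems(2) by (intro Suc.IH) auto
    with pq Suc.prems(2)[of q] show ?thesis by simp
  qed simp
qed simp

section \<open>Shapes without removable columns or rows\<close>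

definition reducible :: "nat \<Rightarrow> (nat \<Rightarrow> nat) \<Rightarrow> (nat \<Rightarrow> nat) \<Rightarrow> bool" where
  "reducible n l m \<longleftrightarrow> (\<exists>r. isolated_box l m r) \<or>
     (\<exists>l' m'. enough_corners n l' m' \<and> (column_move l' m' l m \<or> row_move l' m' l m))"

text \<open>Let neither a column pair nor a row pair be removable, and let there be no isolated box. Then in
  each component the outer path (for \<open>l\<close>) or the inner path (for \<open>m\<close>) has only unit steps. If both kinds
  of components occurred, two adjacent ones would have a removable pair at the point where they
  meet; if only one kind occurs, a pair can be removed because the other path has fewer corners.\<close>

locale irreducible_shape =
  fixes n :: nat and l m :: "nat \<Rightarrow> nat"
  assumes ec: "enough_corners n l m" and irr: "\<not> reducible n l m"
begin

lemma bas: "basic_fun l m" using ec by (simp add: enough_corners_def)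

lemmas B = basic_funD[OF bas]

lemma lS: "l (Suc i) \<le> l i" using B(1) by (simp add: antimono_Suc_iff)

lemma mS: "m (Suc i) \<le> m i" using B(2) by (simp add: antimono_Suc_iff)

lemma pos_mono: "0 < l j \<Longrightarrow> i \<le> j \<Longrightarrow> 0 < l i"
  using antimonoD[OF B(1)] by (meson less_le_trans)

lemma not_isolated:
  assumes "l r = Suc (m r)" "touch l m r" "l (Suc r) = m r"
  shows False
proof -
  have "isolated_box l m r" using assms by (simp add: isolated_box_def touch_def)
  then show False using irr by (auto simp: reducible_def)
qed

lemma no_row_removal:
  assumes "l i = l (Suc i)" "0 < l i" "m j = m (Suc j)" "m j \<le> l i"
    "\<And>k. i \<le> k \<Longrightarrow> k < j \<Longrightarrow> m k \<le> l (Suc (Suc k)) \<and> m k < l (Suc k)"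
    "i < j \<Longrightarrow> m j < l (Suc j)"
  shows False
  using row_removal[OF ec assms] irr by (auto simp: reducible_def)

text \<open>Jumps of at least 2 are demanded so that no values merge. The two staircase cases below,
  where a value may get lost, go back to \<open>column_removal_basic\<close>.\<close>

lemma no_column_removal:
  assumes ab: "b \<le> a" "0 < a" and a: "l a + 2 \<le> l (a - 1)"
    and b: "b = 0 \<or> m b + 2 \<le> m (b - 1)"
    and len: "\<And>i. b \<le> i \<Longrightarrow> i < a \<Longrightarrow> m i + 2 \<le> l i"
    and nt: "\<And>i. b \<le> i \<Longrightarrow> Suc i < a \<Longrightarrow> m i < l (Suc i)"
  shows False
proof -
  have "n \<le> num_pos_vals l" "n \<le> num_vals m" using ec by (auto simp: enough_corners_def)
  moreover have "num_pos_vals l \<le> num_pos_vals (\<lambda>i. l i - (if i < a then 1 else 0))"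
    using a by (intro num_vals_column_removal(1) B(1)) auto
  moreover have "num_vals m \<le> num_vals (\<lambda>i. m i - (if i < b then 1 else 0))"
    using b by (intro num_vals_column_removal(2) B(2))
  ultimately have "\<exists>l' m'. enough_corners n l' m' \<and> column_move l' m' l m"
    using a b by (intro column_removal_basic[OF bas ab _ _ len nt]) auto
  then show False using irr by (auto simp: reducible_def)
qed

text \<open>A single box overlapped from above and below forces \<open>m (r - 1) = m r\<close> and
  \<open>l r = l (Suc r)\<close>, and then row \<open>r\<close> of \<open>l\<close> and row
  \<open>r - 1\<close> of \<open>m\<close> can be deleted.\<close>

lemma thin_row_touches:
  assumes "l r = Suc (m r)"
  shows "touch l m r \<or> touch l m (Suc r)"
proof (rule ccontr)
  assume "\<not> ?thesis"
  then have r: "0 < r" "m (r - 1) \<noteq> l r" "m r \<noteq> l (Suc r)" by (auto simp: touch_def)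
  have "m (r - 1) = m r" using r B(5)[of "r - 1"] mS[of "r - 1"] assms by auto
  moreover have "l r = l (Suc r)" using r B(5)[of r] lS[of r] assms by auto
  ultimately show False
    using r(1) assms by (intro no_row_removal[of r "r - 1"]) auto
qed

text \<open>Two consecutive horizontal steps of the outer path at height \<open>a\<close>, of the inner path at height \<open>b\<close>.\<close>

definition uEE :: "nat \<Rightarrow> bool" where
  "uEE a \<longleftrightarrow> 0 < a \<and> l a + 2 \<le> l (a - 1)"

definition vEE :: "nat \<Rightarrow> bool" where
  "vEE b \<longleftrightarrow> (b = 0 \<or> m b + 2 \<le> m (b - 1)) \<and> m b + 2 \<le> l b"

text \<open>The double steps allow columns of heights \<open>a\<close> and \<open>b\<close> to be
  removed, unless a row in between has a single box. Such a row is not row \<open>b\<close>, by the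
  last clause of \<open>vEE\<close>, nor row \<open>a - 1\<close>, because
  \<open>m (a - 1) \<le> l a\<close>; so it would touch strictly between \<open>b\<close> and
  \<open>a\<close>.\<close>

lemma no_EE_pair:
  assumes "b \<le> a" "uEE a" "vEE b" and nt: "\<And>r. b < r \<Longrightarrow> r < a \<Longrightarrow> \<not> touch l m r"
  shows False
proof (rule no_column_removal[OF assms(1)])
  have posl: "0 < l (a - 1)" using assms(2) by (auto simp: uEE_def)
  show "m i + 2 \<le> l i" if i: "b \<le> i" "i < a" for i
  proof (rule ccontr)
    assume *: "\<not> m i + 2 \<le> l i"
    have "0 < l i" using i by (intro pos_mono[OF posl]) auto
    then have th: "l i = Suc (m i)" using * B(6)[of i] by simp
    have "i \<noteq> b" using * assms(3) by (auto simp: vEE_def)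
    moreover have "i \<noteq> a - 1" using * assms(2) B(5)[of "a - 1"] by (auto simp: uEE_def)
    ultimately show False using thin_row_touches[OF th] nt[of i] nt[of "Suc i"] i by auto
  qed
  show "m i < l (Suc i)" if "b \<le> i" "Suc i < a" for i
    using nt[of "Suc i"] that B(5)[of i] by (auto simp: touch_def)
qed (use assms in \<open>auto simp: uEE_def vEE_def\<close>)

text \<open>Deleting the two repeated rows can only fail if \<open>l (Suc (Suc k)) < m k\<close> for
  a row \<open>k\<close> between them. But then \<open>l\<close> falls by at least 2 at
  \<open>Suc (Suc k)\<close> and \<open>m\<close> by at least 2 at \<open>Suc k\<close>, so a column
  pair is removable.\<close>

lemma no_NN_pair:
  assumes nt: "\<And>r. r1 < r \<Longrightarrow> r < r2 \<Longrightarrow> \<not> touch l m r"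
    and i: "r1 \<le> i" "Suc i < r2" "l i = l (Suc i)" "0 < l i"
    and j: "r1 \<le> j" "Suc j < r2" "m j = m (Suc j)" and le: "m j \<le> l i"
  shows False
proof (rule no_row_removal[OF i(3,4) j(3) le])
  have strict: "m k < l (Suc k)" if "r1 \<le> k" "Suc k < r2" for k
    using nt[of "Suc k"] that B(5)[of k] by (auto simp: touch_def)
  then show "m j < l (Suc j)" using j(1,2) by blast
  fix k assume k: "i \<le> k" "k < j"
  have "m k \<le> l (Suc (Suc k))"
  proof (rule ccontr)
    assume *: "\<not> ?thesis"
    show False
    proof (rule no_EE_pair)
      show "Suc k \<le> Suc (Suc k)" by simp
      show "uEE (Suc (Suc k))" using * strict[of k] k i j by (auto simp: uEE_def)
      show "vEE (Suc k)"
        using * strict[of "Suc k"] strict[of k] k i j by (auto simp: vEE_def)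
    qed auto
  qed
  then show "m k \<le> l (Suc (Suc k)) \<and> m k < l (Suc k)" using strict[of k] k i j by auto
qed

definition unit_u :: "nat \<Rightarrow> nat \<Rightarrow> bool" where
  "unit_u r1 r2 \<longleftrightarrow> (\<forall>i. r1 \<le> i \<longrightarrow> i < r2 \<longrightarrow> l i = Suc (l (Suc i)))"

text \<open>The steps of \<open>m\<close> between the rows of a component do not see its first row,
  hence the extra clause that this row has one box. At a touching row \<open>r1 > 0\<close> it says
  \<open>m (r1 - 1) = Suc (m r1)\<close>, which is how neighbouring runs join.\<close>

definition unit_v :: "nat \<Rightarrow> nat \<Rightarrow> bool" where
  "unit_v r1 r2 \<longleftrightarrow> l r1 = Suc (m r1) \<and> (\<forall>i. r1 \<le> i \<longrightarrow> Suc i < r2 \<longrightarrow> m i = Suc (m (Suc i)))"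

text \<open>Otherwise, by \<open>no_EE_pair\<close>, every double step of \<open>l\<close> lies
  above every double step of \<open>m\<close>. As both paths meet at the ends of the component,
  \<open>m\<close> must repeat a value below \<open>b\<close> and \<open>l\<close> one above
  \<open>a\<close>, and these two rows are removable.\<close>

lemma no_uEE_or_no_vEE:
  assumes t: "touch l m r1" "touch l m r2" and r: "r1 < r2" and pos: "0 < l (r2 - 1)"
    and nt: "\<And>r. r1 < r \<Longrightarrow> r < r2 \<Longrightarrow> \<not> touch l m r"
  shows "(\<forall>a. r1 < a \<longrightarrow> a \<le> r2 \<longrightarrow> \<not> uEE a) \<or> (\<forall>b. r1 \<le> b \<longrightarrow> b < r2 \<longrightarrow> \<not> vEE b)"
proof (rule ccontr)
  assume "\<not> ?thesis"
  then obtain a b where a: "r1 < a" "a \<le> r2" "uEE a" and b: "r1 \<le> b" "b < r2" "vEE b" by blast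
  have strict: "m k < l (Suc k)" if "r1 \<le> k" "Suc k < r2" for k
    using nt[of "Suc k"] that B(5)[of k] by (auto simp: touch_def)
  have lt: "a' < b'" if "r1 < a'" "a' \<le> r2" "uEE a'" "r1 \<le> b'" "b' < r2" "vEE b'" for a' b'
  proof (rule ccontr)
    assume "\<not> ?thesis"
    then show False using that nt by (intro no_EE_pair[of b' a']) auto
  qed
  have ab: "a < b" using lt a b by blast
  have lastm: "m (r2 - 1) = l r2" using t(2) r by (auto simp: touch_def)
  \<comment> \<open>If \<open>m\<close> fell in every row from \<open>b\<close> on, comparison at
    the common end \<open>r2\<close> would give \<open>l b \<le> Suc (m b)\<close>, whereas
    \<open>l b\<close> exceeds \<open>m (b - 1) \<ge> m b + 2\<close>.\<close>
  have "\<exists>j. b \<le> j \<and> Suc j < r2 \<and> m j = m (Suc j)"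
  proof (rule ccontr)
    assume no: "\<not> ?thesis"
    have 1: "m (r2 - 1) + (r2 - 1 - b) \<le> m b"
    proof (rule telescope_strict)
      fix k assume k: "b \<le> k" "k < r2 - 1"
      then have "Suc k < r2" by linarith
      then have "m k \<noteq> m (Suc k)" using no k(1) by blast
      then show "m (Suc k) < m k" using mS[of k] by linarith
    qed (use b in auto)
    have 2: "l b \<le> l r2 + (r2 - b)"
    proof (rule telescope_le)
      fix i assume i: "b \<le> i" "i < r2"
      have "\<not> uEE (Suc i)" using lt[of "Suc i" b] a b ab i by auto
      then show "l i \<le> Suc (l (Suc i))" by (auto simp: uEE_def)
    qed (use b in auto)
    have 3: "m (b - 1) < l b" using strict[of "b - 1"] a b ab by auto
    have 4: "m b + 2 \<le> m (b - 1)" using b ab by (auto simp: vEE_def)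
    show False using 1 2 3 4 lastm b(2) by linarith
  qed
  then obtain j where j: "b \<le> j" "Suc j < r2" "m j = m (Suc j)" by blast
  have "\<exists>i. r1 \<le> i \<and> Suc i < a \<and> l i = l (Suc i)"
  proof (rule ccontr)
    assume no: "\<not> ?thesis"
    have 1: "l (a - 1) + (a - 1 - r1) \<le> l r1"
    proof (rule telescope_strict)
      fix k assume k: "r1 \<le> k" "k < a - 1"
      then have "Suc k < a" by linarith
      then have "l k \<noteq> l (Suc k)" using no k(1) by blast
      then show "l (Suc k) < l k" using lS[of k] by linarith
    qed (use a in auto)
    have 2: "m r1 \<le> m (a - 1) + (a - 1 - r1)"
    proof (rule telescope_le)
      fix i assume i: "r1 \<le> i" "i < a - 1"
      have "r1 \<le> Suc i" "Suc i < r2" "\<not> a < Suc i" using a b ab i by linarith+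
      then have "\<not> vEE (Suc i)" using lt[of a "Suc i"] a by blast
      moreover have "m i \<le> l (Suc i)" by (rule B(5))
      ultimately show "m i \<le> Suc (m (Suc i))" by (auto simp: vEE_def)
    qed (use a in auto)
    \<comment> \<open>At a touching row \<open>m (r1 - 1) = l r1\<close>, so the failure of
      \<open>vEE\<close> just says that the row has at most one box.\<close>
    have "\<not> vEE r1" using lt[of a r1] a b ab by auto
    then have 3: "l r1 \<le> Suc (m r1)" using t(1) by (auto simp: vEE_def touch_def)
    have 4: "m (a - 1) < l a" using strict[of "a - 1"] a b ab by auto
    have 5: "l a + 2 \<le> l (a - 1)" using a by (auto simp: uEE_def)
    show False using 1 2 3 4 5 by linarith
  qed
  then obtain i where i: "r1 \<le> i" "Suc i < a" "l i = l (Suc i)" by blast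
  have "m j \<le> l i"
    using B(7)[of j] antimonoD[OF B(1), of i j] i j ab by simp
  moreover have "0 < l i" using i a by (intro pos_mono[OF pos]) auto
  ultimately show False
    using no_NN_pair[OF nt, of r1 r2 i j] i j ab a b by auto
qed

text \<open>Without double steps \<open>l\<close> falls by at most 1 per row. If it stood still at
  some row, then \<open>m\<close> would have to repeat a value from there on for the paths to meet
  at \<open>r2\<close>, and both rows could be deleted. The other case is the same comparison made
  from the upper end \<open>r1\<close>.\<close>

lemma component_cases:
  assumes t: "touch l m r1" "touch l m r2" and r: "r1 < r2" and pos: "0 < l (r2 - 1)"
    and nt: "\<And>r. r1 < r \<Longrightarrow> r < r2 \<Longrightarrow> \<not> touch l m r"
  shows "unit_u r1 r2 \<or> unit_v r1 r2"
  using no_uEE_or_no_vEE[OF t r pos nt]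
proof
  have posi: "0 < l i" if "i < r2" for i using that by (intro pos_mono[OF pos]) auto
  have lastm: "m (r2 - 1) = l r2" using t(2) r by (auto simp: touch_def)
  {
    assume no: "\<forall>a. r1 < a \<longrightarrow> a \<le> r2 \<longrightarrow> \<not> uEE a"
    have le: "l i \<le> Suc (l (Suc i))" if "r1 \<le> i" "i < r2" for i
      using no[rule_format, of "Suc i"] that by (auto simp: uEE_def)
    have ne: "l i \<noteq> l (Suc i)" if i: "r1 \<le> i" "i < r2" for i
    proof
      assume eq: "l i = l (Suc i)"
      have i2: "Suc i < r2"
      proof (rule ccontr)
        assume "\<not> ?thesis"
        then have "i = r2 - 1" "Suc i = r2" using i by auto
        then show False using eq lastm B(6)[of i] posi[of i] i by auto
      qed
      have "\<exists>j. i \<le> j \<and> Suc j < r2 \<and> m j = m (Suc j)"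
      proof (rule ccontr)
        assume no': "\<not> ?thesis"
        have 1: "m (r2 - 1) + (r2 - 1 - i) \<le> m i"
    proof (rule telescope_strict)
      fix k assume k: "i \<le> k" "k < r2 - 1"
      then have "Suc k < r2" by linarith
      then have "m k \<noteq> m (Suc k)" using no' k(1) by blast
      then show "m (Suc k) < m k" using mS[of k] by linarith
    qed (use i in auto)
        have 2: "l (Suc i) \<le> l r2 + (r2 - Suc i)"
          using le i by (intro telescope_le) auto
        show False using 1 2 eq lastm i B(6)[of i] posi[of i] by linarith
      qed
      then obtain j where j: "i \<le> j" "Suc j < r2" "m j = m (Suc j)" by blast
      have "m j \<le> l i" using B(7)[of j] antimonoD[OF B(1), of i j] j by simp
      then show False using no_NN_pair[OF nt, of r1 r2 i j] i i2 j eq posi[of i] by auto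
    qed
    have "unit_u r1 r2" unfolding unit_u_def
      using le ne lS by (metis le_SucE le_antisym)
    then show ?thesis ..
  next
    assume no: "\<forall>b. r1 \<le> b \<longrightarrow> b < r2 \<longrightarrow> \<not> vEE b"
    have "\<not> vEE r1" using no r by auto
    then have l1: "l r1 = Suc (m r1)"
      using t(1) B(6)[of r1] posi[OF r] by (auto simp: vEE_def touch_def)
    have le: "m i \<le> Suc (m (Suc i))" if "r1 \<le> i" "Suc i < r2" for i
      using no[rule_format, of "Suc i"] that B(5)[of i] by (auto simp: vEE_def)
    have ne: "m j \<noteq> m (Suc j)" if j: "r1 \<le> j" "Suc j < r2" for j
    proof
      assume eq: "m j = m (Suc j)"
      have "\<exists>i. r1 \<le> i \<and> i < Suc j \<and> l i = l (Suc i)"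
      proof (rule ccontr)
        assume no': "\<not> ?thesis"
        have 1: "l (Suc j) + (Suc j - r1) \<le> l r1"
    proof (rule telescope_strict)
      fix k assume k: "r1 \<le> k" "k < Suc j"
      then have "k < Suc j" by linarith
      then have "l k \<noteq> l (Suc k)" using no' k(1) by blast
      then show "l (Suc k) < l k" using lS[of k] by linarith
    qed (use j in auto)
        have 2: "m r1 \<le> m j + (j - r1)"
          using le j by (intro telescope_le) auto
        show False using 1 2 eq l1 j B(6)[of "Suc j"] posi[of "Suc j"] by linarith
      qed
      then obtain i where i: "r1 \<le> i" "i < Suc j" "l i = l (Suc i)" by blast
      have "m j \<le> l i" using B(7)[of j] antimonoD[OF B(1), of i j] i by simp
      then show False using no_NN_pair[OF nt, of r1 r2 i j] i j eq posi[of i] by auto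
    qed
    have "unit_v r1 r2" unfolding unit_v_def
      using le ne mS l1 by (metis le_SucE le_antisym)
    then show ?thesis ..
  }
qed

lemma next_component:
  assumes r: "touch l m r" "0 < l r"
  shows "\<exists>r2>r. touch l m r2 \<and> 0 < l (r2 - 1) \<and> (unit_u r r2 \<or> unit_v r r2)"
proof -
  obtain N where N: "\<And>i. i \<ge> N \<Longrightarrow> l i = 0" using B(3) by (auto simp: fin_supp_def)
  define L where "L = (LEAST i. l i = 0)"
  have L0: "l L = 0" unfolding L_def by (rule LeastI[of "\<lambda>i. l i = 0" N]) (simp add: N)
  have Lpos: "0 < l i" if "i < L" for i
    using not_less_Least[of i "\<lambda>i. l i = 0"] that unfolding L_def by simp
  have rL: "r < L" using r(2) L0 antimonoD[OF B(1), of L r] by (metis leI le_zero_eq less_irrefl)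
  have tL: "touch l m L" using L0 B(5)[of "L - 1"] by (cases L) (auto simp: touch_def)
  define r2 where "r2 = (LEAST k. r < k \<and> touch l m k)"
  have r2: "r < r2" "touch l m r2"
    using LeastI[of "\<lambda>k. r < k \<and> touch l m k" L] rL tL unfolding r2_def by auto
  have r2L: "r2 \<le> L" unfolding r2_def by (rule Least_le) (use rL tL in auto)
  have nt: "\<not> touch l m k" if "r < k" "k < r2" for k
    using not_less_Least[of k "\<lambda>k. r < k \<and> touch l m k"] that unfolding r2_def by simp
  have pos: "0 < l (r2 - 1)" using r2(1) r2L by (intro Lpos) auto
  show ?thesis using component_cases[OF r(1) r2(2,1) pos nt] r2 pos by blast
qed

text \<open>The rows \<open>r - 1\<close> and \<open>r\<close> at the joint have one box each. Not
  being isolated, the first is overlapped from above and the second from below; hence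
  \<open>m\<close> repeats at \<open>r - 2\<close>, \<open>l\<close> repeats at \<open>r\<close>,
  and these rows have the same length.\<close>

lemma unit_u_then_unit_v:
  assumes u: "unit_u 0 r" and r: "0 < r" "touch l m r" "0 < l r" and v: "unit_v r r2"
  shows False
proof -
  have m1: "m (r - 1) = l r" and l1: "l (r - 1) = Suc (l r)"
    using u r by (auto simp: unit_u_def touch_def) 
  have "l (r - 1) = Suc (m (r - 1))" using m1 l1 by metis
  moreover have "l (Suc (r - 1)) = m (r - 1)" using m1 Suc_pred'[OF r(1)] by metis
  ultimately have not0: "\<not> touch l m (r - 1)" using not_isolated by blast
  then have "r \<noteq> 1" by (auto simp: touch_def)
  then have r2: "2 \<le> r" using r(1) by simp
  have "m (r - 2) \<noteq> l (r - 1)" using not0 r2 by (auto simp: touch_def numeral_2_eq_2)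
  moreover have "m (r - 2) \<le> l (r - 1)" using B(5)[of "r - 2"] r2 by (simp add: Suc_diff_le numeral_2_eq_2 Suc_diff_Suc)
  moreover have S: "Suc (r - 2) = r - 1" using r2 by simp
  moreover have "m (r - 1) \<le> m (r - 2)" using mS[of "r - 2"] S by simp
  ultimately have meq: "m (r - 2) = m (Suc (r - 2))" using m1 l1 by simp
  have "l r = Suc (m r)" using v by (simp add: unit_v_def)
  then have leq: "l r = l (Suc r)"
    using not_isolated[of r] r(2) B(5)[of r] lS[of r] by fastforce
  show False
    by (rule no_row_removal[OF leq r(3) meq]) (use S m1 meq in auto)
qed

text \<open>Two columns of equal height \<open>r\<close> are removable: if one of the paths fell by
  only 1 at \<open>r\<close>, then row \<open>r\<close> (for \<open>m\<close>) or row
  \<open>r - 1\<close> (for \<open>l\<close>) would be an isolated box.\<close>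

lemma unit_v_then_unit_u:
  assumes v: "unit_v 0 r" and r: "0 < r" "touch l m r" "0 < l r" and u: "unit_u r r2" "r < r2"
  shows False
proof (rule no_EE_pair[of r r])
  have m1: "m (r - 1) = l r" using r by (auto simp: touch_def)
  have lr: "l r = Suc (l (Suc r))" using u by (simp add: unit_u_def)
  have "l r \<noteq> Suc (m r)" using not_isolated[of r] r(2) lr by auto
  moreover have "m r < l r" using B(6) r(3) by blast
  ultimately have "m r + 2 \<le> l r" by simp
  then show "vEE r" using m1 by (simp add: vEE_def)
  have pos: "0 < l (r - 1)" using r(3) by (rule pos_mono) simp
  have "l (r - 1) \<noteq> Suc (l r)"
  proof
    assume eq: "l (r - 1) = Suc (l r)"
    have "touch l m (r - 1)"
    proof (cases "r = 1")
      case False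
      then have "Suc (r - 1 - 1) = r - 1" "Suc (r - 1 - 1) < r" using r(1) by auto
      moreover have "m i = Suc (m (Suc i))" if "Suc i < r" for i using v that by (simp add: unit_v_def)
      ultimately have "m (r - 1 - 1) = Suc (m (r - 1))" by metis
      then show ?thesis using m1 eq by (simp add: touch_def)
    qed (simp add: touch_def)
    moreover have "l (r - 1) = Suc (m (r - 1))" using m1 eq by metis
    moreover have "l (Suc (r - 1)) = m (r - 1)" using m1 Suc_pred'[OF r(1)] by metis
    ultimately show False using not_isolated by blast
  qed
  moreover have "m (r - 1) < l (r - 1)" using B(6) pos by blast
  ultimately show "uEE r" using m1 r(1) by (simp add: uEE_def)
qed auto

text \<open>Now \<open>l\<close> is the staircase r, r - 1, ..., 1, and taking one box from its
  first row does merge two values. This is harmless: \<open>m 0 \<le> r - 2\<close>, for otherwise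
  the first row is an isolated box, so \<open>m\<close> has at most r - 1 values and
  \<open>n \<le> r - 1\<close>.\<close>

lemma all_unit_u:
  assumes u: "unit_u 0 r" and r: "0 < r" "l r = 0"
  shows False
proof -
  have l: "l i = r - i" for i
  proof (cases "i < r")
    case True
    have step: "l k = Suc (l (Suc k))" if "k < r" for k
      using u that by (simp add: unit_u_def)
    have "l r + (r - i) \<le> l i"
      by (rule telescope_strict) (use True step in auto)
    moreover have "l i \<le> l r + (r - i)"
      by (rule telescope_le) (use True step in auto)
    ultimately show ?thesis using r by simp
  next
    case False then show ?thesis using antimonoD[OF B(1), of r i] r by simp
  qed
  have m0: "m 0 + 2 \<le> l 0"
  proof (rule ccontr)
    assume *: "\<not> ?thesis"
    then have "l 0 = Suc (m 0)" using B(6)[of 0] l[of 0] r by simp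
    then show False using not_isolated[of 0] l[of 0] l[of 1] r by (auto simp: touch_def)
  qed
  define l' where "l' = (\<lambda>i. l i - (if i < 1 then 1 else 0))"
  have "n \<le> card (range m)" using ec by (simp add: enough_corners_def num_vals_def)
  also have "\<dots> \<le> card {..r - 2}"
  proof (rule card_mono)
    have "m i \<le> r - 2" for i using antimonoD[OF B(2), of 0 i] m0 l[of 0] by simp
    then show "range m \<subseteq> {..r - 2}" by auto
  qed simp
  also have "\<dots> = card {1..r - 1}" using m0 l[of 0] by simp
  also have "\<dots> \<le> card (range l' - {0})"
  proof (rule card_mono)
    have "range l' \<subseteq> {..r}" using l by (auto simp: l'_def)
    then show "finite (range l' - {0})" using finite_subset by blast
    show "{1..r - 1} \<subseteq> range l' - {0}"
    proof
      fix v assume v: "v \<in> {1..r - 1}"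
      then have "l' (r - v) = v" using l by (auto simp: l'_def)
      then show "v \<in> range l' - {0}" using v by (metis Diff_iff One_nat_def atLeastAtMost_iff empty_iff insert_iff not_one_le_zero rangeI)
    qed
  qed
  finally have n1: "n \<le> num_pos_vals (\<lambda>i. l i - (if i < 1 then 1 else 0))"
    by (simp add: num_pos_vals_def l'_def)
  have "n \<le> num_vals (\<lambda>i. m i - (if i < 0 then 1 else 0))"
    using ec by (simp add: enough_corners_def)
  then have "\<exists>l' m'. enough_corners n l' m' \<and> column_move l' m' l m"
    using n1 m0 l[of 0] l[of 1] r by (intro column_removal_basic[OF bas, of 0 1]) auto
  then show False using irr by (auto simp: reducible_def)
qed

text \<open>Now \<open>m\<close> is the staircase r - 1, ..., 1, 0. The last row is not an isolated
  box, so the positive values of \<open>l\<close> lie between 2 and r and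
  \<open>n \<le> r - 1\<close>. Hence \<open>m\<close> can afford to lose a value when columns of
  heights \<open>r\<close> and \<open>r - 1\<close> are removed, while \<open>l\<close> loses
  none.\<close>

lemma all_unit_v:
  assumes v: "unit_v 0 r" and r: "0 < r" "l r = 0" "0 < l (r - 1)"
  shows False
proof -
  have mr: "m (r - 1) = 0" using B(5)[of "r - 1"] r by simp
  have m: "m i = r - 1 - i" for i
  proof (cases "i < r")
    case True
    have step: "m k = Suc (m (Suc k))" if "k < r - 1" for k
      using v that by (simp add: unit_v_def)
    have "m (r - 1) + (r - 1 - i) \<le> m i"
      by (rule telescope_strict) (use True step in auto)
    moreover have "m i \<le> m (r - 1) + (r - 1 - i)"
      by (rule telescope_le) (use True step in auto)
    ultimately show ?thesis using mr by simp
  next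
    case False then show ?thesis using antimonoD[OF B(2), of "r - 1" i] mr by simp
  qed
  have l0: "l 0 = r" using v m[of 0] r by (simp add: unit_v_def)
  have lr: "2 \<le> l (r - 1)"
  proof (rule ccontr)
    assume "\<not> ?thesis"
    then have l1: "l (r - 1) = 1" using r by simp
    have "touch l m (r - 1)" using m[of "r - 2"] l1 by (auto simp: touch_def numeral_2_eq_2)
    then show False using not_isolated[of "r - 1"] l1 mr r by auto
  qed
  have lbig: "2 \<le> l i" if "i < r" for i
  proof -
    have "i \<le> r - 1" using that by simp
    from antimonoD[OF B(1) this] show ?thesis using lr by simp
  qed
  have lz: "l i = 0" if "r \<le> i" for i using antimonoD[OF B(1) that] r by simp
  define l' where "l' = (\<lambda>i. l i - (if i < r then 1 else 0))"
  define m' where "m' = (\<lambda>i. m i - (if i < r - 1 then 1 else 0))"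
  have fl: "finite (range l')"
  proof (rule finite_subset)
    have "l' i \<le> r" for i using antimonoD[OF B(1), of 0 i] l0 by (simp add: l'_def)
    then show "range l' \<subseteq> {..r}" by auto
  qed simp
  have pos: "range l - {0} \<subseteq> Suc ` (range l' - {0})"
  proof
    fix v assume "v \<in> range l - {0}"
    then obtain i where i: "v = l i" "l i \<noteq> 0" by auto
    then have "i < r" using lz by (meson not_le)
    then have "l' i \<noteq> 0" "v = Suc (l' i)" using lbig[of i] i by (auto simp: l'_def)
    then show "v \<in> Suc ` (range l' - {0})" by (intro image_eqI[of _ _ "l' i"]) auto
  qed
  have "n \<le> card (range l - {0})" using ec by (simp add: enough_corners_def num_pos_vals_def)
  also have "\<dots> \<le> card (Suc ` (range l' - {0}))" using fl by (intro card_mono pos) simp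
  also have "\<dots> \<le> card (range l' - {0})" using fl by (intro card_image_le) simp
  finally have n1: "n \<le> num_pos_vals (\<lambda>i. l i - (if i < r then 1 else 0))"
    by (simp add: num_pos_vals_def l'_def)
  have "n \<le> card (range l - {0})" using ec by (simp add: enough_corners_def num_pos_vals_def)
  also have "\<dots> \<le> card {2..r}"
  proof (rule card_mono)
    show "range l - {0} \<subseteq> {2..r}"
    proof
      fix v assume "v \<in> range l - {0}"
      then obtain i where i: "v = l i" "l i \<noteq> 0" by auto
      then have "i < r" using lz by (meson not_le)
      then show "v \<in> {2..r}" using lbig[of i] i antimonoD[OF B(1), of 0 i] l0 by auto
    qed
  qed simp
  also have "\<dots> = card {..<r - 1}" using r by simp
  also have "\<dots> \<le> card (range m')"
  proof (rule card_mono)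
    have "range m' \<subseteq> {..r}" using m by (auto simp: m'_def)
    then show "finite (range m')" using finite_subset by blast
    show "{..<r - 1} \<subseteq> range m'"
    proof
      fix v assume v: "v \<in> {..<r - 1}"
      then have "m' (r - 2 - v) = v" using m by (auto simp: m'_def)
      then show "v \<in> range m'" by (metis rangeI)
    qed
  qed
  finally have n2: "n \<le> num_vals (\<lambda>i. m i - (if i < r - 1 then 1 else 0))"
    by (simp add: num_vals_def m'_def)
  have len: "m i + 2 \<le> l i" if "r - 1 \<le> i" "i < r" for i
  proof -
    have "i = r - 1" using that by simp
    then show ?thesis using mr lr by simp
  qed
  have "\<exists>l' m'. enough_corners n l' m' \<and> column_move l' m' l m"
    using n1 n2 r m by (intro column_removal_basic[OF bas, of "r - 1" r] len) auto
  then show False using irr by (auto simp: reducible_def)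
qed

text \<open>Neighbouring components of the same kind merge into one run. A longest initial run ends
  either at the bottom of the diagram, where it is a staircase, or at a joint with a component of
  the other kind; both are excluded.\<close>

lemma empty: "l 0 = 0"
proof (rule ccontr)
  assume "l 0 \<noteq> 0"
  then have l0: "0 < l 0" by simp
  obtain N where N: "\<And>i. i \<ge> N \<Longrightarrow> l i = 0" using B(3) by (auto simp: fin_supp_def)
  have bound: "r \<le> N" if "0 < l (r - 1)" for r
    using N[of "r - 1"] that by (cases "r \<le> N") auto
  have t0: "touch l m 0" by (simp add: touch_def)
  obtain r0 where r0: "r0 > 0" "touch l m r0" "0 < l (r0 - 1)" "unit_u 0 r0 \<or> unit_v 0 r0"
    using next_component[OF t0 l0] by blast
  show False using r0(4)
  proof
    assume u0: "unit_u 0 r0"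
    let ?P = "\<lambda>r. 0 < r \<and> touch l m r \<and> 0 < l (r - 1) \<and> unit_u 0 r"
    define r where "r = (GREATEST r. ?P r)"
    have r: "?P r" unfolding r_def by (rule GreatestI_nat[of ?P r0 N]) (use r0 u0 bound in auto)
    have max: "k \<le> r" if "?P k" for k unfolding r_def by (rule Greatest_le_nat[of ?P k N]) (use that bound in auto)
    show False
    proof (cases "l r = 0")
      case True then show False using all_unit_u[of r] r by auto
    next
      case False
      then obtain r2 where r2: "r2 > r" "touch l m r2" "0 < l (r2 - 1)" "unit_u r r2 \<or> unit_v r r2"
        using next_component[of r] r by auto
      show False using r2(4)
      proof
        assume "unit_u r r2"
        then have "unit_u 0 r2" using r unfolding unit_u_def by (meson le0 not_le)
        then show False using max[of r2] r2 by auto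
      next
        assume "unit_v r r2" then show False using unit_u_then_unit_v[of r r2] r False by auto
      qed
    qed
  next
    assume v0: "unit_v 0 r0"
    let ?P = "\<lambda>r. 0 < r \<and> touch l m r \<and> 0 < l (r - 1) \<and> unit_v 0 r"
    define r where "r = (GREATEST r. ?P r)"
    have r: "?P r" unfolding r_def by (rule GreatestI_nat[of ?P r0 N]) (use r0 v0 bound in auto)
    have max: "k \<le> r" if "?P k" for k unfolding r_def by (rule Greatest_le_nat[of ?P k N]) (use that bound in auto)
    show False
    proof (cases "l r = 0")
      case True then show False using all_unit_v[of r] r by auto
    next
      case False
      then obtain r2 where r2: "r2 > r" "touch l m r2" "0 < l (r2 - 1)" "unit_u r r2 \<or> unit_v r r2"
        using next_component[of r] r by auto
      show False using r2(4)
      proof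
        assume "unit_u r r2" then show False using unit_v_then_unit_u[of r r2] r r2 False by auto
      next
        assume v: "unit_v r r2"
        have "m i = Suc (m (Suc i))" if "Suc i < r2" for i
        proof -
          consider "Suc i < r" | "Suc i = r" | "r \<le> i" by linarith
          then show ?thesis
          proof cases
            case 2 then show ?thesis using r v by (auto simp: touch_def unit_v_def)
          qed (use r v that in \<open>auto simp: unit_v_def\<close>)
        qed
        then have "unit_v 0 r2" using r unfolding unit_v_def by blast
        then show False using max[of r2] r2 by auto
      qed
    qed
  qed
qed

end

lemma reducible_if_nonempty:
  assumes "enough_corners n l m" "l 0 \<noteq> 0"
  shows "reducible n l m"
proof (rule ccontr)
  assume "\<not> reducible n l m"
  then interpret irreducible_shape n l m using assms by unfold_locales
  show False using empty assms by simp
qed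

section \<open>Littlewood-Richardson tableaux as chains of shapes\<close>

text \<open>\<open>\<rho> x i\<close> is the end of the part of row \<open>i\<close> with entries at most \<open>x\<close>, including the boxes of \<open>m\<close>.\<close>

definition strip_chain :: "(nat \<Rightarrow> nat) \<Rightarrow> (nat \<Rightarrow> nat) \<Rightarrow> (nat \<Rightarrow> nat \<Rightarrow> nat) \<Rightarrow> bool" where
  "strip_chain l m \<rho> \<longleftrightarrow> \<rho> 0 = m \<and> (\<forall>x i. \<rho> x i \<le> \<rho> (Suc x) i) \<and>
     (\<forall>x i. \<rho> (Suc x) (Suc i) \<le> \<rho> x i) \<and> (\<exists>N. \<forall>n\<ge>N. \<rho> n = l)"

text \<open>Rows are read from right to left, so within a row the larger letters come first. The
  critical prefixes thus compare the \<open>Suc (Suc k)\<close> in rows up to \<open>i\<close> with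
  the \<open>Suc k\<close> in rows strictly before \<open>i\<close>. The last clause replaces sums
  over all rows by sums that are constant from some point on.\<close>

definition lr_chains ::
    "(nat \<Rightarrow> nat) \<Rightarrow> (nat \<Rightarrow> nat) \<Rightarrow> (nat \<Rightarrow> nat) \<Rightarrow> (nat \<Rightarrow> nat \<Rightarrow> nat) set" where
  "lr_chains l m \<nu> = {\<rho>. strip_chain l m \<rho> \<and>
     (\<forall>k i. (\<Sum>r\<le>i. \<rho> (Suc (Suc k)) r - \<rho> (Suc k) r) \<le> (\<Sum>r<i. \<rho> (Suc k) r - \<rho> k r)) \<and>
     (\<exists>N. \<forall>n\<ge>N. \<forall>k. (\<Sum>r<n. \<rho> (Suc k) r - \<rho> k r) = \<nu> k)}"

lemma strip_chainD:
  assumes "strip_chain l m \<rho>"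
  shows "\<rho> 0 = m" "\<rho> x i \<le> \<rho> (Suc x) i" "\<rho> (Suc x) (Suc i) \<le> \<rho> x i"
  using assms by (auto simp: strip_chain_def)

lemma strip_chain_mono:
  assumes "strip_chain l m \<rho>" "x \<le> y"
  shows "\<rho> x i \<le> \<rho> y i"
  using assms(2) by (rule lift_Suc_mono_le[rotated]) (rule strip_chainD(2)[OF assms(1)])

lemma strip_chain_le:
  assumes "strip_chain l m \<rho>"
  shows "\<rho> x i \<le> l i"
proof -
  obtain N where N: "\<And>n. N \<le> n \<Longrightarrow> \<rho> n = l" using assms unfolding strip_chain_def by blast
  have "\<rho> x i \<le> \<rho> (max x N) i" by (rule strip_chain_mono[OF assms]) simp
  then show ?thesis using N[of "max x N"] by simp
qed

lemma strip_chain_antimono: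
  assumes "strip_chain l m \<rho>" "antimono m"
  shows "antimono (\<rho> x)"
proof (cases x)
  case 0 then show ?thesis using assms strip_chainD(1)[OF assms(1)] by simp
next
  case (Suc y)
  then show ?thesis
    by (intro antimono_SucI) (metis assms(1) le_trans strip_chainD(2,3))
qed

lemma strip_chain_fin_supp:
  assumes "strip_chain l m \<rho>" "fin_supp l"
  shows "fin_supp (\<rho> x)"
  using assms(2) strip_chain_le[OF assms(1)] unfolding fin_supp_def by (metis le_zero_eq)

lemma strip_chain_hstrip:
  assumes "strip_chain l m \<rho>" "antimono m" "i < i'"
  shows "\<rho> (Suc x) i' \<le> \<rho> x i"
proof -
  obtain j where j: "i' = Suc j" "i \<le> j" using assms(3) by (metis less_imp_Suc_add le_add1)
  have "\<rho> (Suc x) i' \<le> \<rho> x j" using strip_chainD(3)[OF assms(1)] j by simp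
  also have "\<dots> \<le> \<rho> x i" using antimonoD[OF strip_chain_antimono[OF assms(1,2)] j(2)] .
  finally show ?thesis .
qed

text \<open>The added boxes carry the letters 1, 2, ..., a - b downwards: row \<open>b + k\<close>
  receives one more \<open>Suc k\<close> and is sorted again. Each new \<open>Suc (Suc k)\<close>
  comes one row below a new \<open>Suc k\<close>, which is what the lattice condition asks
  for.\<close>

lemma lr_chains_add_column:
  assumes ba: "b \<le> a" and l: "fin_supp l"
    and \<rho>: "\<rho> \<in> lr_chains l m \<nu>"
  shows "(\<lambda>x i. \<rho> x i + (if i < a \<and> i < b + x then 1 else 0)) \<in>
    lr_chains (add_column a l) (add_column b m) (add_column (a - b) \<nu>)"
proof -
  define \<rho>' where "\<rho>' = (\<lambda>x i. \<rho> x i + (if i < a \<and> i < b + x then 1 else 0))"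
  have R: "\<rho> 0 = m" "\<And>x i. \<rho> x i \<le> \<rho> (Suc x) i" "\<And>x i. \<rho> (Suc x) (Suc i) \<le> \<rho> x i"
    "\<And>k i. (\<Sum>r\<le>i. \<rho> (Suc (Suc k)) r - \<rho> (Suc k) r) \<le> (\<Sum>r<i. \<rho> (Suc k) r - \<rho> k r)"
    using \<rho> by (auto simp: lr_chains_def strip_chain_def)
  obtain N1 where N1: "\<And>n. N1 \<le> n \<Longrightarrow> \<rho> n = l"
    using \<rho> unfolding lr_chains_def strip_chain_def by blast
  obtain N2 where N2: "\<And>n k. N2 \<le> n \<Longrightarrow> (\<Sum>r<n. \<rho> (Suc k) r - \<rho> k r) = \<nu> k"
    using \<rho> unfolding lr_chains_def by blast
  define N where "N = max N1 N2"
  have N: "\<And>n. N \<le> n \<Longrightarrow> \<rho> n = l" "\<And>n k. N \<le> n \<Longrightarrow> (\<Sum>r<n. \<rho> (Suc k) r - \<rho> k r) = \<nu> k"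
    using N1 N2 by (auto simp: N_def)
  have diff: "\<rho>' (Suc k) r - \<rho>' k r = (\<rho> (Suc k) r - \<rho> k r) + (if r = b + k \<and> b + k < a then 1 else 0)" for k r
    using R(2)[of k r] by (auto simp: \<rho>'_def)
  have sum: "(\<Sum>r\<in>S. \<rho>' (Suc k) r - \<rho>' k r) =
      (\<Sum>r\<in>S. \<rho> (Suc k) r - \<rho> k r) + (if b + k \<in> S \<and> b + k < a then 1 else 0)" if "finite S" for k S
  proof -
    have "(\<Sum>r\<in>S. (if r = b + k \<and> b + k < a then 1 else 0 :: nat)) =
      (if b + k \<in> S \<and> b + k < a then 1 else 0)"
      using that by (cases "b + k < a") (simp_all add: sum.delta)
    then show ?thesis by (simp add: diff sum.distrib)
  qed
  have "\<rho>' 0 = add_column b m" using R(1) ba by (auto simp: \<rho>'_def add_column_def)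
  moreover have "\<rho>' x i \<le> \<rho>' (Suc x) i" "\<rho>' (Suc x) (Suc i) \<le> \<rho>' x i" for x i
    using R(2,3)[of x i] by (auto simp: \<rho>'_def)
  moreover have "(\<Sum>r\<le>i. \<rho>' (Suc (Suc k)) r - \<rho>' (Suc k) r) \<le> (\<Sum>r<i. \<rho>' (Suc k) r - \<rho>' k r)" for k i
    using R(4)[of k i] by (simp add: sum)
  moreover have "\<rho>' n = add_column a l \<and> (\<forall>k. (\<Sum>r<n. \<rho>' (Suc k) r - \<rho>' k r) = add_column (a - b) \<nu> k)"
    if "N + a \<le> n" for n
  proof
    show "\<rho>' n = add_column a l" using N(1)[of n] that by (auto simp: \<rho>'_def add_column_def)
    show "\<forall>k. (\<Sum>r<n. \<rho>' (Suc k) r - \<rho>' k r) = add_column (a - b) \<nu> k"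
      using N(2)[of n] that by (auto simp: add_column_def sum)
  qed
  ultimately show ?thesis unfolding lr_chains_def strip_chain_def \<rho>'_def[symmetric] by blast
qed

lemma inj_lr_chains_add_column:
  "inj (\<lambda>\<rho> x i. \<rho> x i + (if i < a \<and> i < b + x then 1 else (0::nat)))"
  by (rule injI) (auto simp: fun_eq_iff)

lemma lr_chains_strip: "\<rho> \<in> lr_chains l m \<nu> \<Longrightarrow> strip_chain l m \<rho>"
  by (simp add: lr_chains_def)

lemmas lr_chains_mono = strip_chain_mono[OF lr_chains_strip]
lemmas lr_chains_le = strip_chain_le[OF lr_chains_strip]
lemmas lr_chains_hstrip = strip_chain_hstrip[OF lr_chains_strip]

lemma lr_chainsD:
  assumes "\<rho> \<in> lr_chains l m \<nu>"
  shows "\<rho> 0 = m"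
    "(\<Sum>r\<le>i. \<rho> (Suc (Suc x)) r - \<rho> (Suc x) r) \<le> (\<Sum>r<i. \<rho> (Suc x) r - \<rho> x r)"
  using assms by (auto simp: lr_chains_def strip_chain_def)

section \<open>From chains to Littlewood-Richardson tableaux\<close>

lemma take_concat_map_upt:
  "\<exists>i r s. i \<le> n \<and> take p (concat (map f [0..<n])) = concat (map f [0..<i]) @ r \<and>
     (i < n \<longrightarrow> f i = r @ s) \<and> (i = n \<longrightarrow> r = [])"
proof (induction n)
  case (Suc n)
  then obtain i r s where i: "i \<le> n" "take p (concat (map f [0..<n])) = concat (map f [0..<i]) @ r"
    "i < n \<longrightarrow> f i = r @ s" "i = n \<longrightarrow> r = []" by blast
  show ?case
  proof (cases "p \<le> length (concat (map f [0..<n]))")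
    case True
    show ?thesis
    proof (cases "i = n")
      case True
      then show ?thesis using i \<open>p \<le> _\<close>
        by (intro exI[of _ n] exI[of _ "[]"] exI[of _ "f n"]) simp
    next
      case False
      then show ?thesis using i \<open>p \<le> _\<close>
        by (intro exI[of _ i] exI[of _ r] exI[of _ s]) simp
    qed
  next
    case False
    define q where "q = p - length (concat (map f [0..<n]))"
    have "take p (concat (map f [0..<Suc n])) = concat (map f [0..<n]) @ take q (f n)"
      using False by (simp add: q_def)
    then show ?thesis
      by (intro exI[of _ n] exI[of _ "take q (f n)"] exI[of _ "drop q (f n)"]) simp
  qed
qed simp

lemma count_list_concat_map:
  "count_list (concat (map f [0..<n])) v = (\<Sum>i<n. count_list (f i) v)"
  by (induction n) (auto simp: count_list_append)

lemma count_list_rev_map_upt: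
  "count_list (rev (map g [a..<b])) v = card {j. a \<le> j \<and> j < b \<and> g j = v}"
proof -
  have "count_list (rev (map g [a..<b])) v = count_list (map g [a..<b]) v" by simp
  also have "\<dots> = length (filter (\<lambda>j. g j = v) [a..<b])"
    by (induction b) (auto simp: count_list_append)
  also have "\<dots> = card (set (filter (\<lambda>j. g j = v) [a..<b]))"
    by (rule distinct_card[symmetric]) simp
  also have "set (filter (\<lambda>j. g j = v) [a..<b]) = {j. a \<le> j \<and> j < b \<and> g j = v}" by auto
  finally show ?thesis .
qed

definition chain_tableau :: "(nat \<Rightarrow> nat) \<Rightarrow> (nat \<Rightarrow> nat) \<Rightarrow> (nat \<Rightarrow> nat \<Rightarrow> nat) \<Rightarrow> nat \<times> nat \<Rightarrow> nat" where
  "chain_tableau l m \<rho> = (\<lambda>(i, j). if m i \<le> j \<and> j < l i then LEAST x. j < \<rho> x i else undefined)"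

lemma chain_tableau_le_iff:
  assumes \<rho>: "\<rho> \<in> lr_chains l m \<nu>" and ij: "m i \<le> j" "j < l i"
  shows "chain_tableau l m \<rho> (i, j) \<le> x \<longleftrightarrow> j < \<rho> x i"
proof -
  obtain N where N: "\<rho> N = l" using \<rho> unfolding lr_chains_def strip_chain_def by blast
  have T: "chain_tableau l m \<rho> (i, j) = (LEAST x. j < \<rho> x i)"
    using ij by (simp add: chain_tableau_def)
  have L: "j < \<rho> (LEAST x. j < \<rho> x i) i"
    by (rule LeastI[of "\<lambda>x. j < \<rho> x i" N]) (simp add: N ij)
  show ?thesis
  proof
    assume "chain_tableau l m \<rho> (i, j) \<le> x"
    then show "j < \<rho> x i" using L lr_chains_mono[OF \<rho>] unfolding T by (meson less_le_trans)
  next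
    assume "j < \<rho> x i" then show "chain_tableau l m \<rho> (i, j) \<le> x" unfolding T by (rule Least_le)
  qed
qed

lemma chain_tableau_eq_Suc_iff:
  assumes \<rho>: "\<rho> \<in> lr_chains l m \<nu>" and ij: "m i \<le> j" "j < l i"
  shows "chain_tableau l m \<rho> (i, j) = Suc k \<longleftrightarrow> \<rho> k i \<le> j \<and> j < \<rho> (Suc k) i"
  using chain_tableau_le_iff[OF assms, of k] chain_tableau_le_iff[OF assms, of "Suc k"]
  by linarith

lemma chain_tableau_row_count:
  assumes \<rho>: "\<rho> \<in> lr_chains l m \<nu>"
  shows "{j. m i \<le> j \<and> j < l i \<and> chain_tableau l m \<rho> (i, j) = Suc k} = {\<rho> k i..<\<rho> (Suc k) i}"
proof -
  have "m i \<le> \<rho> k i" using lr_chains_mono[OF \<rho>, of 0 k i] lr_chainsD(1)[OF \<rho>] by simp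
  moreover have "\<rho> (Suc k) i \<le> l i" by (rule lr_chains_le[OF \<rho>])
  ultimately show ?thesis
    using chain_tableau_eq_Suc_iff[OF \<rho>, of i _ k] by auto
qed

text \<open>The entry of a box is the first step of the chain that contains it. The entries at most
  \<open>x\<close> then fill \<open>\<rho> x\<close>, so the chain can be read off from the
  tableau.\<close>

lemma card_lr_chains_le_lr_coeff:
  fixes lam mu nu :: "nat list"
  assumes lam: "is_partition lam" and mu: "antimono (part mu)"
  shows "card (lr_chains (part lam) (part mu) (part nu)) \<le> lr_coeff lam mu nu"
    and "finite (lr_chains (part lam) (part mu) (part nu))"
proof -
  let ?X = "lr_chains (part lam) (part mu) (part nu)"
  let ?D = "skew_diagram lam mu"
  let ?t = "chain_tableau (part lam) (part mu)"
  let ?S = "{T. semistandard ?D T \<and> has_content ?D T nu \<and> lattice_word (reverse_row_word lam mu T)}"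
  have D: "(i, j) \<in> ?D \<longleftrightarrow> part mu i \<le> j \<and> j < part lam i" for i j by (simp add: skew_diagram_def)
  have part0: "part lam i = 0" if "length lam \<le> i" for i using that by (simp add: part_def)
  have finD: "finite ?D"
  proof (rule finite_subset)
    show "?D \<subseteq> Sigma {..<length lam} (\<lambda>i. {..<part lam i})"
      using part0 by (auto simp: skew_diagram_def not_le[symmetric])
  qed auto
  have finS: "finite ?S"
  proof (rule finite_subset)
    show "?S \<subseteq> ?D \<rightarrow>\<^sub>E {..length nu}"
    proof
      fix T assume T: "T \<in> ?S"
      then have ext: "T \<in> ?D \<rightarrow>\<^sub>E {0<..}" and c: "has_content ?D T nu" by (auto simp: semistandard_def)
      have "T b \<le> length nu" if b: "b \<in> ?D" for b
      proof (rule ccontr)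
        assume "\<not> ?thesis"
        then obtain k where k: "T b = Suc k" "length nu \<le> k" by (cases "T b") auto
        then have "card {b \<in> ?D. T b = Suc k} = 0" using c by (simp add: has_content_def part_def)
        then have "{b \<in> ?D. T b = Suc k} = {}" using finD by (subst (asm) card_0_eq) auto
        then show False using b k(1) by blast
      qed
      then show "T \<in> ?D \<rightarrow>\<^sub>E {..length nu}" using ext by (auto simp: PiE_iff)
    qed
    show "finite (?D \<rightarrow>\<^sub>E {..length nu})" by (intro finite_PiE finD) auto
  qed
  have sub: "?t ` ?X \<subseteq> ?S"
  proof
    fix T assume "T \<in> ?t ` ?X"
    then obtain \<rho> where \<rho>: "\<rho> \<in> ?X" and T: "T = ?t \<rho>" by auto
    note le_iff = chain_tableau_le_iff[OF \<rho>]
    have m0: "\<rho> 0 = part mu" by (rule lr_chainsD(1)[OF \<rho>])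
    have ext: "T \<in> ?D \<rightarrow>\<^sub>E {0<..}"
    proof (rule PiE_I)
      fix b assume "b \<in> ?D"
      then obtain i j where b: "b = (i, j)" "part mu i \<le> j" "j < part lam i" by (cases b) (simp add: D)
      then show "T b \<in> {0<..}" using le_iff[of i j 0] by (simp add: T m0)
    next
      fix b assume "b \<notin> ?D"
      then show "T b = undefined" by (cases b) (auto simp: T chain_tableau_def D)
    qed
    have row: "T (i, j) \<le> T (i, j')" if "(i, j) \<in> ?D" "(i, j') \<in> ?D" "j < j'" for i j j'
    proof -
      have "j' < \<rho> (T (i, j')) i" using le_iff[of i j' "T (i, j')"] that by (simp add: T D)
      then show ?thesis using le_iff[of i j "T (i, j')"] that by (simp add: T D)
    qed
    have col: "T (i, j) < T (i', j)" if "(i, j) \<in> ?D" "(i', j) \<in> ?D" "i < i'" for i i' j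
    proof -
      have "0 < T (i', j)" using ext that by (auto simp: PiE_iff)
      then obtain k where k: "T (i', j) = Suc k" by (cases "T (i', j)") auto
      have "j < \<rho> (Suc k) i'" using le_iff[of i' j "Suc k"] k that by (simp add: T D)
      also have "\<dots> \<le> \<rho> k i" using lr_chains_hstrip[OF \<rho> mu that(3)] .
      finally have "T (i, j) \<le> k" using le_iff[of i j k] that by (simp add: T D)
      then show ?thesis using k by simp
    qed
    obtain N where N: "\<And>n. N \<le> n \<Longrightarrow> (\<forall>k. (\<Sum>r<n. \<rho> (Suc k) r - \<rho> k r) = part nu k)"
      using \<rho> unfolding lr_chains_def by blast
    have cnt: "card {b \<in> ?D. T b = Suc k} = part nu k" for k
    proof -
      define n where "n = max N (length lam)"
      note eq_iff = chain_tableau_eq_Suc_iff[OF \<rho>, where k=k]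
      have lo: "part mu i \<le> \<rho> k i" for k i using lr_chains_mono[OF \<rho>, of 0 k i] m0 by simp
      have "{b \<in> ?D. T b = Suc k} = Sigma {..<n} (\<lambda>i. {\<rho> k i..<\<rho> (Suc k) i})"
      proof (intro equalityI subsetI)
        fix b assume b: "b \<in> {b \<in> ?D. T b = Suc k}"
        obtain i j where ij: "b = (i, j)" by (cases b)
        have "j < part lam i" using b by (simp add: ij D)
        then have "i < n" using part0[of i] unfolding n_def by (cases "length lam \<le> i") simp_all
        then show "b \<in> Sigma {..<n} (\<lambda>i. {\<rho> k i..<\<rho> (Suc k) i})"
          using b eq_iff[of i j] \<open>j < part lam i\<close> by (auto simp: ij D T)
      next
        fix b assume "b \<in> Sigma {..<n} (\<lambda>i. {\<rho> k i..<\<rho> (Suc k) i})"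
        then obtain i j where ij: "b = (i, j)" "j \<in> {\<rho> k i..<\<rho> (Suc k) i}" by auto
        then show "b \<in> {b \<in> ?D. T b = Suc k}"
          using eq_iff[of i j] lo[of i k] lr_chains_le[OF \<rho>, of "Suc k" i] by (auto simp: D T)
      qed
      then show ?thesis using N[of n] by (simp add: n_def)
    qed
    have lat: "lattice_word (reverse_row_word lam mu T)"
      unfolding lattice_word_def
    proof (intro allI impI)
      fix p k :: nat assume "0 < k"
      then obtain k' where k: "k = Suc k'" by (cases k) auto
      define f where "f = (\<lambda>i. rev (map (\<lambda>j. T (i, j)) [part mu i..<part lam i]))"
      have fc: "count_list (f i) (Suc k) = \<rho> (Suc k) i - \<rho> k i" for i k
        unfolding f_def count_list_rev_map_upt
        using chain_tableau_row_count[OF \<rho>, of i k] by (simp add: T)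
      \<comment> \<open>A prefix consists of the complete rows before \<open>i\<close> and a part of
        row \<open>i\<close>. The larger letter is counted in all of row \<open>i\<close>, the
        smaller one only before it.\<close>
      obtain i r s where irs: "i \<le> length lam"
        "take p (concat (map f [0..<length lam])) = concat (map f [0..<i]) @ r"
        "i < length lam \<longrightarrow> f i = r @ s" "i = length lam \<longrightarrow> r = []"
        using take_concat_map_upt[of "length lam" p f] by blast
      have w: "take p (reverse_row_word lam mu T) = concat (map f [0..<i]) @ r"
        unfolding reverse_row_word_def f_def[symmetric] using irs(2) .
      have "count_list r (Suc k) \<le> count_list (f i) (Suc k)"
        using irs by (cases "i = length lam") (auto simp: count_list_append)
      then have "count_list (take p (reverse_row_word lam mu T)) (Suc k) \<le> (\<Sum>r\<le>i. \<rho> (Suc k) r - \<rho> k r)"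
        unfolding w by (simp add: count_list_append count_list_concat_map fc lessThan_Suc_atMost[symmetric])
      also have "\<dots> \<le> (\<Sum>r<i. \<rho> k r - \<rho> k' r)" using lr_chainsD(2)[OF \<rho>, where x=k' and i=i] k by simp
      also have "\<dots> \<le> count_list (take p (reverse_row_word lam mu T)) k"
        unfolding w by (simp add: count_list_append count_list_concat_map fc k)
      finally show "count_list (take p (reverse_row_word lam mu T)) (Suc k) \<le>
        count_list (take p (reverse_row_word lam mu T)) k" .
    qed
    show "T \<in> ?S" using ext row col cnt lat by (simp add: semistandard_def has_content_def)
  qed
  have inj: "inj_on ?t ?X"
  proof (rule inj_onI, rule ext, rule ext)
    fix \<rho> \<rho>' x i assume R: "\<rho> \<in> ?X" "\<rho>' \<in> ?X" "?t \<rho> = ?t \<rho>'"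
    have lo: "part mu i \<le> \<rho> x i" if "\<rho> \<in> ?X" for \<rho>
      using lr_chains_mono[OF that, of 0 x i] lr_chainsD(1)[OF that] by simp
    have "j < \<rho> x i \<longleftrightarrow> j < \<rho>' x i" for j
    proof (cases "part mu i \<le> j \<and> j < part lam i")
      case True
      then show ?thesis
        using chain_tableau_le_iff[OF R(1), of i j x] chain_tableau_le_iff[OF R(2), of i j x] R(3) by simp
    next
      case False
      then show ?thesis
        using lo[OF R(1)] lo[OF R(2)] lr_chains_le[OF R(1), of x i] lr_chains_le[OF R(2), of x i] by auto
    qed
    then show "\<rho> x i = \<rho>' x i" by (metis linorder_neqE_nat less_irrefl)
  qed
  show "finite ?X" using inj sub finS by (rule inj_on_finite)
  show "card ?X \<le> lr_coeff lam mu nu"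
    unfolding lr_coeff_def using inj sub finS by (rule card_inj_on_le)
qed

section \<open>Reading tableaux by columns\<close>

definition letter_boxes :: "(nat \<Rightarrow> nat \<Rightarrow> nat) \<Rightarrow> nat \<Rightarrow> (nat \<times> nat) set" where
  "letter_boxes \<rho> k = {(i, j). \<rho> k i \<le> j \<and> j < \<rho> (Suc k) i}"

text \<open>\<open>col_state \<rho> y\<close> is the content of the columns from \<open>y\<close> on, and \<open>col_height\<close> recovers the
  columns of the shape \<open>\<rho> x\<close> from these contents.\<close>

definition col_state :: "(nat \<Rightarrow> nat \<Rightarrow> nat) \<Rightarrow> nat \<Rightarrow> nat \<Rightarrow> nat" where
  "col_state \<rho> y k = card {b \<in> letter_boxes \<rho> k. y \<le> snd b}"

definition col_height :: "(nat \<Rightarrow> nat) \<Rightarrow> (nat \<Rightarrow> nat \<Rightarrow> nat) \<Rightarrow> nat \<Rightarrow> nat \<Rightarrow> nat" where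
  "col_height B \<kappa> x y = B y + (\<Sum>k<x. \<kappa> y k - \<kappa> (Suc y) k)"

text \<open>A tableau as the shrinking contents of its columns from \<open>y\<close> on. Consecutive
  contents differ by a vertical strip because a column contains a letter at most once; that each
  content is a partition is the lattice property read by columns; decreasing
  \<open>col_height\<close> means weak increase along rows. \<open>A\<close> and \<open>B\<close>
  are the column heights of the outer and inner shape.\<close>

definition lr_columns ::
    "(nat \<Rightarrow> nat) \<Rightarrow> (nat \<Rightarrow> nat) \<Rightarrow> (nat \<Rightarrow> nat) \<Rightarrow> (nat \<Rightarrow> nat \<Rightarrow> nat) set" where
  "lr_columns A B \<nu> = {\<kappa>. \<kappa> 0 = \<nu> \<and> (\<forall>y k. \<kappa> (Suc y) k \<le> \<kappa> y k \<and> \<kappa> y k \<le> Suc (\<kappa> (Suc y) k)) \<and>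
     (\<forall>y k. \<kappa> y (Suc k) \<le> \<kappa> y k) \<and>
     (\<forall>x y. col_height B \<kappa> x (Suc y) \<le> col_height B \<kappa> x y) \<and>
     (\<exists>N. \<forall>n\<ge>N. (\<forall>k. \<kappa> n k = 0) \<and> (\<forall>y. col_height B \<kappa> n y = A y))}"

context
  fixes l m :: "nat \<Rightarrow> nat" and \<rho> :: "nat \<Rightarrow> nat \<Rightarrow> nat"
  assumes m: "antimono m" and l: "fin_supp l" and ch: "strip_chain l m \<rho>"
begin

lemma finite_letter_boxes: "finite (letter_boxes \<rho> k)"
proof -
  obtain N where N: "\<And>i. i \<ge> N \<Longrightarrow> l i = 0" using l by (auto simp: fin_supp_def)
  show ?thesis
  proof (rule finite_subset)
    show "letter_boxes \<rho> k \<subseteq> Sigma {..<N} (\<lambda>i. {..<l i})"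
    proof
      fix b assume "b \<in> letter_boxes \<rho> k"
      then obtain i j where b: "b = (i, j)" "j < \<rho> (Suc k) i" by (auto simp: letter_boxes_def)
      then have "j < l i" using strip_chain_le[OF ch, of "Suc k" i] by simp
      moreover then have "i < N" using N[of i] by (cases "N \<le> i") auto
      ultimately show "b \<in> Sigma {..<N} (\<lambda>i. {..<l i})" using b by simp
    qed
  qed simp
qed

lemma card_letter_boxes_rows:
  "card {b \<in> letter_boxes \<rho> k. fst b < i} = (\<Sum>r<i. \<rho> (Suc k) r - \<rho> k r)"
proof -
  have "{b \<in> letter_boxes \<rho> k. fst b < i} = Sigma {..<i} (\<lambda>r. {\<rho> k r..<\<rho> (Suc k) r})"
    by (auto simp: letter_boxes_def)
  then show ?thesis by simp
qed

lemmas rho_antimono = strip_chain_antimono[OF ch m]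
lemmas rho_fin = strip_chain_fin_supp[OF ch l]
lemmas less_conj_rho_iff = less_conj_fun_iff[OF rho_antimono rho_fin]

lemma letter_boxes_column: "{i. (i, y) \<in> letter_boxes \<rho> k} = {conj_fun (\<rho> k) y..<conj_fun (\<rho> (Suc k)) y}"
  using less_conj_rho_iff by (auto simp: letter_boxes_def not_less[symmetric])

lemma conj_rho_step:
  "conj_fun (\<rho> k) y \<le> conj_fun (\<rho> (Suc k)) y" "conj_fun (\<rho> (Suc k)) y \<le> Suc (conj_fun (\<rho> k) y)"
proof -
  show "conj_fun (\<rho> k) y \<le> conj_fun (\<rho> (Suc k)) y"
    using less_conj_rho_iff strip_chainD(2)[OF ch] by (meson leI less_irrefl less_le_trans)
  show "conj_fun (\<rho> (Suc k)) y \<le> Suc (conj_fun (\<rho> k) y)"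
  proof (rule ccontr)
    assume "\<not> ?thesis"
    then have "Suc (conj_fun (\<rho> k) y) < conj_fun (\<rho> (Suc k)) y" by simp
    then have "y < \<rho> (Suc k) (Suc (conj_fun (\<rho> k) y))" using less_conj_rho_iff by simp
    also have "\<dots> \<le> \<rho> k (conj_fun (\<rho> k) y)" using strip_chainD(3)[OF ch] .
    finally show False using less_conj_rho_iff[of "conj_fun (\<rho> k) y" k y] by simp
  qed
qed

lemma col_state_step:
  "col_state \<rho> y k = col_state \<rho> (Suc y) k + (conj_fun (\<rho> (Suc k)) y - conj_fun (\<rho> k) y)"
proof -
  have "{b \<in> letter_boxes \<rho> k. y \<le> snd b} =
    {b \<in> letter_boxes \<rho> k. Suc y \<le> snd b} \<union> (\<lambda>i. (i, y)) ` {i. (i, y) \<in> letter_boxes \<rho> k}" (is "_ = ?a \<union> ?b")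
  proof (intro equalityI subsetI)
    fix b assume "b \<in> {b \<in> letter_boxes \<rho> k. y \<le> snd b}"
    then show "b \<in> ?a \<union> ?b" by (cases b; cases "snd b = y") auto
  qed auto
  moreover have "card (?a \<union> ?b) = card ?a + card ?b"
    using finite_letter_boxes by (intro card_Un_disjoint) (auto simp: letter_boxes_column)
  moreover have "card ?b = conj_fun (\<rho> (Suc k)) y - conj_fun (\<rho> k) y"
    by (simp add: letter_boxes_column card_image inj_on_def)
  ultimately show ?thesis by (simp add: col_state_def)
qed

lemma col_state_eventually: "\<exists>N. \<forall>n\<ge>N. \<forall>k. col_state \<rho> n k = 0"
proof (intro exI allI impI)
  fix n k assume n: "l 0 \<le> n"
  have "{b \<in> letter_boxes \<rho> k. n \<le> snd b} = {}"
  proof (rule ccontr)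
    assume "\<not> ?thesis"
    then obtain i j where "n \<le> j" "j < \<rho> (Suc k) i" by (auto simp: letter_boxes_def)
    moreover have "\<rho> (Suc k) i \<le> \<rho> (Suc k) 0" using antimonoD[OF rho_antimono] by simp
    ultimately show False using strip_chain_le[OF ch, of "Suc k" 0] n by simp
  qed
  then show "col_state \<rho> n k = 0" unfolding col_state_def by (simp only: card.empty)
qed

lemma col_height_col_state: "col_height (conj_fun m) (col_state \<rho>) x y = conj_fun (\<rho> x) y"
proof (induction x)
  case 0 then show ?case using strip_chainD(1)[OF ch] by (simp add: col_height_def)
next
  case (Suc x)
  then show ?case using col_state_step[of y x] conj_rho_step(1)[of x y] by (simp add: col_height_def)
qed

text \<open>Both directions compare the boxes lying outside the two regions in question.\<close>

lemma row_lattice_iff_column_lattice: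
  "(\<forall>i. (\<Sum>r\<le>i. \<rho> (Suc (Suc k)) r - \<rho> (Suc k) r) \<le> (\<Sum>r<i. \<rho> (Suc k) r - \<rho> k r)) \<longleftrightarrow>
   (\<forall>y. col_state \<rho> y (Suc k) \<le> col_state \<rho> y k)" (is "?row \<longleftrightarrow> ?col")
proof -
  let ?a = "letter_boxes \<rho> k" and ?b = "letter_boxes \<rho> (Suc k)"
  have fin: "finite ?a" "finite ?b" by (rule finite_letter_boxes)+
  have row: "?row \<longleftrightarrow> (\<forall>i. card {b \<in> ?b. fst b < Suc i} \<le> card {b \<in> ?a. fst b < i})"
    by (simp add: card_letter_boxes_rows lessThan_Suc_atMost)
  show ?thesis
  proof
    assume col: ?col
    show ?row unfolding row
    proof
      fix i
      let ?P = "{b \<in> ?b. fst b < Suc i}"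
      show "card ?P \<le> card {b \<in> ?a. fst b < i}"
      proof (cases "?P = {}")
        case True show ?thesis unfolding True by simp
      next
        case False
        \<comment> \<open>The leftmost column with a \<open>Suc (Suc k)\<close> in the rows up to
          \<open>i\<close>, say in row \<open>r0\<close>. From row \<open>r0\<close> on, every
          \<open>Suc k\<close> lies left of this column, so the \<open>Suc k\<close> in columns from
          \<open>y\<close> on are all above row \<open>i\<close>.\<close>
        define y where "y = Min (snd ` ?P)"
        have finP: "finite ?P" using fin by simp
        then have "y \<in> snd ` ?P" unfolding y_def using False by (intro Min_in) auto
        then obtain r0 where r0: "(r0, y) \<in> ?b" "r0 \<le> i" by auto
        have "card ?P \<le> col_state \<rho> y (Suc k)"
          unfolding col_state_def
        proof (rule card_mono)
          have "y \<le> snd b" if "b \<in> ?P" for b unfolding y_def using finP that by (intro Min_le) auto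
          then show "?P \<subseteq> {b \<in> ?b. y \<le> snd b}" by blast
        qed (use fin in simp)
        also have "\<dots> \<le> col_state \<rho> y k" using col by blast
        also have "\<dots> \<le> card {b \<in> ?a. fst b < i}"
          unfolding col_state_def
        proof (rule card_mono)
          show "{b \<in> ?a. y \<le> snd b} \<subseteq> {b \<in> ?a. fst b < i}"
          proof safe
            fix r j assume rj: "(r, j) \<in> ?a" "y \<le> snd (r, j)"
            show "fst (r, j) < i"
            proof (rule ccontr)
              assume "\<not> ?thesis"
              then have "\<rho> (Suc k) r \<le> \<rho> (Suc k) r0" using r0 by (intro antimonoD[OF rho_antimono]) auto
              then show False using rj r0 by (auto simp: letter_boxes_def)
            qed
          qed
        qed (use fin in simp)
        finally show ?thesis .
      qed
    qed
  next
    assume row': ?row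
    show ?col
    proof
      fix y
      let ?Q = "{b \<in> ?b. y \<le> snd b}"
      show "col_state \<rho> y (Suc k) \<le> col_state \<rho> y k"
      proof (cases "?Q = {}")
        case True then show ?thesis unfolding col_state_def True card.empty by simp
      next
        case False
        define i where "i = Max (fst ` ?Q)"
        have finQ: "finite ?Q" using fin by simp
        then have "i \<in> fst ` ?Q" unfolding i_def using False by (intro Max_in) auto
        then obtain j0 where j0: "(i, j0) \<in> ?b" "y \<le> j0" by auto
        have imax: "fst b \<le> i" if "b \<in> ?Q" for b unfolding i_def using finQ that by (intro Max_ge) auto
        let ?b1 = "{b \<in> ?b. fst b < Suc i \<and> snd b < y}" and ?a1 = "{b \<in> ?a. fst b < i \<and> snd b < y}"
        let ?a2 = "{b \<in> ?a. fst b < i \<and> y \<le> snd b}"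
        have e1: "{b \<in> ?b. fst b < Suc i} = ?Q \<union> ?b1" using imax by (auto simp: less_Suc_eq_le not_le)
        have e2: "card (?Q \<union> ?b1) = card ?Q + card ?b1" using fin by (intro card_Un_disjoint) auto
        have e3: "{b \<in> ?a. fst b < i} = ?a2 \<union> ?a1" by auto
        have e4: "card (?a2 \<union> ?a1) = card ?a2 + card ?a1" using fin by (intro card_Un_disjoint) auto
        have "card {b \<in> ?b. fst b < Suc i} \<le> card {b \<in> ?a. fst b < i}" using row' unfolding row by blast
        then have "card ?Q + card ?b1 \<le> card ?a2 + card ?a1" unfolding e1 e2 e3 e4 .
        \<comment> \<open>Below a \<open>Suc k\<close> that is left of \<open>y\<close> and above
          row \<open>i\<close> there is a \<open>Suc (Suc k)\<close> in row \<open>i\<close>: by the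
          strip condition row \<open>i\<close> is past \<open>Suc k\<close> there, and it still
          contains \<open>Suc (Suc k)\<close> at the later column \<open>j0\<close>. A column has at
          most one \<open>Suc k\<close>, so this is injective.\<close>
        moreover have "card ?a1 \<le> card ?b1"
        proof (rule card_inj_on_le[of "\<lambda>b. (i, snd b)"])
          show "inj_on (\<lambda>b. (i, snd b)) ?a1"
          proof (rule inj_onI, clarsimp)
            fix r r' j assume rr: "(r, j) \<in> ?a" "(r', j) \<in> ?a"
            show "r = r'"
            proof (rule ccontr)
              assume "r \<noteq> r'"
              then consider "r < r'" | "r' < r" by linarith
              then show False
                using strip_chain_hstrip[OF ch m, of r r' k] strip_chain_hstrip[OF ch m, of r' r k] rr
                by cases (auto simp: letter_boxes_def)
            qed
          qed
          show "(\<lambda>b. (i, snd b)) ` ?a1 \<subseteq> ?b1"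
          proof safe
            fix r j assume rj: "(r, j) \<in> ?a" "fst (r, j) < i" "snd (r, j) < y"
            then have "\<rho> (Suc k) i \<le> j"
              using strip_chain_hstrip[OF ch m, of r i k] by (auto simp: letter_boxes_def)
            then show "(i, snd (r, j)) \<in> ?b" using rj j0 by (auto simp: letter_boxes_def)
          qed auto
          show "finite ?b1" using fin by simp
        qed
        moreover have "card ?a2 \<le> col_state \<rho> y k"
          unfolding col_state_def using fin by (intro card_mono) auto
        ultimately show ?thesis by (simp add: col_state_def)
      qed
    qed
  qed
qed

lemma content_iff:
  "(\<exists>N. \<forall>n\<ge>N. \<forall>k. (\<Sum>r<n. \<rho> (Suc k) r - \<rho> k r) = \<nu> k) \<longleftrightarrow> col_state \<rho> 0 = \<nu>"
proof -
  obtain N where N: "\<And>i. i \<ge> N \<Longrightarrow> l i = 0" using l by (auto simp: fin_supp_def)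
  have all: "(\<Sum>r<n. \<rho> (Suc k) r - \<rho> k r) = col_state \<rho> 0 k" if n: "N \<le> n" for n k
  proof -
    have "fst b < n" if "b \<in> letter_boxes \<rho> k" for b
    proof (rule ccontr)
      assume "\<not> ?thesis"
      then have "l (fst b) = 0" using n by (intro N) simp
      then have "\<rho> (Suc k) (fst b) = 0" using strip_chain_le[OF ch, of "Suc k" "fst b"] by simp
      then show False using that by (auto simp: letter_boxes_def)
    qed
    then have "{b \<in> letter_boxes \<rho> k. fst b < n} = {b \<in> letter_boxes \<rho> k. 0 \<le> snd b}" by auto
    then show ?thesis by (simp add: card_letter_boxes_rows[symmetric] col_state_def)
  qed
  show ?thesis
  proof
    assume "\<exists>N. \<forall>n\<ge>N. \<forall>k. (\<Sum>r<n. \<rho> (Suc k) r - \<rho> k r) = \<nu> k"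
    then obtain M where "\<And>n k. M \<le> n \<Longrightarrow> (\<Sum>r<n. \<rho> (Suc k) r - \<rho> k r) = \<nu> k" by blast
    then show "col_state \<rho> 0 = \<nu>" using all[of "max N M"] by (intro ext) simp
  next
    assume "col_state \<rho> 0 = \<nu>"
    then show "\<exists>N. \<forall>n\<ge>N. \<forall>k. (\<Sum>r<n. \<rho> (Suc k) r - \<rho> k r) = \<nu> k" using all by blast
  qed
qed

lemma mem_lr_chains_iff:
  "\<rho> \<in> lr_chains l m \<nu> \<longleftrightarrow> (\<forall>y k. col_state \<rho> y (Suc k) \<le> col_state \<rho> y k) \<and> col_state \<rho> 0 = \<nu>"
  unfolding lr_chains_def mem_Collect_eq content_iff row_lattice_iff_column_lattice using ch by blast

lemma col_state_in_lr_columns: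
  assumes "\<rho> \<in> lr_chains l m \<nu>"
  shows "col_state \<rho> \<in> lr_columns (conj_fun l) (conj_fun m) \<nu>"
proof -
  have "col_state \<rho> (Suc y) k \<le> col_state \<rho> y k \<and> col_state \<rho> y k \<le> Suc (col_state \<rho> (Suc y) k)" for y k
    using col_state_step[of y k] conj_rho_step[of k y] by linarith
  moreover have "col_height (conj_fun m) (col_state \<rho>) x (Suc y) \<le> col_height (conj_fun m) (col_state \<rho>) x y" for x y
    unfolding col_height_col_state using antimonoD[OF antimono_conj_fun[OF rho_antimono rho_fin]] by simp
  moreover obtain N where "\<And>n k. N \<le> n \<Longrightarrow> col_state \<rho> n k = 0" using col_state_eventually by blast
  moreover obtain M where "\<And>n. M \<le> n \<Longrightarrow> \<rho> n = l" using ch unfolding strip_chain_def by blast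
  ultimately show ?thesis
    using assms unfolding mem_lr_chains_iff lr_columns_def mem_Collect_eq
    by (intro conjI exI[of _ "max N M"]) (auto simp: col_height_col_state)
qed

end

section \<open>Recovering a tableau from its column contents\<close>

lemma lr_columnsD:
  assumes "\<kappa> \<in> lr_columns A B \<nu>"
  shows "\<kappa> 0 = \<nu>" "\<kappa> (Suc y) k \<le> \<kappa> y k" "\<kappa> y k \<le> Suc (\<kappa> (Suc y) k)" "\<kappa> y (Suc k) \<le> \<kappa> y k"
    "col_height B \<kappa> x (Suc y) \<le> col_height B \<kappa> x y"
    "\<exists>N. \<forall>n\<ge>N. (\<forall>k. \<kappa> n k = 0) \<and> (\<forall>y. col_height B \<kappa> n y = A y)"
  using assms by (auto simp: lr_columns_def)

text \<open>The heights \<open>\<pi> x\<close> are the columns of the intermediate shapes, so the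
  chain consists of their conjugates; growth by at most one per column becomes the horizontal strip
  condition.\<close>

lemma lr_columns_eq_col_state:
  assumes l: "antimono l" "fin_supp l" and m: "antimono m" "fin_supp m"
    and \<kappa>: "\<kappa> \<in> lr_columns (conj_fun l) (conj_fun m) \<nu>"
  shows "\<exists>\<rho>\<in>lr_chains l m \<nu>. col_state \<rho> = \<kappa>"
proof -
  note K = lr_columnsD[OF \<kappa>]
  define \<pi> where "\<pi> = col_height (conj_fun m) \<kappa>"
  obtain N where N: "\<And>n k. N \<le> n \<Longrightarrow> \<kappa> n k = 0" "\<And>n y. N \<le> n \<Longrightarrow> \<pi> n y = conj_fun l y"
    using K(6) unfolding \<pi>_def by blast
  have pi_step: "\<pi> (Suc x) y = \<pi> x y + (\<kappa> y x - \<kappa> (Suc y) x)" for x y by (simp add: \<pi>_def col_height_def)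
  have mono: "\<pi> x y \<le> \<pi> x' y" if "x \<le> x'" for x x' y
    using that by (rule lift_Suc_mono_le[rotated]) (simp add: pi_step)
  have le: "\<pi> x y \<le> conj_fun l y" for x y
    using mono[of x "max x N" y] N(2)[of "max x N" y] by simp
  have anti: "antimono (\<pi> x)" for x
    by (rule antimono_SucI) (use K(5) in \<open>simp add: \<pi>_def\<close>)
  have fin: "fin_supp (\<pi> x)" for x
    using fin_supp_conj_fun[OF l] le unfolding fin_supp_def by (metis le_zero_eq)
  define \<rho> where "\<rho> = (\<lambda>x. conj_fun (\<pi> x))"
  have iff: "i < \<pi> x y \<longleftrightarrow> y < \<rho> x i" for i x y
    unfolding \<rho>_def using less_conj_fun_iff[OF anti fin] by blast
  have conj: "conj_fun (\<rho> x) = \<pi> x" for x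
    unfolding \<rho>_def by (rule conj_fun_conj_fun[OF anti fin])
  have ch: "strip_chain l m \<rho>"
    unfolding strip_chain_def
  proof (intro conjI allI exI[of _ N] impI)
    have "\<pi> 0 = conj_fun m" by (auto simp: \<pi>_def col_height_def)
    then show "\<rho> 0 = m" by (simp add: \<rho>_def conj_fun_conj_fun[OF m])
    fix x i
    show "\<rho> x i \<le> \<rho> (Suc x) i"
    proof (rule ccontr)
      assume "\<not> ?thesis"
      then have "i < \<pi> x (\<rho> (Suc x) i)" using iff by simp
      then have "i < \<pi> (Suc x) (\<rho> (Suc x) i)" by (simp add: pi_step)
      then show False using iff by simp
    qed
    show "\<rho> (Suc x) (Suc i) \<le> \<rho> x i"
    proof (rule ccontr)
      assume "\<not> ?thesis"
      then have "Suc i < \<pi> (Suc x) (\<rho> x i)" using iff by simp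
      then have "i < \<pi> x (\<rho> x i)" using K(3)[of "\<rho> x i" x] by (simp add: pi_step)
      then show False using iff by simp
    qed
  next
    fix n assume "N \<le> n"
    then have "\<pi> n = conj_fun l" using N(2) by blast
    then show "\<rho> n = l" by (simp add: \<rho>_def conj_fun_conj_fun[OF l])
  qed
  have eq: "col_state \<rho> = \<kappa>"
  proof (intro ext)
    fix y k
    obtain M where M: "\<And>n. M \<le> n \<Longrightarrow> col_state \<rho> n k = 0"
      using col_state_eventually[OF m(1) l(2) ch] by blast
    show "col_state \<rho> y k = \<kappa> y k"
    proof (cases "y \<le> max N M")
      case True
      then show ?thesis
      \<comment> \<open>Both sequences vanish far to the right and have the same differences, so
        they agree going back.\<close>
      proof (induction y rule: inc_induct)
        case base then show ?case using M[of "max N M"] N(1)[of "max N M" k] by simp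
      next
        case (step y)
        have "col_state \<rho> y k = col_state \<rho> (Suc y) k + (\<pi> (Suc k) y - \<pi> k y)"
          using col_state_step[OF m(1) l(2) ch, of y k] unfolding conj .
        also have "\<pi> (Suc k) y - \<pi> k y = \<kappa> y k - \<kappa> (Suc y) k"
          by (simp add: pi_step)
        finally show ?case using step.IH K(2)[of y k] by simp
      qed
    next
      case False then show ?thesis using M[of y] N(1)[of y k] by simp
    qed
  qed
  have "\<rho> \<in> lr_chains l m \<nu>"
    unfolding mem_lr_chains_iff[OF m(1) l(2) ch] eq using K by blast
  with eq show ?thesis by blast
qed

lemma bij_betw_col_state:
  assumes l: "antimono l" "fin_supp l" and m: "antimono m" "fin_supp m"
  shows "bij_betw col_state (lr_chains l m \<nu>) (lr_columns (conj_fun l) (conj_fun m) \<nu>)"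
  unfolding bij_betw_def
proof (intro conjI equalityI subsetI)
  show "inj_on col_state (lr_chains l m \<nu>)"
  proof (rule inj_onI, rule ext)
    fix \<rho> \<rho>' x assume R: "\<rho> \<in> lr_chains l m \<nu>" "\<rho>' \<in> lr_chains l m \<nu>" and eq: "col_state \<rho> = col_state \<rho>'"
    note S = lr_chains_strip[OF R(1)] lr_chains_strip[OF R(2)]
    have "conj_fun (\<rho> x) = conj_fun (\<rho>' x)"
      using col_height_col_state[OF m(1) l(2) S(1), of x] col_height_col_state[OF m(1) l(2) S(2), of x] eq by auto
    then show "\<rho> x = \<rho>' x"
      using conj_fun_conj_fun[OF strip_chain_antimono[OF S(1) m(1)] strip_chain_fin_supp[OF S(1) l(2)], of x]
        conj_fun_conj_fun[OF strip_chain_antimono[OF S(2) m(1)] strip_chain_fin_supp[OF S(2) l(2)], of x] by metis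
  qed
next
  fix \<kappa> assume "\<kappa> \<in> col_state ` lr_chains l m \<nu>"
  then show "\<kappa> \<in> lr_columns (conj_fun l) (conj_fun m) \<nu>"
    using col_state_in_lr_columns[OF m(1) l(2) lr_chains_strip] by auto
next
  fix \<kappa> assume "\<kappa> \<in> lr_columns (conj_fun l) (conj_fun m) \<nu>"
  then show "\<kappa> \<in> col_state ` lr_chains l m \<nu>" using lr_columns_eq_col_state[OF l m] by blast
qed

section \<open>Insertion of a row\<close>

text \<open>Sorted insertion of the part \<open>q\<close>: position \<open>k\<close> holds
  \<open>f k\<close> as long as \<open>f k \<ge> q\<close>, then \<open>q\<close>, and afterwards
  \<open>f (k - 1)\<close>.\<close>

definition insert_part :: "nat \<Rightarrow> (nat \<Rightarrow> nat) \<Rightarrow> nat \<Rightarrow> nat" where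
  "insert_part q f k = max (f k) (case k of 0 \<Rightarrow> q | Suc j \<Rightarrow> min q (f j))"

lemma insert_part_0 [simp]: "insert_part q f 0 = max (f 0) q"
  and insert_part_Suc [simp]: "insert_part q f (Suc k) = max (f (Suc k)) (min q (f k))"
  by (simp_all add: insert_part_def)

lemma antimono_insert_part:
  assumes "antimono f"
  shows "antimono (insert_part q f)"
proof (rule antimono_SucI)
  fix k
  have "f (Suc k) \<le> f k" using assms by (simp add: antimono_Suc_iff)
  then show "insert_part q f (Suc k) \<le> insert_part q f k"
    using antimonoD[OF assms, of "k - 1" k] by (cases k) auto
qed

lemma fin_supp_insert_part:
  assumes "fin_supp f"
  shows "fin_supp (insert_part q f)"
proof -
  obtain N where "\<And>i. i \<ge> N \<Longrightarrow> f i = 0" using assms by (auto simp: fin_supp_def)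
  then have "insert_part q f i = 0" if "i \<ge> Suc N" for i using that by (cases i) auto
  then show ?thesis unfolding fin_supp_def by blast
qed

text \<open>If \<open>f x < g x\<close> is the first difference, equal results at \<open>x\<close>
  force \<open>g x \<le> q\<close>; but then position \<open>Suc x\<close> holds \<open>f x\<close>
  on one side and \<open>g x\<close> on the other.\<close>

lemma insert_part_inject:
  assumes f: "antimono f" and g: "antimono g" and eq: "insert_part q f = insert_part q g"
  shows "f = g"
proof (rule ccontr)
  have step: False if fg: "antimono f" "antimono g" "insert_part q f = insert_part q g"
    and x: "\<And>j. j < x \<Longrightarrow> f j = g j" "f x < g x" for f g :: "nat \<Rightarrow> nat" and x
  proof -
    define t where "t = (case x of 0 \<Rightarrow> q | Suc j \<Rightarrow> min q (f j))"
    have "insert_part q f x = max (f x) t" by (simp add: insert_part_def t_def)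
    moreover have "insert_part q g x = max (g x) t"
      using x(1) by (cases x) (auto simp: insert_part_def t_def)
    ultimately have "max (f x) t = max (g x) t" using fg by simp
    moreover have "t \<le> q" by (cases x) (auto simp: t_def)
    ultimately have "g x \<le> q" using x(2) by linarith
    moreover have "insert_part q f (Suc x) = insert_part q g (Suc x)" using fg by simp
    moreover have "f (Suc x) \<le> f x" "g (Suc x) \<le> g x" using fg by (auto simp: antimono_Suc_iff)
    ultimately show False using x(2) by simp
  qed
  assume "f \<noteq> g"
  then obtain i where "f i \<noteq> g i" by auto
  define x where "x = (LEAST x. f x \<noteq> g x)"
  have x: "f x \<noteq> g x" unfolding x_def by (rule LeastI) fact
  have below: "f j = g j" if "j < x" for j using not_less_Least[of j "\<lambda>x. f x \<noteq> g x"] that unfolding x_def by simp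
  from x show False
    using step[OF f g eq below] step[OF g f eq[symmetric]] below by (metis linorder_neqE_nat)
qed

text \<open>The leading parts either omit the new part or contain it, and sorting picks the larger
  sum. The form as a maximum is what allows inequalities for partial sums to be inherited.\<close>

lemma sum_insert_part:
  assumes "antimono f"
  shows "(\<Sum>k<Suc x. insert_part q f k) = max (\<Sum>k<Suc x. f k) ((\<Sum>k<x. f k) + q)"
proof (induction x)
  case (Suc x)
  have "f (Suc x) \<le> f x" using assms by (simp add: antimono_Suc_iff)
  have "(\<Sum>k<Suc (Suc x). insert_part q f k) =
      max (\<Sum>k<Suc x. f k) ((\<Sum>k<x. f k) + q) + max (f (Suc x)) (min q (f x))"
    using Suc.IH by simp
  also have "\<dots> = max (\<Sum>k<Suc (Suc x). f k) ((\<Sum>k<Suc x. f k) + q)"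
    using \<open>f (Suc x) \<le> f x\<close> by (simp add: max_def min_def)
  finally show ?case .
qed simp

lemma col_height_int:
  assumes "\<And>k. \<kappa> (Suc y) k \<le> \<kappa> y k"
  shows "int (col_height B \<kappa> x y) = int (B y) + int (\<Sum>k<x. \<kappa> y k) - int (\<Sum>k<x. \<kappa> (Suc y) k)"
proof -
  have "(\<Sum>k<x. \<kappa> y k - \<kappa> (Suc y) k) + (\<Sum>k<x. \<kappa> (Suc y) k) = (\<Sum>k<x. \<kappa> y k)"
    using assms by (simp add: sum.distrib[symmetric])
  then show ?thesis unfolding col_height_def by linarith
qed

lemma lr_columns_antimono: "\<kappa> \<in> lr_columns A B \<nu> \<Longrightarrow> antimono (\<kappa> y)"
  by (rule antimono_SucI) (rule lr_columnsD)

lemma col_height_Suc: "col_height B \<kappa> (Suc x) y = col_height B \<kappa> x y + (\<kappa> y x - \<kappa> (Suc y) x)"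
  by (simp add: col_height_def)

lemma col_height_mono: "x \<le> x' \<Longrightarrow> col_height B \<kappa> x y \<le> col_height B \<kappa> x' y"
  by (rule lift_Suc_mono_le) (simp_all add: col_height_Suc)

lemma lr_columns_support:
  assumes \<kappa>: "\<kappa> \<in> lr_columns A B \<nu>"
  obtains N where "\<And>n k. N \<le> n \<Longrightarrow> \<kappa> n k = 0" "\<And>n y. N \<le> n \<Longrightarrow> col_height B \<kappa> n y = A y"
    "\<And>y k. N \<le> k \<Longrightarrow> \<kappa> y k = 0"
proof -
  note K = lr_columnsD[OF \<kappa>]
  obtain N where N: "\<And>n k. N \<le> n \<Longrightarrow> \<kappa> n k = 0" "\<And>n y. N \<le> n \<Longrightarrow> col_height B \<kappa> n y = A y"
    using K(6) by blast
  have eq: "\<kappa> y k = \<kappa> (Suc y) k" if "N \<le> k" for y k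
    using N(2)[of k y] N(2)[of "Suc k" y] that K(2)[of y k] by (simp add: col_height_Suc)
  have "\<kappa> y k = 0" if k: "N \<le> k" for y k
  proof (cases "y \<le> N")
    case True then show ?thesis
      by (induction y rule: inc_induct) (use N(1) eq[OF k] in auto)
  qed (use N(1) in simp)
  then show thesis using that N by blast
qed

text \<open>The new row has one box in each column from \<open>d\<close> to \<open>c - 1\<close>,
  and \<open>c - max y d\<close> of these lie in columns from \<open>y\<close> on; this is the part
  inserted in the content of these columns.\<close>

lemma lr_columns_insert_part:
  assumes dc: "d \<le> c" and \<kappa>: "\<kappa> \<in> lr_columns A B \<nu>"
  shows "(\<lambda>y. insert_part (c - max y d) (\<kappa> y)) \<in>
    lr_columns (add_column c A) (add_column d B) (insert_part (c - d) \<nu>)"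
proof -
  note K = lr_columnsD[OF \<kappa>] and anti = lr_columns_antimono[OF \<kappa>]
  define q where "q = (\<lambda>y. c - max y d)"
  define \<kappa>' where "\<kappa>' = (\<lambda>y. insert_part (q y) (\<kappa> y))"
  have q: "q (Suc y) \<le> q y" "q y \<le> Suc (q (Suc y))" for y by (auto simp: q_def)
  have strip: "\<kappa>' (Suc y) k \<le> \<kappa>' y k \<and> \<kappa>' y k \<le> Suc (\<kappa>' (Suc y) k)" for y k
  proof (cases k)
    case 0 then show ?thesis using q[of y] K(2,3)[of y 0] by (auto simp: \<kappa>'_def)
  next
    case (Suc j)
    then show ?thesis using q[of y] K(2,3)[of y k] K(2,3)[of y j] by (auto simp: \<kappa>'_def)
  qed
  define F where "F = (\<lambda>y x. \<Sum>k<x. \<kappa> y k)"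
  define F' where "F' = (\<lambda>y x. \<Sum>k<x. \<kappa>' y k)"
  have F'Suc: "F' y (Suc x) = max (F y (Suc x)) (F y x + q y)" for y x
    unfolding F'_def F_def \<kappa>'_def by (rule sum_insert_part[OF anti])
  have ch: "int (col_height B \<kappa> x y) = int (B y) + int (F y x) - int (F (Suc y) x)" for x y
    unfolding F_def by (rule col_height_int) (rule K(2))
  have ch': "int (col_height (add_column d B) \<kappa>' x y) = int (add_column d B y) + int (F' y x) - int (F' (Suc y) x)" for x y
    unfolding F'_def by (rule col_height_int) (use strip in blast)
  have Bdec: "B (Suc y) \<le> B y" for y using K(5)[of 0 y] by (simp add: col_height_def)
  have dec: "col_height (add_column d B) \<kappa>' x (Suc y) \<le> col_height (add_column d B) \<kappa>' x y" for x y
  proof (cases x)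
    case 0 then show ?thesis using Bdec[of y] by (simp add: col_height_def add_column_def)
  next
    case (Suc z)
    have old: "int (B (Suc y)) + 2 * int (F (Suc y) x) \<le> int (B y) + int (F y x) + int (F (Suc (Suc y)) x)" for x
      using K(5)[of x y] ch[of x y] ch[of x "Suc y"] by linarith
    have "int (add_column d B (Suc y)) + 2 * int (F' (Suc y) x) \<le>
      int (add_column d B y) + int (F' y x) + int (F' (Suc (Suc y)) x)"
    \<comment> \<open>The claim bounds a middle term by its two neighbours. The alternative of
      \<open>F'Suc\<close> that attains the maximum in the middle column is a lower bound in the two
      outer columns, which reduces the claim to \<open>old\<close>.\<close>
    proof (cases "F (Suc y) z + q (Suc y) \<le> F (Suc y) (Suc z)")
      case True
      then have "F' (Suc y) x = F (Suc y) (Suc z)" by (simp add: Suc F'Suc)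
      moreover have "F y (Suc z) \<le> F' y x" "F (Suc (Suc y)) (Suc z) \<le> F' (Suc (Suc y)) x"
        by (simp_all add: Suc F'Suc)
      ultimately show ?thesis using old[of "Suc z"] by (simp add: add_column_def)
    next
      case False
      then have "F' (Suc y) x = F (Suc y) z + q (Suc y)" by (simp add: Suc F'Suc)
      moreover have "F y z + q y \<le> F' y x" "F (Suc (Suc y)) z + q (Suc (Suc y)) \<le> F' (Suc (Suc y)) x"
        by (simp_all add: Suc F'Suc)
      \<comment> \<open>The quantity \<open>add_column d B y - B y + q y - q (Suc y)\<close> is 1
        for \<open>y < c\<close> and 0 afterwards, hence weakly decreasing.\<close>
      moreover have "int (add_column d B (Suc y)) + 2 * int (q (Suc y)) - int (B (Suc y)) \<le>
          int (add_column d B y) + int (q y) + int (q (Suc (Suc y))) - int (B y)"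
        using dc by (auto simp: q_def add_column_def max_def)
      ultimately show ?thesis using old[of z] by linarith
    qed
    then show ?thesis using ch'[of x y] ch'[of x "Suc y"] by linarith
  qed
  obtain N where N: "\<And>n k. N \<le> n \<Longrightarrow> \<kappa> n k = 0" "\<And>n y. N \<le> n \<Longrightarrow> col_height B \<kappa> n y = A y"
    "\<And>y k. N \<le> k \<Longrightarrow> \<kappa> y k = 0" by (rule lr_columns_support[OF \<kappa>]) blast
  have ev: "(\<forall>k. \<kappa>' n k = 0) \<and> (\<forall>y. col_height (add_column d B) \<kappa>' n y = add_column c A y)"
    if n: "Suc N + c \<le> n" for n
  proof (intro conjI allI)
    fix k show "\<kappa>' n k = 0" using N(1)[of n] n by (cases k) (auto simp: \<kappa>'_def q_def)
  next
    fix y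
    obtain z where z: "n = Suc z" "N \<le> z" using n by (cases n) auto
    have F1: "F y (Suc z) = F y z" for y using N(3)[of z y] z by (simp add: F_def)
    have "F' y n = F y n + q y" for y by (simp add: z(1) F'Suc F1)
    then have "int (col_height (add_column d B) \<kappa>' n y) = int (add_column d B y) + int (F y n + q y) - int (F (Suc y) n + q (Suc y))"
      using ch' by simp
    also have "\<dots> = int (add_column d B y) - int (B y) + int (q y) - int (q (Suc y)) + int (A y)"
      using ch[of n y] N(2)[of n y] z by simp
    also have "\<dots> = int (add_column c A y)"
      using dc by (auto simp: q_def add_column_def max_def)
    finally show "col_height (add_column d B) \<kappa>' n y = add_column c A y" by simp
  qed
  have "\<kappa>' 0 = insert_part (c - d) \<nu>" by (simp add: \<kappa>'_def q_def K(1))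
  moreover have "\<kappa>' y (Suc k) \<le> \<kappa>' y k" for y k
    using antimono_insert_part[OF anti, of "q y" y] by (simp add: \<kappa>'_def antimono_Suc_iff)
  ultimately show ?thesis
    unfolding lr_columns_def mem_Collect_eq \<kappa>'_def[unfolded q_def, symmetric]
    using strip dec ev by (intro conjI exI[of _ "Suc N + c"] allI impI) (auto simp: \<kappa>'_def)
qed

lemma inj_on_lr_columns_insert_part:
  "inj_on (\<lambda>\<kappa> y. insert_part (c - max y d) (\<kappa> y)) (lr_columns A B \<nu>)"
proof (rule inj_onI, rule ext)
  fix \<kappa> \<kappa>' y assume *: "\<kappa> \<in> lr_columns A B \<nu>" "\<kappa>' \<in> lr_columns A B \<nu>"
    "(\<lambda>y. insert_part (c - max y d) (\<kappa> y)) = (\<lambda>y. insert_part (c - max y d) (\<kappa>' y))"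
  show "\<kappa> y = \<kappa>' y"
    by (rule insert_part_inject[OF lr_columns_antimono[OF *(1)] lr_columns_antimono[OF *(2)] fun_cong[OF *(3)]])
qed

section \<open>Insertion of an isolated box\<close>

definition add_box :: "nat \<Rightarrow> (nat \<Rightarrow> nat) \<Rightarrow> nat \<Rightarrow> nat" where
  "add_box x f k = f k + (if k = x then 1 else 0)"

text \<open>A box is removed from the final content, in row \<open>x\<close>, and pushed back to column \<open>p\<close>, where it becomes
  the entry of the isolated box. On its way it moves up to the first row of the same length in each
  intermediate content.\<close>

primrec slide_row :: "(nat \<Rightarrow> nat \<Rightarrow> nat) \<Rightarrow> nat \<Rightarrow> nat \<Rightarrow> nat" where
  "slide_row \<kappa> x 0 = x"
| "slide_row \<kappa> x (Suc y) = (LEAST z. \<kappa> (Suc y) z \<le> \<kappa> (Suc y) (slide_row \<kappa> x y))"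

definition slide_box :: "nat \<Rightarrow> (nat \<Rightarrow> nat \<Rightarrow> nat) \<Rightarrow> nat \<Rightarrow> nat \<Rightarrow> nat \<Rightarrow> nat" where
  "slide_box p \<kappa> x y = (if y \<le> p then add_box (slide_row \<kappa> x y) (\<kappa> y) else \<kappa> (y - 1))"

text \<open>Column heights after an isolated box enters in a new column \<open>p\<close>. The box
  also brings a row of its own, whose inner part covers the columns before \<open>p\<close>; these
  therefore grow by one.\<close>

definition insert_column :: "nat \<Rightarrow> nat \<Rightarrow> (nat \<Rightarrow> nat) \<Rightarrow> nat \<Rightarrow> nat" where
  "insert_column p h A y = (if y < p then Suc (A y) else if y = p then h else A (y - 1))"

context
  fixes A B \<nu> :: "nat \<Rightarrow> nat" and \<kappa> :: "nat \<Rightarrow> nat \<Rightarrow> nat" and x0 :: nat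
  assumes \<kappa>: "\<kappa> \<in> lr_columns A B \<nu>" and corner: "antimono (add_box x0 \<nu>)"
begin

private lemmas K = lr_columnsD[OF \<kappa>]
private lemmas anti = lr_columns_antimono[OF \<kappa>]

private abbreviation "s \<equiv> slide_row \<kappa> x0"

lemma slide_row_Suc_le: "s (Suc y) \<le> s y"
  by (simp add: Least_le)

lemma slide_row_le: "s y \<le> x0"
  by (induction y) (auto intro: le_trans[OF slide_row_Suc_le] simp del: slide_row.simps(2))

text \<open>A box can be added to \<open>\<kappa> y\<close> in row \<open>s y\<close>: at column 0
  by \<open>corner\<close>, later because the first row of its length was chosen.\<close>

lemma slide_row_corner: "z < s y \<Longrightarrow> \<kappa> y (s y) < \<kappa> y z"
proof (cases y)
  case 0
  assume z: "z < s y"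
  have "add_box x0 \<nu> x0 \<le> add_box x0 \<nu> z" using z 0 by (intro antimonoD[OF corner]) simp
  then show ?thesis using z 0 K(1) by (simp add: add_box_def)
next
  case (Suc y')
  let ?P = "\<lambda>z. \<kappa> (Suc y') z \<le> \<kappa> (Suc y') (s y')"
  assume "z < s y"
  then have "z < (LEAST z. ?P z)" unfolding Suc slide_row.simps(2) .
  then have "\<not> ?P z" by (rule not_less_Least)
  moreover have "?P (s (Suc y'))" unfolding slide_row.simps(2) by (rule LeastI[of ?P "s y'"]) simp
  ultimately show ?thesis unfolding Suc by simp
qed

lemma slide_row_block:
  assumes "s (Suc y) \<le> z" "z \<le> s y"
  shows "\<kappa> (Suc y) z = \<kappa> (Suc y) (s y)"
proof (rule antisym)
  let ?P = "\<lambda>z. \<kappa> (Suc y) z \<le> \<kappa> (Suc y) (s y)"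
  have "?P (s (Suc y))" unfolding slide_row.simps(2) by (rule LeastI[of ?P "s y"]) simp
  then show "?P z" using antimonoD[OF anti assms(1), of "Suc y"] by simp
  show "\<kappa> (Suc y) (s y) \<le> \<kappa> (Suc y) z" using antimonoD[OF anti assms(2)] .
qed

text \<open>These rows have the length of row \<open>s y\<close> after the step but are strictly
  longer than it before, so each of them loses its box here.\<close>

lemma slide_row_in_strip:
  assumes "s (Suc y) \<le> z" "z < s y"
  shows "\<kappa> y z = Suc (\<kappa> (Suc y) z)"
proof (rule antisym)
  have "\<kappa> (Suc y) z = \<kappa> (Suc y) (s y)" using assms by (intro slide_row_block) auto
  also have "\<dots> \<le> \<kappa> y (s y)" by (rule K(2))
  also have "\<dots> < \<kappa> y z" using assms(2) by (rule slide_row_corner)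
  finally show "Suc (\<kappa> (Suc y) z) \<le> \<kappa> y z" by simp
qed (rule K(3))

text \<open>With \<open>slide_row_in_strip\<close>, column \<open>y\<close> has the letters of rows
  \<open>s (Suc y)\<close> to \<open>s y - 1\<close> and lacks that of row \<open>s y\<close>. The
  slide exchanges the first of these letters for the missing one.\<close>

lemma slide_row_end:
  assumes "s (Suc y) < s y"
  shows "\<kappa> y (s y) = \<kappa> (Suc y) (s y)"
proof (rule antisym)
  have "\<kappa> y (s y) < \<kappa> y (s (Suc y))" using assms by (rule slide_row_corner)
  also have "\<dots> = Suc (\<kappa> (Suc y) (s (Suc y)))" using assms by (intro slide_row_in_strip) auto
  also have "\<kappa> (Suc y) (s (Suc y)) = \<kappa> (Suc y) (s y)" using assms by (intro slide_row_block) auto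
  finally show "\<kappa> y (s y) \<le> \<kappa> (Suc y) (s y)" by simp
qed (rule K(2))

text \<open>For these \<open>x\<close> and \<open>Suc y < p\<close>, sliding raises the height of
  column \<open>Suc y\<close> by one but not that of column \<open>y\<close>; strictness makes room
  for this.\<close>

lemma col_height_strict:
  assumes x: "s (Suc y) < x" "x \<le> s y"
  shows "col_height B \<kappa> x (Suc y) < col_height B \<kappa> x y"
\<comment> \<open>If column \<open>Suc y\<close> contains the letter of row
  \<open>s (Suc y)\<close>, it contains those of the whole block up to row \<open>s y\<close>, whose
  letter column \<open>y\<close> lacks; strictness then comes down from there. If not, column
  \<open>y\<close> gains strictness at row \<open>s (Suc y)\<close> and keeps it upwards.\<close>
proof (cases "\<kappa> (Suc (Suc y)) (s (Suc y)) < \<kappa> (Suc y) (s (Suc y))")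
  case True
  have next_strip: "\<kappa> (Suc (Suc y)) z < \<kappa> (Suc y) z" if z: "s (Suc y) \<le> z" "z \<le> s y" for z
  proof -
    have "\<kappa> (Suc (Suc y)) z \<le> \<kappa> (Suc (Suc y)) (s (Suc y))" using antimonoD[OF anti z(1)] .
    also have "\<dots> < \<kappa> (Suc y) (s (Suc y))" by (rule True)
    also have "\<dots> = \<kappa> (Suc y) z" using slide_row_block[of y z] slide_row_block[of y "s (Suc y)"] z by simp
    finally show ?thesis .
  qed
  show ?thesis using x(2)
  proof (induction x rule: inc_induct)
    case base
    have e: "\<kappa> y (s y) = \<kappa> (Suc y) (s y)" using x by (intro slide_row_end) simp
    have "\<kappa> (Suc (Suc y)) (s y) < \<kappa> (Suc y) (s y)" using x by (intro next_strip) auto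
    then show ?case using K(5)[of "Suc (s y)" y] e unfolding col_height_Suc by linarith
  next
    case (step z)
    have z: "s (Suc y) \<le> z" "z < s y" using step x by auto
    then have "\<kappa> y z = Suc (\<kappa> (Suc y) z)" by (rule slide_row_in_strip)
    moreover have "\<kappa> (Suc (Suc y)) z < \<kappa> (Suc y) z" using z by (intro next_strip) auto
    ultimately show ?case using step.IH unfolding col_height_Suc by linarith
  qed
next
  case False
  show ?thesis using Suc_leI[OF x(1)] x(2)
  proof (induction x rule: dec_induct)
    case base
    then have "\<kappa> y (s (Suc y)) = Suc (\<kappa> (Suc y) (s (Suc y)))" using x by (intro slide_row_in_strip) auto
    then show ?case using K(5)[of "s (Suc y)" y] False unfolding col_height_Suc by linarith
  next
    case (step z)
    then have "\<kappa> y z = Suc (\<kappa> (Suc y) z)" by (intro slide_row_in_strip) auto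
    then show ?case using step.IH step.prems K(3)[of "Suc y" z] unfolding col_height_Suc by linarith
  qed
qed

text \<open>Here \<open>i\<close> is the number of rows above the isolated box, whose entry becomes
  \<open>Suc (s p)\<close>: by the two bounds on \<open>A\<close> and \<open>B\<close> the new
  column fits between its neighbours.\<close>

lemma slide_box_in_lr_columns:
  assumes i: "A p \<le> i" "\<And>y. y < p \<Longrightarrow> i \<le> B y"
  shows "slide_box p \<kappa> x0 \<in> lr_columns (insert_column p (Suc i) A) (insert_column p i B) (add_box x0 \<nu>)"
proof -
  define \<beta> where "\<beta> = slide_box p \<kappa> x0"
  let ?B = "insert_column p i B"
  have \<beta>_le: "\<beta> y k = \<kappa> y k + (if k = s y then 1 else 0)" if "y \<le> p" for y k
    using that by (simp add: \<beta>_def slide_box_def add_box_def)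
  have \<beta>_gt: "\<beta> (Suc y) = \<kappa> y" if "p \<le> y" for y
    using that by (simp add: \<beta>_def slide_box_def)
  have strip: "\<beta> (Suc y) k \<le> \<beta> y k \<and> \<beta> y k \<le> Suc (\<beta> (Suc y) k)" for y k
  proof -
    consider "y < p" | "y = p" | "p < y" by linarith
    then show ?thesis
    proof cases
      case 1
      then have b: "\<beta> y k = \<kappa> y k + (if k = s y then 1 else 0)"
        "\<beta> (Suc y) k = \<kappa> (Suc y) k + (if k = s (Suc y) then 1 else 0)"
        by (auto simp: \<beta>_le simp del: slide_row.simps(2))
      show ?thesis
      proof (cases "s (Suc y) = s y")
        case True
        then show ?thesis using K(2,3)[of y k] unfolding b by simp
      next
        case False
        then have lt: "s (Suc y) < s y" using slide_row_Suc_le[of y] by simp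
        show ?thesis unfolding b
          using K(2,3)[of y k] slide_row_in_strip[of y "s (Suc y)"] slide_row_end[OF lt] lt
          by (auto simp del: slide_row.simps(2))
      qed
    next
      case 2 then show ?thesis by (simp add: \<beta>_le \<beta>_gt)
    next
      case 3
      then obtain y' where "y = Suc y'" "p \<le> y'" by (cases y) auto
      then show ?thesis using K(2,3)[of y' k] by (simp add: \<beta>_gt)
    qed
  qed
  have anti\<beta>: "\<beta> y (Suc k) \<le> \<beta> y k" for y k
  proof (cases "y \<le> p")
    case True
    then show ?thesis using K(4)[of y k] slide_row_corner[of k y] by (auto simp: \<beta>_le)
  next
    case False
    then obtain y' where "y = Suc y'" "p \<le> y'" by (cases y) auto
    then show ?thesis using K(4) by (simp add: \<beta>_gt)
  qed
  have sum_le: "(\<Sum>k<x. \<beta> y k) = (\<Sum>k<x. \<kappa> y k) + (if s y < x then 1 else 0)" if "y \<le> p" for x y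
    using that by (simp add: \<beta>_le sum.distrib sum.delta)
  have ch: "int (col_height B' \<kappa> x y) = int (B' y) + int (\<Sum>k<x. \<kappa> y k) - int (\<Sum>k<x. \<kappa> (Suc y) k)" for B' x y
    by (rule col_height_int) (rule K(2))
  have ch\<beta>: "int (col_height ?B \<beta> x y) = int (?B y) + int (\<Sum>k<x. \<beta> y k) - int (\<Sum>k<x. \<beta> (Suc y) k)" for x y
    by (rule col_height_int) (use strip in blast)
  have h_lt: "int (col_height ?B \<beta> x y) = int (col_height B \<kappa> x y) + 1
      + (if s y < x then 1 else 0) - (if s (Suc y) < x then 1 else 0)" if "y < p" for x y
    using that ch\<beta>[of x y] ch[of B x y] sum_le[of y x] sum_le[of "Suc y" x]
    by (simp add: insert_column_def del: slide_row.simps(2))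
  have h_eq: "col_height ?B \<beta> x p = i + (if s p < x then 1 else 0)" for x
    using ch\<beta>[of x p] sum_le[of p x] \<beta>_gt[of p] by (simp add: insert_column_def split: if_splits)
  have h_gt: "col_height ?B \<beta> x (Suc y) = col_height B \<kappa> x y" if "p \<le> y" for x y
    using that ch\<beta>[of x "Suc y"] ch[of B x y] by (simp add: insert_column_def \<beta>_gt)
  obtain N where N: "\<And>n k. N \<le> n \<Longrightarrow> \<kappa> n k = 0" "\<And>n y. N \<le> n \<Longrightarrow> col_height B \<kappa> n y = A y"
    by (rule lr_columns_support[OF \<kappa>]) blast
  have dec: "col_height ?B \<beta> x (Suc y) \<le> col_height ?B \<beta> x y" for x y
  proof -
    have strict: "col_height B \<kappa> x (Suc y) < col_height B \<kappa> x y" if "s (Suc y) < x" "\<not> s y < x"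
      using that by (intro col_height_strict) auto
    have sle: "s (Suc y) \<le> s y" "s (Suc (Suc y)) \<le> s (Suc y)" by (rule slide_row_Suc_le)+
    consider "Suc y < p" | "Suc y = p" | "y = p" | "p < y" by linarith
    then show ?thesis
    proof cases
      case 1
      then show ?thesis
        using h_lt[of y x] h_lt[of "Suc y" x] K(5)[of x y] strict sle by (auto split: if_splits simp del: slide_row.simps(2))
    next
      case 2
      then have yp: "y < p" by simp
      have lo: "i \<le> col_height B \<kappa> x y"
        using i(2)[OF yp] by (simp add: col_height_def)
      \<comment> \<open>Column \<open>y\<close> contains the letter of row \<open>s (Suc y)\<close>,
        which lifts it above its inner height.\<close>
      have "i < col_height B \<kappa> x y" if sx: "s (Suc y) < x" "\<not> s y < x"
      proof -
        have "\<kappa> y (s (Suc y)) = Suc (\<kappa> (Suc y) (s (Suc y)))" using sx by (intro slide_row_in_strip) auto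
        then have "B y < col_height B \<kappa> (Suc (s (Suc y))) y" unfolding col_height_Suc by (simp add: col_height_def)
        also have "\<dots> \<le> col_height B \<kappa> x y" using sx by (intro col_height_mono) simp
        finally show ?thesis using i(2)[OF yp] by simp
      qed
      then show ?thesis using h_lt[OF yp, of x] h_eq[of x] lo 2 by (auto split: if_splits simp del: slide_row.simps(2))
    next
      case 3
      have "col_height B \<kappa> x p \<le> col_height B \<kappa> (max x N) p" by (rule col_height_mono) simp
      also have "\<dots> = A p" by (rule N) simp
      finally show ?thesis using i(1) h_eq[of x] h_gt[of p x] 3 by simp
    next
      case 4
      then obtain y' where "y = Suc y'" "p \<le> y'" by (cases y) auto
      then show ?thesis using K(5) by (simp add: h_gt)
    qed
  qed
  have "(\<forall>k. \<beta> n k = 0) \<and> (\<forall>y. col_height ?B \<beta> n y = insert_column p (Suc i) A y)"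
    if n: "N + p + x0 + 1 \<le> n" for n
  proof (intro conjI allI)
    obtain n' where n': "n = Suc n'" "p \<le> n'" "N \<le> n'" using n by (cases n) auto
    fix k show "\<beta> n k = 0" using N(1)[of n' k] n' by (simp add: \<beta>_gt)
  next
    fix y
    have sn: "s z < n" for z using slide_row_le[of z] n by simp
    consider "y < p" | "y = p" | y' where "y = Suc y'" "p \<le> y'" by (cases y) (auto, linarith)
    then show "col_height ?B \<beta> n y = insert_column p (Suc i) A y"
    proof cases
      case 1
      then show ?thesis using h_lt[OF 1, of n] sn[of y] sn[of "Suc y"] N(2)[of n y] n
        by (simp add: insert_column_def del: slide_row.simps(2))
    next
      case 2 then show ?thesis using h_eq[of n] sn[of p] by (simp add: insert_column_def)
    next
      case 3 then show ?thesis using h_gt[of y' n] N(2)[of n y'] n by (simp add: insert_column_def)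
    qed
  qed
  moreover have "\<beta> 0 = add_box x0 \<nu>" by (simp add: \<beta>_def slide_box_def K(1))
  ultimately show ?thesis
    unfolding lr_columns_def mem_Collect_eq \<beta>_def[symmetric] using strip anti\<beta> dec by blast
qed

end

text \<open>In the content with the box added, all rows from the smaller to the larger candidate
  have the same length. Taking the box away at the upper end of this run would not leave a
  partition, so the row of the box is determined.\<close>

lemma slide_row_not_less:
  assumes k1: "\<kappa>1 \<in> lr_columns A B \<nu>1" "antimono (add_box x1 \<nu>1)"
    and k2: "\<kappa>2 \<in> lr_columns A B \<nu>2" "antimono (add_box x2 \<nu>2)"
    and eq: "add_box (slide_row \<kappa>1 x1 y) (\<kappa>1 y) = add_box (slide_row \<kappa>2 x2 y) (\<kappa>2 y)"
    and Suc_eq: "\<kappa>1 (Suc y) = \<kappa>2 (Suc y)" "slide_row \<kappa>1 x1 (Suc y) = slide_row \<kappa>2 x2 (Suc y)"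
  shows "\<not> slide_row \<kappa>1 x1 y < slide_row \<kappa>2 x2 y"
proof
  let ?s = "slide_row \<kappa>1 x1" and ?t = "slide_row \<kappa>2 x2"
  assume lt: "?s y < ?t y"
  have le: "?s (Suc y) \<le> ?s y" by (rule slide_row_Suc_le[OF k1])
  have tlt: "?t (Suc y) < ?t y" using le lt Suc_eq(2) by simp
  have \<beta>: "add_box (?t y) (\<kappa>2 y) z = Suc (\<kappa>2 (Suc y) (?t y))" if z: "?s y \<le> z" "z \<le> ?t y" for z
  proof (cases "z = ?t y")
    case True
    then show ?thesis using slide_row_end[OF k2 tlt] by (simp add: add_box_def)
  next
    case False
    then have "z < ?t y" "?t (Suc y) \<le> z" using z le Suc_eq(2) by auto
    then show ?thesis
      using slide_row_in_strip[OF k2, of y z] slide_row_block[OF k2, of y z] by (simp add: add_box_def)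
  qed
  have "\<kappa>1 y (Suc (?s y)) \<le> \<kappa>1 y (?s y)" using lr_columnsD(4)[OF k1(1)] .
  moreover have "Suc (\<kappa>1 y (?s y)) = add_box (?s y) (\<kappa>1 y) (?s y)"
    "\<kappa>1 y (Suc (?s y)) = add_box (?s y) (\<kappa>1 y) (Suc (?s y))" by (simp_all add: add_box_def)
  ultimately show False using \<beta>[of "?s y"] \<beta>[of "Suc (?s y)"] lt unfolding eq by simp
qed

lemma add_box_inject: "add_box x f = add_box x g \<Longrightarrow> f = g"
  by (auto simp: add_box_def fun_eq_iff)

lemma add_box_left_inject:
  assumes "add_box x f = add_box x' f"
  shows "x = x'"
  using fun_cong[OF assms, of x] by (simp add: add_box_def split: if_splits)

text \<open>The slide is undone from right to left: column \<open>Suc p\<close> shows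
  \<open>\<kappa> p\<close> without the extra box, which gives its row at \<open>p\<close>, and
  \<open>slide_row_not_less\<close> recovers the row at \<open>y\<close> from the data at
  \<open>Suc y\<close>.\<close>

lemma slide_box_inject:
  assumes k1: "\<kappa>1 \<in> lr_columns A B \<nu>1" "antimono (add_box x1 \<nu>1)"
    and k2: "\<kappa>2 \<in> lr_columns A B \<nu>2" "antimono (add_box x2 \<nu>2)"
    and eq: "slide_box p \<kappa>1 x1 = slide_box p \<kappa>2 x2"
  shows "x1 = x2 \<and> \<kappa>1 = \<kappa>2"
proof -
  let ?s = "slide_row \<kappa>1 x1" and ?t = "slide_row \<kappa>2 x2"
  have ge: "\<kappa>1 y = \<kappa>2 y" if "p \<le> y" for y
    using fun_cong[OF eq, of "Suc y"] that by (simp add: slide_box_def)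
  have le: "add_box (?s y) (\<kappa>1 y) = add_box (?t y) (\<kappa>2 y)" if "y \<le> p" for y
    using fun_cong[OF eq, of y] that by (simp add: slide_box_def)
  have main: "?s y = ?t y \<and> \<kappa>1 y = \<kappa>2 y" if "y \<le> p" for y
    using that
  proof (induction y rule: inc_induct)
    case base
    then show ?case using le[of p] ge[of p] add_box_left_inject by auto
  next
    case (step y)
    then have yp: "y \<le> p" and IH: "\<kappa>1 (Suc y) = \<kappa>2 (Suc y)" "?s (Suc y) = ?t (Suc y)" by auto
    have "?s y = ?t y"
      using slide_row_not_less[OF k1 k2 le[OF yp] IH]
        slide_row_not_less[OF k2 k1 le[OF yp, symmetric] IH[symmetric]] by simp
    then show ?case using le[OF yp] add_box_inject by metis
  qed
  then have "\<kappa>1 y = \<kappa>2 y" for y using ge by (cases "y \<le> p") auto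
  then show ?thesis using main[of 0] by auto
qed

section \<open>Corners of partitions and one inequality of the Pieri rule for a single box\<close>

definition corners :: "(nat \<Rightarrow> nat) \<Rightarrow> nat set" where
  "corners f = {x. f (Suc x) < f x}"

definition remove_box :: "nat \<Rightarrow> (nat \<Rightarrow> nat) \<Rightarrow> nat \<Rightarrow> nat" where
  "remove_box x f k = f k - (if k = x then 1 else 0)"

lemma add_box_remove_box: "x \<in> corners f \<Longrightarrow> add_box x (remove_box x f) = f"
  by (auto simp: add_box_def remove_box_def corners_def fun_eq_iff)

lemma finite_corners: "fin_supp f \<Longrightarrow> finite (corners f)"
  unfolding fin_supp_def corners_def
  by (metis (mono_tags, lifting) finite_nat_set_iff_bounded mem_Collect_eq not_le not_less0)

lemma antimono_remove_box:
  assumes "antimono f" "x \<in> corners f"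
  shows "antimono (remove_box x f)"
proof (rule antimono_SucI)
  fix k
  have "f (Suc k) \<le> f k" using assms(1) by (simp add: antimono_Suc_iff)
  then show "remove_box x f (Suc k) \<le> remove_box x f k"
    using assms(2) by (auto simp: remove_box_def corners_def)
qed

lemma fin_supp_remove_box: "fin_supp f \<Longrightarrow> fin_supp (remove_box x f)"
  unfolding fin_supp_def remove_box_def by (metis diff_0_eq_0)

text \<open>A corner of \<open>\<nu>\<close> and a tableau of the smaller content are slid to one
  tableau of content \<open>\<nu>\<close>, and \<open>slide_box_inject\<close> recovers
  both.\<close>

lemma sum_card_lr_columns_le:
  assumes i: "A p \<le> i" "\<And>y. y < p \<Longrightarrow> i \<le> B y" and \<nu>: "antimono \<nu>" "fin_supp \<nu>"
    and fin: "\<And>\<nu>. antimono \<nu> \<Longrightarrow> fin_supp \<nu> \<Longrightarrow> finite (lr_columns A B \<nu>)"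
      "finite (lr_columns (insert_column p (Suc i) A) (insert_column p i B) \<nu>)"
  shows "(\<Sum>x\<in>corners \<nu>. card (lr_columns A B (remove_box x \<nu>)))
    \<le> card (lr_columns (insert_column p (Suc i) A) (insert_column p i B) \<nu>)"
proof -
  let ?S = "Sigma (corners \<nu>) (\<lambda>x. lr_columns A B (remove_box x \<nu>))"
  let ?f = "\<lambda>(x, \<kappa>). slide_box p \<kappa> x"
  have "(\<Sum>x\<in>corners \<nu>. card (lr_columns A B (remove_box x \<nu>))) = card ?S"
    by (rule card_SigmaI[symmetric]) (use finite_corners[OF \<nu>(2)] fin(1) antimono_remove_box[OF \<nu>(1)] fin_supp_remove_box[OF \<nu>(2)] in auto)
  also have "\<dots> \<le> card (lr_columns (insert_column p (Suc i) A) (insert_column p i B) \<nu>)"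
  proof (rule card_inj_on_le[of ?f])
    show "inj_on ?f ?S"
    proof (rule inj_onI, clarsimp)
      fix x1 \<kappa>1 x2 \<kappa>2
      assume *: "x1 \<in> corners \<nu>" "\<kappa>1 \<in> lr_columns A B (remove_box x1 \<nu>)"
        "x2 \<in> corners \<nu>" "\<kappa>2 \<in> lr_columns A B (remove_box x2 \<nu>)"
        "slide_box p \<kappa>1 x1 = slide_box p \<kappa>2 x2"
      show "x1 = x2 \<and> \<kappa>1 = \<kappa>2"
        by (rule slide_box_inject[OF *(2) _ *(4) _ *(5)])
          (simp_all add: add_box_remove_box *(1,3) \<nu>(1))
    qed
    show "?f ` ?S \<subseteq> lr_columns (insert_column p (Suc i) A) (insert_column p i B) \<nu>"
    proof clarsimp
      fix x \<kappa> assume *: "x \<in> corners \<nu>" "\<kappa> \<in> lr_columns A B (remove_box x \<nu>)"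
      show "slide_box p \<kappa> x \<in> lr_columns (insert_column p (Suc i) A) (insert_column p i B) \<nu>"
        using slide_box_in_lr_columns[OF *(2) _ i, of x] \<nu>(1) by (simp add: add_box_remove_box *(1))
    qed
  qed (rule fin(2))
  finally show ?thesis .
qed

section \<open>Monotonicity of the number of tableaux\<close>

definition unpart :: "(nat \<Rightarrow> nat) \<Rightarrow> nat list" where
  "unpart f = map f [0..<conj_fun f 0]"

lemma part_unpart:
  assumes "antimono f" "fin_supp f"
  shows "part (unpart f) = f"
proof
  fix i show "part (unpart f) i = f i"
    using less_conj_fun_iff[OF assms, of i 0] by (auto simp: part_def unpart_def)
qed

lemma is_partition_unpart:
  assumes "antimono f" "fin_supp f"
  shows "is_partition (unpart f)"
  unfolding is_partition_def
proof
  show "sorted_wrt (\<ge>) (unpart f)"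
    by (simp add: sorted_wrt_iff_nth_less unpart_def antimonoD[OF assms(1)])
  show "\<forall>x\<in>set (unpart f). 0 < x"
    using less_conj_fun_iff[OF assms, of _ 0] by (auto simp: unpart_def)
qed

lemma is_partition_part:
  assumes "is_partition xs"
  shows "antimono (part xs)" "fin_supp (part xs)" "i < length xs \<longleftrightarrow> 0 < part xs i"
proof -
  show "antimono (part xs)"
    using assms by (intro antimono_SucI) (auto simp: part_def is_partition_def sorted_wrt_iff_nth_less)
  show "fin_supp (part xs)" unfolding fin_supp_def part_def by (intro exI[of _ "length xs"]) simp
  show "i < length xs \<longleftrightarrow> 0 < part xs i"
    using assms by (auto simp: part_def is_partition_def)
qed

lemma part_inject:
  assumes "is_partition xs" "is_partition ys" "part xs = part ys"
  shows "xs = ys"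
proof (rule nth_equalityI)
  have "i < length xs \<longleftrightarrow> i < length ys" for i
    using is_partition_part(3) assms by metis
  then show len: "length xs = length ys" by (metis linorder_neqE_nat less_irrefl)
  fix i assume "i < length xs"
  then show "xs ! i = ys ! i" using fun_cong[OF assms(3), of i] len by (simp add: part_def)
qed

lemma finite_lr_chains:
  assumes "antimono l" "fin_supp l" "antimono m" "fin_supp m" "antimono \<nu>" "fin_supp \<nu>"
  shows "finite (lr_chains l m \<nu>)"
  using card_lr_chains_le_lr_coeff(2)[of "unpart l" "unpart m" "unpart \<nu>"]
    is_partition_unpart assms part_unpart by metis

definition partition_funs :: "(nat \<Rightarrow> nat) set" where
  "partition_funs = {f. antimono f \<and> fin_supp f}"

text \<open>Injective maps on Young's lattice carrying downward edges to downward edges. The size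
  may change and \<open>\<phi> f\<close> may have further corners; these only add nonnegative terms
  when a sum over corners is carried over.\<close>

definition box_compatible :: "((nat \<Rightarrow> nat) \<Rightarrow> nat \<Rightarrow> nat) \<Rightarrow> bool" where
  "box_compatible \<phi> \<longleftrightarrow> \<phi> ` partition_funs \<subseteq> partition_funs \<and> inj_on \<phi> partition_funs \<and>
     (\<forall>f\<in>partition_funs. \<forall>x\<in>corners f. \<exists>x'\<in>corners (\<phi> f). \<phi> (remove_box x f) = remove_box x' (\<phi> f))"

lemma remove_box_in_partition_funs:
  "f \<in> partition_funs \<Longrightarrow> x \<in> corners f \<Longrightarrow> remove_box x f \<in> partition_funs"
  by (simp add: partition_funs_def antimono_remove_box fin_supp_remove_box)

lemma box_compatible_id: "box_compatible (\<lambda>f. f)"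
  by (auto simp: box_compatible_def)

lemma box_compatible_comp:
  assumes \<phi>: "box_compatible \<phi>" and \<psi>: "box_compatible \<psi>"
  shows "box_compatible (\<lambda>f. \<psi> (\<phi> f))"
  unfolding box_compatible_def
proof (intro conjI ballI)
  show "(\<lambda>f. \<psi> (\<phi> f)) ` partition_funs \<subseteq> partition_funs"
    using \<phi> \<psi> by (auto simp: box_compatible_def)
  show "inj_on (\<lambda>f. \<psi> (\<phi> f)) partition_funs"
    using comp_inj_on[of \<phi> partition_funs \<psi>] inj_on_subset[of \<psi> partition_funs "\<phi> ` partition_funs"] \<phi> \<psi>
    unfolding box_compatible_def comp_def by blast
  fix f x assume f: "f \<in> partition_funs" "x \<in> corners f"
  then obtain x' where x': "x' \<in> corners (\<phi> f)" "\<phi> (remove_box x f) = remove_box x' (\<phi> f)"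
    using \<phi> unfolding box_compatible_def by blast
  have "\<phi> f \<in> partition_funs" using \<phi> f unfolding box_compatible_def by blast
  then show "\<exists>x'\<in>corners (\<psi> (\<phi> f)). \<psi> (\<phi> (remove_box x f)) = remove_box x' (\<psi> (\<phi> f))"
    using \<psi> x' unfolding box_compatible_def by metis
qed

lemma box_compatible_add_column: "box_compatible (add_column t)"
  unfolding box_compatible_def
proof (intro conjI ballI)
  show "add_column t ` partition_funs \<subseteq> partition_funs"
  proof safe
    fix f assume "f \<in> partition_funs"
    then have f: "antimono f" "fin_supp f" by (auto simp: partition_funs_def)
    obtain N where "\<And>i. i \<ge> N \<Longrightarrow> f i = 0" using f by (auto simp: fin_supp_def)
    then have "fin_supp (add_column t f)" unfolding fin_supp_def add_column_def
      by (intro exI[of _ "max N t"]) auto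
    moreover have "antimono (add_column t f)"
      using f(1) by (auto simp: antimono_Suc_iff add_column_def intro: le_SucI)
    ultimately show "add_column t f \<in> partition_funs" by (simp add: partition_funs_def)
  qed
  show "inj_on (add_column t) partition_funs"
    by (auto simp: inj_on_def add_column_def fun_eq_iff)
  fix f x assume "f \<in> partition_funs" "x \<in> corners f"
  then show "\<exists>x'\<in>corners (add_column t f). add_column t (remove_box x f) = remove_box x' (add_column t f)"
    by (intro bexI[of _ x]) (auto simp: corners_def add_column_def remove_box_def fun_eq_iff)
qed

lemma box_compatible_insert_part: "box_compatible (insert_part q)"
  unfolding box_compatible_def
proof (intro conjI ballI)
  show "insert_part q ` partition_funs \<subseteq> partition_funs"
    by (auto simp: partition_funs_def antimono_insert_part fin_supp_insert_part)
  show "inj_on (insert_part q) partition_funs"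
    by (auto simp: inj_on_def partition_funs_def intro: insert_part_inject)
  fix f x assume f: "f \<in> partition_funs" "x \<in> corners f"
  then have anti: "f (Suc k) \<le> f k" for k by (simp add: partition_funs_def antimono_Suc_iff)
  have x: "f (Suc x) < f x" using f by (simp add: corners_def)
  \<comment> \<open>A new part inserted above row \<open>x\<close> moves it to \<open>Suc x\<close>.
    For \<open>q = f x\<close> the new part counts as inserted above, since only the last of equal
    rows is a corner.\<close>
  let ?x = "if q < f x then x else Suc x"
  show "\<exists>x'\<in>corners (insert_part q f). insert_part q (remove_box x f) = remove_box x' (insert_part q f)"
  proof (intro bexI[of _ ?x] ext)
    show "?x \<in> corners (insert_part q f)"
      using x anti[of x] anti[of "Suc x"] by (cases x) (auto simp: corners_def)
    fix k
    show "insert_part q (remove_box x f) k = remove_box ?x (insert_part q f) k"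
    proof (cases k)
      case 0 then show ?thesis by (auto simp: remove_box_def)
    next
      case (Suc j)
      then show ?thesis using x anti[of j] by (auto simp: remove_box_def)
    qed
  qed
qed

section \<open>Effect of the removals on the number of tableaux\<close>

lemma card_lr_chains_column_move:
  assumes mv: "column_move l' m' l m" and lm': "basic_fun l' m'" and lm: "basic_fun l m"
  shows "\<exists>\<psi>. box_compatible \<psi> \<and> (\<forall>\<nu>\<in>partition_funs. card (lr_chains l' m' \<nu>) \<le> card (lr_chains l m (\<psi> \<nu>)))"
proof -
  obtain a b where ab: "b \<le> a" "l = add_column a l'" "m = add_column b m'"
    using mv by (auto simp: column_move_def)
  have "card (lr_chains l' m' \<nu>) \<le> card (lr_chains l m (add_column (a - b) \<nu>))" if \<nu>: "\<nu> \<in> partition_funs" for \<nu>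
  proof (rule card_inj_on_le)
    show "inj_on (\<lambda>\<rho> x i. \<rho> x i + (if i < a \<and> i < b + x then 1 else 0)) (lr_chains l' m' \<nu>)"
      by (rule inj_on_subset[OF inj_lr_chains_add_column]) simp
    show "(\<lambda>\<rho> x i. \<rho> x i + (if i < a \<and> i < b + x then 1 else 0)) ` lr_chains l' m' \<nu>
      \<subseteq> lr_chains l m (add_column (a - b) \<nu>)"
      using lr_chains_add_column[OF ab(1) basic_funD(3)[OF lm']] ab(2,3) by blast
    have "add_column (a - b) \<nu> \<in> partition_funs"
      using box_compatible_add_column \<nu> unfolding box_compatible_def by blast
    then show "finite (lr_chains l m (add_column (a - b) \<nu>))"
      using basic_funD(1-4)[OF lm] by (intro finite_lr_chains) (auto simp: partition_funs_def)
  qed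
  then show ?thesis using box_compatible_add_column by blast
qed

lemma card_lr_columns:
  assumes "basic_fun l m"
  shows "card (lr_columns (conj_fun l) (conj_fun m) \<nu>) = card (lr_chains l m \<nu>)"
    "finite (lr_columns (conj_fun l) (conj_fun m) \<nu>) \<longleftrightarrow> finite (lr_chains l m \<nu>)"
  using bij_betw_col_state[OF basic_funD(1)[OF assms] basic_funD(3)[OF assms] basic_funD(2)[OF assms]
    basic_funD(4)[OF assms], of \<nu>]
  by (simp_all add: bij_betw_same_card bij_betw_finite)

lemma card_lr_chains_row_move:
  assumes mv: "row_move l' m' l m" and lm': "basic_fun l' m'" and lm: "basic_fun l m"
  shows "\<exists>\<psi>. box_compatible \<psi> \<and> (\<forall>\<nu>\<in>partition_funs. card (lr_chains l' m' \<nu>) \<le> card (lr_chains l m (\<psi> \<nu>)))"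
proof -
  obtain c d where cd: "d \<le> c" "conj_fun l = add_column c (conj_fun l')" "conj_fun m = add_column d (conj_fun m')"
    using mv by (auto simp: row_move_def)
  have "card (lr_columns (conj_fun l') (conj_fun m') \<nu>) \<le> card (lr_columns (conj_fun l) (conj_fun m) (insert_part (c - d) \<nu>))"
    if \<nu>: "\<nu> \<in> partition_funs" for \<nu>
  proof (rule card_inj_on_le[OF inj_on_lr_columns_insert_part])
    show "(\<lambda>\<kappa> y. insert_part (c - max y d) (\<kappa> y)) ` lr_columns (conj_fun l') (conj_fun m') \<nu>
      \<subseteq> lr_columns (conj_fun l) (conj_fun m) (insert_part (c - d) \<nu>)"
      unfolding cd(2,3) using lr_columns_insert_part[OF cd(1)] by blast
    have "insert_part (c - d) \<nu> \<in> partition_funs"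
      using box_compatible_insert_part \<nu> unfolding box_compatible_def by blast
    then show "finite (lr_columns (conj_fun l) (conj_fun m) (insert_part (c - d) \<nu>))"
      unfolding card_lr_columns(2)[OF lm]
      using basic_funD(1-4)[OF lm] by (intro finite_lr_chains) (auto simp: partition_funs_def)
  qed
  then show ?thesis using box_compatible_insert_part unfolding card_lr_columns(1)[OF lm] card_lr_columns(1)[OF lm'] by blast
qed

text \<open>Deletes the row and the column of an isolated box in row \<open>r\<close>. In both
  shapes the rows above extend over this column and the rows below end before it, so only those
  above get shorter.\<close>

definition remove_isolated :: "nat \<Rightarrow> (nat \<Rightarrow> nat) \<Rightarrow> nat \<Rightarrow> nat" where
  "remove_isolated r f i = (if i < r then f i - 1 else f (Suc i))"

lemma isolated_boxD:
  assumes ib: "isolated_box l m r" and bas: "basic_fun l m"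
  shows "l r = Suc (m r)" "l (Suc r) = m r" "i < r \<Longrightarrow> m r < m i" "i < r \<Longrightarrow> Suc (m r) < l i"
    "r < i \<Longrightarrow> l i \<le> m r"
proof -
  note B = basic_funD[OF bas]
  show 1: "l r = Suc (m r)" "l (Suc r) = m r" using ib by (auto simp: isolated_box_def touch_def)
  show 2: "m r < m i" if "i < r" for i
  proof -
    have "m (r - 1) = l r" using ib that by (auto simp: isolated_box_def touch_def)
    moreover have "i \<le> r - 1" using that by simp
    ultimately show ?thesis using antimonoD[OF B(2) \<open>i \<le> r - 1\<close>] 1 by simp
  qed
  show "Suc (m r) < l i" if "i < r"
    using 2[OF that] B(7)[of i] B(6)[of i] by simp
  show "l i \<le> m r" if "r < i" using antimonoD[OF B(1) Suc_leI[OF that]] 1 by simp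
qed

text \<open>The box lies in column \<open>m r\<close> below \<open>r\<close> rows; this is the
  deletion in terms of column heights, with the bounds that \<open>slide_box_in_lr_columns\<close>
  asks for.\<close>

lemma remove_isolated_columns:
  assumes ib: "isolated_box l m r" and bas: "basic_fun l m"
  shows "conj_fun l = insert_column (m r) (Suc r) (conj_fun (remove_isolated r l))"
    and "conj_fun m = insert_column (m r) r (conj_fun (remove_isolated r m))"
    and "conj_fun (remove_isolated r l) (m r) \<le> r"
    and "y < m r \<Longrightarrow> r \<le> conj_fun (remove_isolated r m) y"
    and "basic_fun (remove_isolated r l) (remove_isolated r m)"
proof -
  note B = basic_funD[OF bas] and I = isolated_boxD[OF ib bas]
  let ?l = "remove_isolated r l" and ?m = "remove_isolated r m"
  have lS: "l (Suc i) \<le> l i" for i using B(1) by (simp add: antimono_Suc_iff)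
  have mS: "m (Suc i) \<le> m i" for i using B(2) by (simp add: antimono_Suc_iff)
  have mgt: "m i \<le> m r" if "r < i" for i using antimonoD[OF B(2), of r i] that by simp
  have "antimono ?l"
  proof (rule antimono_SucI)
    fix i show "?l (Suc i) \<le> ?l i"
      using lS[of i] lS[of "Suc i"] I(4)[of i] I(5)[of "Suc (Suc i)"]
      by (cases "Suc i = r") (auto simp: remove_isolated_def)
  qed
  moreover have "antimono ?m"
  proof (rule antimono_SucI)
    fix i show "?m (Suc i) \<le> ?m i"
      using mS[of i] mS[of "Suc i"] I(3)[of i] mgt[of "Suc (Suc i)"]
      by (cases "Suc i = r") (auto simp: remove_isolated_def)
  qed
  moreover have fin: "fin_supp (remove_isolated r f)" if fs: "fin_supp f" for f
  proof -
    obtain N where "\<And>i. i \<ge> N \<Longrightarrow> f i = 0" using fs by (auto simp: fin_supp_def)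
    then show ?thesis unfolding fin_supp_def remove_isolated_def by (intro exI[of _ N]) auto
  qed
  moreover have "?m i \<le> ?l (Suc i)" for i
  proof (cases "Suc i = r")
    case True
    then have "m i = Suc (m r)" using ib by (auto simp: isolated_box_def touch_def)
    then show ?thesis using True I(2) by (simp add: remove_isolated_def)
  next
    case False
    then show ?thesis using B(5)[of i] B(5)[of "Suc i"] by (auto simp: remove_isolated_def)
  qed
  moreover have "?m i < ?l i" if "0 < ?l i" for i
    using that B(6)[of i] B(6)[of "Suc i"] I(3)[of i] by (auto simp: remove_isolated_def)
  ultimately show bas': "basic_fun ?l ?m" using B(3) by (auto simp: basic_fun_def)
  note B' = basic_funD[OF bas']
  show "conj_fun ?l (m r) \<le> r"
  proof (rule ccontr)
    assume "\<not> ?thesis"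
    then have "m r < ?l r" using less_conj_fun_iff[OF B'(1,3), of r "m r"] by simp
    then show False using I(2) by (simp add: remove_isolated_def)
  qed
  show "r \<le> conj_fun ?m y" if "y < m r"
  proof (rule ccontr)
    assume "\<not> ?thesis"
    then have "\<not> y < ?m (conj_fun ?m y)" "conj_fun ?m y < r"
      using less_conj_fun_iff[OF B'(2,4), of "conj_fun ?m y" y] by auto
    then show False using I(3)[of "conj_fun ?m y"] that by (auto simp: remove_isolated_def)
  qed
  show "conj_fun l = insert_column (m r) (Suc r) (conj_fun ?l)"
  proof
    fix y
    have L: "y < ?l i \<longleftrightarrow> i < conj_fun ?l y" for i y using less_conj_fun_iff[OF B'(1,3)] by blast
    show "conj_fun l y = insert_column (m r) (Suc r) (conj_fun ?l) y"
    proof (rule conj_fun_eqI)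
      fix i
      consider "y < m r" | "y = m r" | "m r < y" by linarith
      then show "y < l i \<longleftrightarrow> i < insert_column (m r) (Suc r) (conj_fun ?l) y"
      proof cases
        case 1
        show ?thesis
        proof (cases "i \<le> r")
          case True
          have "y < l i" using True 1 I(1) antimonoD[OF B(1), of i r] by simp
          moreover have "i < Suc (conj_fun ?l y)"
          proof (cases i)
            case (Suc j)
            then have "y < ?l j" using True 1 I(4)[of j] by (simp add: remove_isolated_def)
            then show ?thesis using L Suc by simp
          qed simp
          ultimately show ?thesis using 1 by (simp add: insert_column_def)
        next
          case False
          then obtain j where j: "i = Suc j" "r \<le> j" by (cases i) auto
          then show ?thesis using L[of y j] 1 by (simp add: insert_column_def remove_isolated_def)
        qed
      next
        case 2
        then show ?thesis using I(4)[of i] I(5)[of i] I(1) by (cases i r rule: linorder_cases) (auto simp: insert_column_def)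
      next
        case 3
        then have "y < l i \<longleftrightarrow> y - 1 < ?l i"
          using I(4)[of i] I(5)[of i] I(5)[of "Suc i"] I(1)
          by (cases i r rule: linorder_cases) (auto simp: remove_isolated_def)
        then show ?thesis using 3 L by (simp add: insert_column_def)
      qed
    qed
  qed
  show "conj_fun m = insert_column (m r) r (conj_fun ?m)"
  proof
    fix y
    have L: "y < ?m i \<longleftrightarrow> i < conj_fun ?m y" for i y using less_conj_fun_iff[OF B'(2,4)] by blast
    show "conj_fun m y = insert_column (m r) r (conj_fun ?m) y"
    proof (rule conj_fun_eqI)
      fix i
      consider "y < m r" | "y = m r" | "m r < y" by linarith
      then show "y < m i \<longleftrightarrow> i < insert_column (m r) r (conj_fun ?m) y"
      proof cases
        case 1
        show ?thesis
        proof (cases "i \<le> r")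
          case True
          have "y < m i" using True 1 antimonoD[OF B(2), of i r] by simp
          moreover have "i < Suc (conj_fun ?m y)"
          proof (cases i)
            case (Suc j)
            then have "y < ?m j" using True 1 I(3)[of j] by (simp add: remove_isolated_def)
            then show ?thesis using L Suc by simp
          qed simp
          ultimately show ?thesis using 1 by (simp add: insert_column_def)
        next
          case False
          then obtain j where j: "i = Suc j" "r \<le> j" by (cases i) auto
          then show ?thesis using L[of y j] 1 by (simp add: insert_column_def remove_isolated_def)
        qed
      next
        case 2
        then show ?thesis using I(3)[of i] mgt[of i] by (cases i r rule: linorder_cases) (auto simp: insert_column_def)
      next
        case 3
        then have "y < m i \<longleftrightarrow> y - 1 < ?m i"
          using I(3)[of i] mgt[of i] mgt[of "Suc i"]
          by (cases i r rule: linorder_cases) (auto simp: remove_isolated_def)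
        then show ?thesis using 3 L by (simp add: insert_column_def)
      qed
    qed
  qed
qed

text \<open>Only the value of row \<open>r\<close> can disappear; the others are recovered by
  shifting back those above it. The thresholds in \<open>h\<close> and \<open>h'\<close> differ
  because rows of \<open>l\<close> above \<open>r\<close> remain longer than \<open>m r\<close>,
  whereas those of \<open>m\<close> may shrink to \<open>m r\<close>.\<close>

lemma remove_isolated_vals:
  assumes ib: "isolated_box l m r" and bas: "basic_fun l m"
  shows "num_pos_vals l \<le> Suc (num_pos_vals (remove_isolated r l))"
    and "num_vals m \<le> Suc (num_vals (remove_isolated r m))"
proof -
  note B = basic_funD[OF bas] and I = isolated_boxD[OF ib bas]
  let ?l = "remove_isolated r l" and ?m = "remove_isolated r m"
  have bas': "basic_fun ?l ?m" by (rule remove_isolated_columns[OF ib bas])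
  note fin = finite_range_antimono[OF basic_funD(1)[OF bas']] finite_range_antimono[OF basic_funD(2)[OF bas']]
  define h where "h = (\<lambda>v. if m r < v then Suc v else v)"
  have "range l - {0} \<subseteq> insert (l r) (h ` (range ?l - {0}))"
  proof
    fix v assume "v \<in> range l - {0}"
    then obtain i where i: "v = l i" "l i \<noteq> 0" by auto
    consider "i < r" | "i = r" | j where "i = Suc j" "r \<le> j" by (cases i) (auto, linarith)
    then show "v \<in> insert (l r) (h ` (range ?l - {0}))"
    proof cases
      case 1
      then have "v = h (?l i)" "?l i \<noteq> 0" using i I(4)[of i] by (auto simp: h_def remove_isolated_def)
      then show ?thesis by (intro insertI2 image_eqI[of _ _ "?l i"]) auto
    next
      case 3
      then have "v = h (?l j)" "?l j \<noteq> 0" using i I(5)[of i] by (auto simp: h_def remove_isolated_def)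
      then show ?thesis by (intro insertI2 image_eqI[of _ _ "?l j"]) auto
    qed (use i in simp)
  qed
  then have "card (range l - {0}) \<le> card (insert (l r) (h ` (range ?l - {0})))"
    using fin by (intro card_mono) auto
  also have "\<dots> \<le> Suc (card (h ` (range ?l - {0})))" by (rule card_insert_le_m1) simp_all
  also have "card (h ` (range ?l - {0})) \<le> card (range ?l - {0})" using fin by (intro card_image_le) auto
  finally show "num_pos_vals l \<le> Suc (num_pos_vals ?l)" by (simp add: num_pos_vals_def)
  define h' where "h' = (\<lambda>v. if m r \<le> v then Suc v else v)"
  have "range m \<subseteq> insert (m r) (h' ` range ?m)"
  proof
    fix v assume "v \<in> range m"
    then obtain i where i: "v = m i" by auto
    consider "i < r" | "i = r" | j where "i = Suc j" "r \<le> j" by (cases i) (auto, linarith)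
    then show "v \<in> insert (m r) (h' ` range ?m)"
    proof cases
      case 1
      then have "v = h' (?m i)" using i I(3)[of i] by (auto simp: h'_def remove_isolated_def)
      then show ?thesis by (intro insertI2 image_eqI[of _ h' "?m i"] rangeI)
    next
      case 3
      then have "m i \<le> m r" by (intro antimonoD[OF B(2)]) simp
      show ?thesis
      proof (cases "m i = m r")
        case False
        then have "v = h' (?m j)" using i 3 \<open>m i \<le> m r\<close> by (auto simp: h'_def remove_isolated_def)
        then show ?thesis by (intro insertI2 image_eqI[of _ h' "?m j"] rangeI)
      qed (use i in simp)
    qed (use i in simp)
  qed
  then have "card (range m) \<le> card (insert (m r) (h' ` range ?m))"
    using fin by (intro card_mono) auto
  also have "\<dots> \<le> Suc (card (h' ` range ?m))" by (rule card_insert_le_m1) simp_all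
  also have "card (h' ` range ?m) \<le> card (range ?m)" using fin by (intro card_image_le) auto
  finally show "num_vals m \<le> Suc (num_vals ?m)" by (simp add: num_vals_def)
qed

lemma sum_card_lr_chains_le:
  assumes ib: "isolated_box l m r" and bas: "basic_fun l m" and \<nu>: "\<nu> \<in> partition_funs"
  shows "(\<Sum>x\<in>corners \<nu>. card (lr_chains (remove_isolated r l) (remove_isolated r m) (remove_box x \<nu>)))
    \<le> card (lr_chains l m \<nu>)"
proof -
  note C = remove_isolated_columns[OF ib bas]
  note fin = finite_lr_chains[OF basic_funD(1)[OF bas] basic_funD(3)[OF bas] basic_funD(2)[OF bas] basic_funD(4)[OF bas]]
    finite_lr_chains[OF basic_funD(1)[OF C(5)] basic_funD(3)[OF C(5)] basic_funD(2)[OF C(5)] basic_funD(4)[OF C(5)]]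
  have "(\<Sum>x\<in>corners \<nu>. card (lr_columns (conj_fun (remove_isolated r l)) (conj_fun (remove_isolated r m)) (remove_box x \<nu>)))
    \<le> card (lr_columns (insert_column (m r) (Suc r) (conj_fun (remove_isolated r l)))
        (insert_column (m r) r (conj_fun (remove_isolated r m))) \<nu>)"
    using C(3,4) \<nu> fin
    by (intro sum_card_lr_columns_le)
      (auto simp: partition_funs_def card_lr_columns(2)[OF C(5)] C(1,2)[symmetric] card_lr_columns(2)[OF bas])
  then show ?thesis
    unfolding C(1,2)[symmetric] card_lr_columns(1)[OF bas] card_lr_columns(1)[OF C(5)] .
qed

section \<open>Standard tableaux and the lower bounds\<close>

definition partition_funs_of :: "nat \<Rightarrow> (nat \<Rightarrow> nat) set" where
  "partition_funs_of n = {f \<in> partition_funs. \<exists>N. (\<forall>i\<ge>N. f i = 0) \<and> (\<Sum>i<N. f i) = n}"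

lemma remove_box_in_partition_funs_of:
  assumes "f \<in> partition_funs_of (Suc n)" "x \<in> corners f"
  shows "remove_box x f \<in> partition_funs_of n"
proof -
  obtain N where N: "\<forall>i\<ge>N. f i = 0" "(\<Sum>i<N. f i) = Suc n" and f: "f \<in> partition_funs"
    using assms(1) by (auto simp: partition_funs_of_def)
  have fx: "0 < f x" using assms(2) by (auto simp: corners_def)
  then have xN: "x < N" using N(1) by (metis not_le not_less0)
  have "f = (\<lambda>i. remove_box x f i + (if i = x then 1 else 0))" using fx by (auto simp: remove_box_def)
  then have "Suc n = (\<Sum>i<N. remove_box x f i + (if i = x then 1 else 0))" using N(2) by metis
  also have "\<dots> = Suc (\<Sum>i<N. remove_box x f i)" using xN by (simp add: sum.distrib sum.delta)
  finally have "(\<Sum>i<N. remove_box x f i) = n" by simp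
  moreover have "\<forall>i\<ge>N. remove_box x f i = 0" using N(1) by (simp add: remove_box_def)
  ultimately show ?thesis
    using remove_box_in_partition_funs[OF f assms(2)] by (auto simp: partition_funs_of_def)
qed

lemma partition_funs_of_0: "f \<in> partition_funs_of 0 \<Longrightarrow> f = (\<lambda>_. 0)"
proof
  fix i assume "f \<in> partition_funs_of 0"
  then obtain N where N: "\<forall>i\<ge>N. f i = 0" "(\<Sum>i<N. f i) = 0" by (auto simp: partition_funs_of_def)
  then show "f i = 0" by (cases "i < N") auto
qed

lemma corners_nonempty:
  assumes "f \<in> partition_funs_of (Suc n)"
  shows "corners f \<noteq> {}"
proof
  assume c: "corners f = {}"
  obtain N where N: "\<forall>i\<ge>N. f i = 0" "(\<Sum>i<N. f i) = Suc n" and f: "f \<in> partition_funs"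
    using assms by (auto simp: partition_funs_of_def)
  have eq: "f (Suc i) = f i" for i
    using c f unfolding corners_def partition_funs_def antimono_Suc_iff
    by (metis (mono_tags, lifting) empty_iff le_neq_implies_less mem_Collect_eq)
  have "f i = f 0" for i by (induction i) (simp_all add: eq)
  then have "f i = 0" for i using N(1) by (metis order_refl)
  then show False using N(2) by simp
qed

section \<open>Standard fillings and their recursion over corners\<close>

definition young_diagram :: "(nat \<Rightarrow> nat) \<Rightarrow> (nat \<times> nat) set" where
  "young_diagram f = {(i, j). j < f i}"

definition standard_fillings :: "nat \<Rightarrow> (nat \<Rightarrow> nat) \<Rightarrow> (nat \<times> nat \<Rightarrow> nat) set" where
  "standard_fillings n f =
     {T. semistandard (young_diagram f) T \<and> bij_betw T (young_diagram f) {1..n}}"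

lemma finite_young_diagram: "fin_supp f \<Longrightarrow> finite (young_diagram f)"
proof -
  assume "fin_supp f"
  then obtain N where N: "\<And>i. i \<ge> N \<Longrightarrow> f i = 0" by (auto simp: fin_supp_def)
  show ?thesis
  proof (rule finite_subset)
    show "young_diagram f \<subseteq> Sigma {..<N} (\<lambda>i. {..<f i})"
      using N by (auto simp: young_diagram_def) (metis not_le not_less0)
  qed simp
qed

lemma finite_standard_fillings:
  assumes "fin_supp f"
  shows "finite (standard_fillings n f)"
proof (rule finite_subset)
  show "standard_fillings n f \<subseteq> young_diagram f \<rightarrow>\<^sub>E {1..n}"
  proof
    fix T assume "T \<in> standard_fillings n f"
    then have "T \<in> young_diagram f \<rightarrow>\<^sub>E {0<..}" "T ` young_diagram f = {1..n}"
      by (simp_all add: standard_fillings_def semistandard_def bij_betw_def)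
    then show "T \<in> young_diagram f \<rightarrow>\<^sub>E {1..n}" by (intro PiE_I) (auto intro: PiE_arb)
  qed
  show "finite (young_diagram f \<rightarrow>\<^sub>E {1..n})"
    by (intro finite_PiE finite_young_diagram assms) simp
qed

lemma young_diagram_remove_box:
  assumes "x \<in> corners f"
  shows "young_diagram (remove_box x f) = young_diagram f - {(x, f x - 1)}"
  by (auto simp: young_diagram_def remove_box_def split: if_splits)

lemma largest_entry_at_corner:
  assumes f: "f \<in> partition_funs" and T: "T \<in> standard_fillings (Suc n) f"
  shows "\<exists>x\<in>corners f. T (x, f x - 1) = Suc n"
proof -
  let ?D = "young_diagram f"
  have ss: "semistandard ?D T" and bij: "bij_betw T ?D {1..Suc n}"
    using T by (auto simp: standard_fillings_def)
  have "Suc n \<in> T ` ?D" using bij by (simp add: bij_betw_def)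
  then obtain x j where xj: "(x, j) \<in> ?D" "T (x, j) = Suc n" by auto
  have le: "T b \<le> Suc n" if "b \<in> ?D" for b using bij that by (auto simp: bij_betw_def)
  have "(x, Suc j) \<notin> ?D"
  proof
    assume D: "(x, Suc j) \<in> ?D"
    then have "T (x, j) \<le> T (x, Suc j)" using ss xj(1) lessI[of j] unfolding semistandard_def by blast
    then have "T (x, Suc j) = T (x, j)" using le[OF D] xj by simp
    then show False using bij D xj(1) by (auto simp: bij_betw_def dest: inj_onD)
  qed
  then have j: "j = f x - 1" "0 < f x" using xj by (auto simp: young_diagram_def)
  have "(Suc x, j) \<notin> ?D"
  proof
    assume D: "(Suc x, j) \<in> ?D"
    then have "T (x, j) < T (Suc x, j)" using ss xj(1) lessI[of x] unfolding semistandard_def by blast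
    then show False using le[OF D] xj by simp
  qed
  then have "x \<in> corners f" using j by (auto simp: young_diagram_def corners_def)
  then show ?thesis using xj j by auto
qed

text \<open>One inequality of the branching rule: a filling is determined by the corner holding its
  largest entry and by the standard filling that remains.\<close>

lemma card_standard_fillings_le:
  assumes f: "f \<in> partition_funs"
  shows "card (standard_fillings (Suc n) f) \<le> (\<Sum>x\<in>corners f. card (standard_fillings n (remove_box x f)))"
proof -
  have fs: "fin_supp f" using f by (simp add: partition_funs_def)
  let ?D = "young_diagram f"
  let ?S = "Sigma (corners f) (\<lambda>x. standard_fillings n (remove_box x f))"
  let ?D' = "\<lambda>x. young_diagram (remove_box x f)"
  define c where "c = (\<lambda>T. SOME x. x \<in> corners f \<and> T (x, f x - 1) = Suc n)"
  have c: "c T \<in> corners f" "T (c T, f (c T) - 1) = Suc n" if "T \<in> standard_fillings (Suc n) f" for T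
    using someI_ex[of "\<lambda>x. x \<in> corners f \<and> T (x, f x - 1) = Suc n"] largest_entry_at_corner[OF f that]
    unfolding c_def by blast+
  have "card (standard_fillings (Suc n) f) \<le> card ?S"
  proof (rule card_inj_on_le[of "\<lambda>T. (c T, restrict T (?D' (c T)))"])
    show "inj_on (\<lambda>T. (c T, restrict T (?D' (c T)))) (standard_fillings (Suc n) f)"
    proof (rule inj_onI)
      fix T U assume T: "T \<in> standard_fillings (Suc n) f" and U: "U \<in> standard_fillings (Suc n) f"
        and eq: "(c T, restrict T (?D' (c T))) = (c U, restrict U (?D' (c U)))"
      show "T = U"
      proof
        fix b
        consider "b \<notin> ?D" | "b = (c T, f (c T) - 1)" | "b \<in> ?D' (c T)"
          unfolding young_diagram_remove_box[OF c(1)[OF T]] by blast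
        then show "T b = U b"
        proof cases
          case 1
          moreover have "T \<in> ?D \<rightarrow>\<^sub>E {0<..}" "U \<in> ?D \<rightarrow>\<^sub>E {0<..}"
            using T U by (simp_all add: standard_fillings_def semistandard_def)
          ultimately show ?thesis by (metis PiE_arb)
        next
          case 2 then show ?thesis using c(2)[OF T] c(2)[OF U] eq by simp
        next
          case 3 then show ?thesis using eq by (metis Pair_inject restrict_apply')
        qed
      qed
    qed
    show "(\<lambda>T. (c T, restrict T (?D' (c T)))) ` standard_fillings (Suc n) f \<subseteq> ?S"
    proof safe
      fix T assume T: "T \<in> standard_fillings (Suc n) f"
      show "c T \<in> corners f" by (rule c(1)[OF T])
      have ss: "semistandard ?D T" and bij: "bij_betw T ?D {1..Suc n}"
        using T by (auto simp: standard_fillings_def)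
      have D': "?D' (c T) = ?D - {(c T, f (c T) - 1)}" by (rule young_diagram_remove_box[OF c(1)[OF T]])
      have in_D: "(c T, f (c T) - 1) \<in> ?D" using c(1)[OF T] by (auto simp: corners_def young_diagram_def)
      have "semistandard (?D' (c T)) (restrict T (?D' (c T)))"
        using ss unfolding semistandard_def D' by (auto simp: PiE_iff)
      moreover have "bij_betw T (?D - {(c T, f (c T) - 1)}) ({1..Suc n} - {T (c T, f (c T) - 1)})"
        using bij in_D by (auto simp: bij_betw_def inj_on_diff inj_on_image_set_diff[where C="?D"])
      then have "bij_betw T (?D' (c T)) {1..n}"
        unfolding D' c(2)[OF T] by (simp add: atLeastAtMostSuc_conv)
      then have "bij_betw (restrict T (?D' (c T))) (?D' (c T)) {1..n}"
        by (subst bij_betw_cong[where g=T]) auto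
      ultimately show "restrict T (?D' (c T)) \<in> standard_fillings n (remove_box (c T) f)"
        by (simp add: standard_fillings_def)
    qed
    show "finite ?S"
      using finite_corners[OF fs] finite_standard_fillings[OF fin_supp_remove_box[OF fs]] by auto
  qed
  also have "\<dots> = (\<Sum>x\<in>corners f. card (standard_fillings n (remove_box x f)))"
    using finite_corners[OF fs] finite_standard_fillings[OF fin_supp_remove_box[OF fs]]
    by (intro card_SigmaI) auto
  finally show ?thesis .
qed

text \<open>The maximum with 1 makes one induction bound both the constituents and the components.\<close>

definition weight :: "nat \<Rightarrow> (nat \<Rightarrow> nat) \<Rightarrow> nat" where
  "weight n f = max 1 (card (standard_fillings n f))"

lemma weight_Suc_le:
  assumes "f \<in> partition_funs_of (Suc n)"
  shows "weight (Suc n) f \<le> (\<Sum>x\<in>corners f. weight n (remove_box x f))"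
proof -
  have f: "f \<in> partition_funs" using assms by (simp add: partition_funs_of_def)
  then have fin: "finite (corners f)" by (intro finite_corners) (simp add: partition_funs_def)
  have "card (standard_fillings (Suc n) f) \<le> (\<Sum>x\<in>corners f. card (standard_fillings n (remove_box x f)))"
    by (rule card_standard_fillings_le[OF f])
  also have "\<dots> \<le> (\<Sum>x\<in>corners f. weight n (remove_box x f))"
    by (rule sum_mono) (simp add: weight_def)
  finally have 1: "card (standard_fillings (Suc n) f) \<le> \<dots>" .
  have "1 \<le> card (corners f)" using corners_nonempty[OF assms] fin by (simp add: Suc_le_eq card_gt_0_iff)
  also have "card (corners f) = (\<Sum>x\<in>corners f. 1)" by simp
  also have "\<dots> \<le> (\<Sum>x\<in>corners f. weight n (remove_box x f))"
    by (rule sum_mono) (simp add: weight_def)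
  finally show ?thesis using 1 by (simp add: weight_def)
qed

lemma weight_0: "weight 0 (\<lambda>_. 0) = 1"
proof -
  have "standard_fillings 0 (\<lambda>_. 0) \<subseteq> {\<lambda>_. undefined}"
    by (auto simp: standard_fillings_def semistandard_def young_diagram_def)
  then have "card (standard_fillings 0 (\<lambda>_. 0)) \<le> card {\<lambda>_::nat \<times> nat. undefined :: nat}"
    by (intro card_mono) auto
  then show ?thesis by (simp add: weight_def)
qed

section \<open>The induction over shapes\<close>

lemma move_size:
  assumes "basic_fun l m" "basic_fun l' m'" "column_move l' m' l m \<or> row_move l' m' l m"
  shows "l' 0 + conj_fun l' 0 < l 0 + conj_fun l 0"
  using assms(3)
proof
  note B = basic_funD[OF assms(1)] and B' = basic_funD[OF assms(2)]
  {
    assume "column_move l' m' l m"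
    then obtain a where a: "0 < a" "l = add_column a l'" by (auto simp: column_move_def)
    have "conj_fun l' 0 \<le> conj_fun l 0"
    proof (rule ccontr)
      assume "\<not> ?thesis"
      then have "0 < l' (conj_fun l 0)" using less_conj_fun_iff[OF B'(1,3), of "conj_fun l 0" 0] by simp
      then have "0 < l (conj_fun l 0)" by (simp add: a(2) add_column_def)
      then show False using less_conj_fun_iff[OF B(1,3), of "conj_fun l 0" 0] by simp
    qed
    then show ?thesis using a by (simp add: add_column_def)
  next
    assume "row_move l' m' l m"
    then obtain c where c: "0 < c" "conj_fun l = add_column c (conj_fun l')" by (auto simp: row_move_def)
    have "l' 0 \<le> l 0"
    proof (rule ccontr)
      assume "\<not> ?thesis"
      then have "0 < conj_fun l' (l 0)" using less_conj_fun_iff[OF B'(1,3), of 0 "l 0"] by simp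
      then have "0 < conj_fun l (l 0)" by (simp add: c(2) add_column_def)
      then show False using less_conj_fun_iff[OF B(1,3), of 0 "l 0"] by simp
    qed
    then show ?thesis using c by (simp add: add_column_def)
  }
qed

lemma remove_isolated_size:
  assumes ib: "isolated_box l m r" and bas: "basic_fun l m"
  shows "remove_isolated r l 0 + conj_fun (remove_isolated r l) 0 < l 0 + conj_fun l 0"
proof -
  note I = isolated_boxD[OF ib bas] and C = remove_isolated_columns[OF ib bas]
  have "remove_isolated r l 0 < l 0"
    using I(1,2) I(4)[of 0] by (cases r) (auto simp: remove_isolated_def)
  moreover have "conj_fun (remove_isolated r l) 0 \<le> conj_fun l 0"
    using C(3) by (subst C(1)) (auto simp: insert_column_def)
  ultimately show ?thesis by simp
qed

text \<open>The measure is the number of columns plus the number of rows of \<open>l\<close>. A move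
  composes \<open>\<phi>\<close> with its own map of contents. For an isolated box
  \<open>\<phi>\<close> is kept: the recursion of \<open>weight\<close> over the corners of
  \<open>\<nu>\<close> is matched with a part of the sum over the corners of
  \<open>\<phi> \<nu>\<close>.\<close>

theorem lr_chains_lower_bound:
  assumes "enough_corners n l m"
  shows "\<exists>\<phi>. box_compatible \<phi> \<and> (\<forall>\<nu>\<in>partition_funs_of n. weight n \<nu> \<le> card (lr_chains l m (\<phi> \<nu>)))"
  using assms
proof (induction "l 0 + conj_fun l 0" arbitrary: n l m rule: less_induct)
  case less
  have bas: "basic_fun l m" using less.prems by (simp add: enough_corners_def)
  note B = basic_funD[OF bas]
  show ?case
  proof (cases "l 0 = 0")
    case True
    have l: "l = (\<lambda>_. 0)" using antimonoD[OF B(1), of 0] True by (auto simp: fun_eq_iff)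
    have m: "m = (\<lambda>_. 0)" using B(7) l by (auto simp: fun_eq_iff)
    have n: "n = 0" using less.prems by (simp add: enough_corners_def num_pos_vals_def l)
    have "weight n \<nu> \<le> card (lr_chains l m \<nu>)" if "\<nu> \<in> partition_funs_of n" for \<nu>
    proof -
      have \<nu>: "\<nu> = (\<lambda>_. 0)" using that n partition_funs_of_0 by simp
      have "finite (lr_chains l m \<nu>)"
        using B(1-4) unfolding \<nu> by (intro finite_lr_chains) (auto simp: antimono_Suc_iff fin_supp_def)
      moreover have "(\<lambda>_ _. 0) \<in> lr_chains l m \<nu>"
        by (auto simp: lr_chains_def strip_chain_def l m \<nu>)
      ultimately have "0 < card (lr_chains l m \<nu>)" by (auto simp: card_gt_0_iff)
      then show ?thesis by (simp add: \<nu> n weight_0)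
    qed
    then show ?thesis using box_compatible_id by blast
  next
    case False
    have "reducible n l m" by (rule reducible_if_nonempty[OF less.prems False])
    then consider (move) l' m' where "enough_corners n l' m'" "column_move l' m' l m \<or> row_move l' m' l m"
      | (box) r where "isolated_box l m r" unfolding reducible_def by blast
    then show ?thesis
    proof cases
      case move
      have bas': "basic_fun l' m'" using move by (simp add: enough_corners_def)
      obtain \<phi> where \<phi>: "box_compatible \<phi>" "\<And>\<nu>. \<nu> \<in> partition_funs_of n \<Longrightarrow> weight n \<nu> \<le> card (lr_chains l' m' (\<phi> \<nu>))"
        using less.hyps[OF move_size[OF bas bas' move(2)] move(1)] by blast
      obtain \<psi> where \<psi>: "box_compatible \<psi>"
        "\<And>\<nu>. \<nu> \<in> partition_funs \<Longrightarrow> card (lr_chains l' m' \<nu>) \<le> card (lr_chains l m (\<psi> \<nu>))"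
        using move(2) card_lr_chains_column_move[OF _ bas' bas] card_lr_chains_row_move[OF _ bas' bas] by blast
      have "weight n \<nu> \<le> card (lr_chains l m (\<psi> (\<phi> \<nu>)))" if \<nu>: "\<nu> \<in> partition_funs_of n" for \<nu>
      proof -
        have "\<phi> \<nu> \<in> partition_funs" using \<nu> \<phi>(1) unfolding box_compatible_def partition_funs_of_def by blast
        then show ?thesis using \<phi>(2)[OF \<nu>] \<psi>(2) le_trans by blast
      qed
      then show ?thesis using box_compatible_comp[OF \<phi>(1) \<psi>(1)] by blast
    next
      case box
      let ?l = "remove_isolated r l" and ?m = "remove_isolated r m"
      have bas': "basic_fun ?l ?m" by (rule remove_isolated_columns[OF box bas])
      have ec: "enough_corners (n - 1) ?l ?m"
        using bas' less.prems remove_isolated_vals[OF box bas] unfolding enough_corners_def by linarith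
      obtain \<phi> where \<phi>: "box_compatible \<phi>" "\<And>\<nu>. \<nu> \<in> partition_funs_of (n - 1) \<Longrightarrow> weight (n - 1) \<nu> \<le> card (lr_chains ?l ?m (\<phi> \<nu>))"
        using less.hyps[OF remove_isolated_size[OF box bas] ec] by blast
      have pf: "\<phi> \<nu> \<in> partition_funs" if "\<nu> \<in> partition_funs" for \<nu>
        using that \<phi>(1) unfolding box_compatible_def by blast
      have fin: "finite (corners \<nu>)" if "\<nu> \<in> partition_funs" for \<nu>
        using that by (intro finite_corners) (simp add: partition_funs_def)
      note sum = sum_card_lr_chains_le[OF box bas]
      show ?thesis
      proof (cases n)
        \<comment> \<open>No box of \<open>\<nu>\<close> is left to be matched with the isolated one
          (here \<open>n - 1\<close> is again 0), so the content receives an additional box in its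
          first row.\<close>
        case 0
        have "weight n \<nu> \<le> card (lr_chains l m (add_column 1 (\<phi> \<nu>)))" if \<nu>: "\<nu> \<in> partition_funs_of n" for \<nu>
        proof -
          have p: "\<phi> \<nu> \<in> partition_funs" using \<nu> pf by (simp add: partition_funs_of_def)
          have p': "add_column 1 (\<phi> \<nu>) \<in> partition_funs"
            using p box_compatible_add_column unfolding box_compatible_def by blast
          have c: "0 \<in> corners (add_column 1 (\<phi> \<nu>))"
            using p by (auto simp: corners_def add_column_def partition_funs_def antimono_Suc_iff less_Suc_eq_le)
          have r: "remove_box 0 (add_column 1 (\<phi> \<nu>)) = \<phi> \<nu>"
            by (auto simp: remove_box_def add_column_def)
          have "weight n \<nu> \<le> card (lr_chains ?l ?m (\<phi> \<nu>))" using \<phi>(2)[of \<nu>] \<nu> 0 by simp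
          also have "\<dots> \<le> (\<Sum>x\<in>corners (add_column 1 (\<phi> \<nu>)). card (lr_chains ?l ?m (remove_box x (add_column 1 (\<phi> \<nu>)))))"
            using member_le_sum[OF c _ fin[OF p'], of "\<lambda>x. card (lr_chains ?l ?m (remove_box x (add_column 1 (\<phi> \<nu>))))"] r
            by simp
          also have "\<dots> \<le> card (lr_chains l m (add_column 1 (\<phi> \<nu>)))" by (rule sum[OF p'])
          finally show ?thesis .
        qed
        then show ?thesis using box_compatible_comp[OF \<phi>(1) box_compatible_add_column[of 1]] by blast
      next
        case (Suc k)
        have "weight n \<nu> \<le> card (lr_chains l m (\<phi> \<nu>))" if \<nu>: "\<nu> \<in> partition_funs_of n" for \<nu>
        proof -
          have p: "\<nu> \<in> partition_funs" using \<nu> by (simp add: partition_funs_of_def)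
          obtain g where g: "\<And>x. x \<in> corners \<nu> \<Longrightarrow> g x \<in> corners (\<phi> \<nu>)"
            "\<And>x. x \<in> corners \<nu> \<Longrightarrow> \<phi> (remove_box x \<nu>) = remove_box (g x) (\<phi> \<nu>)"
            using \<phi>(1) p unfolding box_compatible_def by metis
          \<comment> \<open>Corners with the same image would leave partitions with the same image
            under the injective \<open>\<phi>\<close>, hence the same partition.\<close>
          have inj: "inj_on g (corners \<nu>)"
          proof (rule inj_onI)
            fix x y assume xy: "x \<in> corners \<nu>" "y \<in> corners \<nu>" "g x = g y"
            then have "\<phi> (remove_box x \<nu>) = \<phi> (remove_box y \<nu>)" using g(2) by simp
            then have eq: "remove_box x \<nu> = remove_box y \<nu>"
              using \<phi>(1) remove_box_in_partition_funs[OF p] xy unfolding box_compatible_def by (meson inj_onD)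
            show "x = y" using fun_cong[OF eq, of x] xy(1)
              by (auto simp: remove_box_def corners_def split: if_splits)
          qed
          have "weight n \<nu> \<le> (\<Sum>x\<in>corners \<nu>. weight k (remove_box x \<nu>))"
            using weight_Suc_le \<nu> Suc by simp
          also have "\<dots> \<le> (\<Sum>x\<in>corners \<nu>. card (lr_chains ?l ?m (remove_box (g x) (\<phi> \<nu>))))"
          proof (rule sum_mono)
            fix x assume x: "x \<in> corners \<nu>"
            then have "weight k (remove_box x \<nu>) \<le> card (lr_chains ?l ?m (\<phi> (remove_box x \<nu>)))"
              using \<phi>(2)[of "remove_box x \<nu>"] remove_box_in_partition_funs_of \<nu> Suc by simp
            then show "weight k (remove_box x \<nu>) \<le> card (lr_chains ?l ?m (remove_box (g x) (\<phi> \<nu>)))"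
              using g(2)[OF x] by simp
          qed
          also have "\<dots> = (\<Sum>x\<in>g ` corners \<nu>. card (lr_chains ?l ?m (remove_box x (\<phi> \<nu>))))"
            using sum.reindex[OF inj, of "\<lambda>x. card (lr_chains ?l ?m (remove_box x (\<phi> \<nu>)))"] by simp
          also have "\<dots> \<le> (\<Sum>x\<in>corners (\<phi> \<nu>). card (lr_chains ?l ?m (remove_box x (\<phi> \<nu>))))"
            using g(1) fin[OF pf[OF p]] by (intro sum_mono2) auto
          also have "\<dots> \<le> card (lr_chains l m (\<phi> \<nu>))" by (rule sum[OF pf[OF p]])
          finally show ?thesis .
        qed
        then show ?thesis using \<phi>(1) by blast
      qed
    qed
  qed
qed

text \<open>For infinite sets \<open>card\<close> and sums would be 0. Each part of a content counts
  boxes, and different parts count disjoint nonempty sets of boxes, so the number of boxes bounds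
  the parts and how many there are.\<close>

lemma finite_components: "finite (components lam mu)"
proof (rule finite_subset)
  let ?D = "skew_diagram lam mu"
  have finD: "finite ?D"
  proof (rule finite_subset)
    show "?D \<subseteq> Sigma {..<length lam} (\<lambda>i. {..<part lam i})"
      by (auto simp: skew_diagram_def part_def split: if_splits)
  qed simp
  show "components lam mu \<subseteq> {nu. set nu \<subseteq> {..card ?D} \<and> length nu \<le> card ?D}"
  proof safe
    fix nu assume nu: "nu \<in> components lam mu"
    then have "lr_coeff lam mu nu \<noteq> 0" and part: "is_partition nu" by (auto simp: components_def)
    then obtain T where T: "has_content ?D T nu"
      unfolding lr_coeff_def by (metis (mono_tags, lifting) card.empty empty_Collect_eq)
    have nth: "card {b \<in> ?D. T b = Suc k} = nu ! k" if "k < length nu" for k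
      using T that by (simp add: has_content_def part_def)
    {
      fix v assume "v \<in> set nu"
      then obtain k where k: "k < length nu" "v = nu ! k" by (auto simp: in_set_conv_nth)
      have "card {b \<in> ?D. T b = Suc k} \<le> card ?D" by (rule card_mono[OF finD]) auto
      then show "v \<le> card ?D" using nth[OF k(1)] k by simp
    }
    have "Suc ` {..<length nu} \<subseteq> T ` ?D"
    proof safe
      fix k assume k: "k < length nu"
      have "0 < nu ! k" using part k by (simp add: is_partition_def)
      then have "{b \<in> ?D. T b = Suc k} \<noteq> {}" using nth[OF k] by (metis card.empty less_irrefl)
      then obtain b where "b \<in> ?D" "T b = Suc k" by blast
      then show "Suc k \<in> T ` ?D" by (metis imageI)
    qed
    then have "card (Suc ` {..<length nu}) \<le> card (T ` ?D)" using finD by (intro card_mono) auto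
    also have "\<dots> \<le> card ?D" by (rule card_image_le[OF finD])
    finally show "length nu \<le> card ?D" by (simp add: card_image)
  qed
  show "finite {nu :: nat list. set nu \<subseteq> {..card ?D} \<and> length nu \<le> card ?D}"
    by (rule finite_lists_length_le) simp
qed

section \<open>Back to lists of parts\<close>

lemma range_part:
  shows "range (part xs) = insert 0 (set xs)"
proof (intro equalityI subsetI)
  fix v assume "v \<in> range (part xs)"
  then show "v \<in> insert 0 (set xs)" by (auto simp: part_def)
next
  fix v assume v: "v \<in> insert 0 (set xs)"
  show "v \<in> range (part xs)"
  proof (cases "v = 0")
    case True
    then have "v = part xs (length xs)" by (simp add: part_def)
    then show ?thesis by blast
  next
    case False
    then obtain i where "i < length xs" "xs ! i = v" using v by (auto simp: in_set_conv_nth)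
    then have "v = part xs i" by (simp add: part_def)
    then show ?thesis by blast
  qed
qed

lemma enough_corners_delta:
  assumes "is_partition lam" "is_partition mu" "basic lam mu"
  shows "enough_corners (delta lam mu) (part lam) (part mu)"
proof -
  have "part mu i \<le> part lam (Suc i)" for i
  proof (cases "i < length lam")
    case False
    then have "part lam i = 0" by (simp add: part_def)
    then show ?thesis using assms(3) unfolding basic_def contained_def by (metis le0 le_zero_eq)
  qed (use assms(3) in \<open>simp add: basic_def\<close>)
  moreover have "part mu i < part lam i" if "0 < part lam i" for i
    using that assms(3) is_partition_part(3)[OF assms(1)] by (auto simp: basic_def)
  ultimately have "basic_fun (part lam) (part mu)"
    using is_partition_part assms(1,2) by (auto simp: basic_fun_def)
  moreover have "0 \<notin> set lam" "0 \<notin> set mu" using assms(1,2) by (auto simp: is_partition_def)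
  then have "num_pos_vals (part lam) = dp lam" "num_vals (part mu) = dp mu + 1"
    by (simp_all add: num_pos_vals_def num_vals_def range_part dp_def)
  ultimately show ?thesis by (simp add: enough_corners_def delta_def)
qed

lemma part_in_partition_funs_of:
  assumes "xs \<in> partitions n"
  shows "part xs \<in> partition_funs_of n"
proof -
  have "(\<Sum>i<length xs. part xs i) = sum_list xs"
    by (simp add: sum_list_sum_nth part_def lessThan_atLeast0)
  then show ?thesis
    using assms is_partition_part(1,2)[of xs]
    unfolding partition_funs_of_def partition_funs_def partitions_def
    by (auto intro!: exI[of _ "length xs"] simp: part_def)
qed

theorem theorem3p4:
  fixes lam mu :: "nat list" and n :: nat
  assumes "is_partition lam" and "is_partition mu"
    and "basic lam mu"
    and "delta lam mu = n"
  shows "at_least (cc lam mu) (num_partitions n, num_standard_tableaux n)"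
proof -
  have "enough_corners n (part lam) (part mu)"
    using enough_corners_delta[OF assms(1-3)] assms(4) by simp
  then obtain \<phi> where \<phi>: "box_compatible \<phi>"
    "\<And>\<nu>. \<nu> \<in> partition_funs_of n \<Longrightarrow> weight n \<nu> \<le> card (lr_chains (part lam) (part mu) (\<phi> \<nu>))"
    using lr_chains_lower_bound by blast
  \<comment> \<open>One injection serves both bounds: each partition of \<open>n\<close> gets its
    own component, of multiplicity at least 1 and at least the number of its standard
    tableaux.\<close>
  define \<psi> where "\<psi> = (\<lambda>xs. unpart (\<phi> (part xs)))"
  have pf: "part xs \<in> partition_funs" if "xs \<in> partitions n" for xs
    using part_in_partition_funs_of[OF that] by (simp add: partition_funs_of_def)
  have \<phi>pf: "antimono (\<phi> (part xs))" "fin_supp (\<phi> (part xs))" if "xs \<in> partitions n" for xs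
    using pf[OF that] \<phi>(1) unfolding box_compatible_def partition_funs_def by blast+
  have part\<psi>: "part (\<psi> xs) = \<phi> (part xs)" if "xs \<in> partitions n" for xs
    unfolding \<psi>_def using \<phi>pf[OF that] by (rule part_unpart)
  have bound: "weight n (part xs) \<le> lr_coeff lam mu (\<psi> xs)" if xs: "xs \<in> partitions n" for xs
  proof -
    have "weight n (part xs) \<le> card (lr_chains (part lam) (part mu) (part (\<psi> xs)))"
      using \<phi>(2)[OF part_in_partition_funs_of[OF xs]] part\<psi>[OF xs] by simp
    also have "\<dots> \<le> lr_coeff lam mu (\<psi> xs)"
      by (rule card_lr_chains_le_lr_coeff(1)[OF assms(1) is_partition_part(1)[OF assms(2)]])
    finally show ?thesis .
  qed
  have sub: "\<psi> ` partitions n \<subseteq> components lam mu"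
  proof safe
    fix xs assume xs: "xs \<in> partitions n"
    have "lr_coeff lam mu (\<psi> xs) \<noteq> 0" using bound[OF xs] by (simp add: weight_def)
    moreover have "is_partition (\<psi> xs)" unfolding \<psi>_def using \<phi>pf[OF xs] by (rule is_partition_unpart)
    ultimately show "\<psi> xs \<in> components lam mu" by (simp add: components_def)
  qed
  have inj: "inj_on \<psi> (partitions n)"
  proof (rule inj_onI)
    fix xs ys assume *: "xs \<in> partitions n" "ys \<in> partitions n" "\<psi> xs = \<psi> ys"
    then have "\<phi> (part xs) = \<phi> (part ys)" using part\<psi> by metis
    then have "part xs = part ys"
      using \<phi>(1) pf[OF *(1)] pf[OF *(2)] unfolding box_compatible_def by (meson inj_onD)
    then show "xs = ys" using part_inject *(1,2) by (auto simp: partitions_def)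
  qed
  have "card (partitions n) \<le> card (components lam mu)"
    using inj sub finite_components by (rule card_inj_on_le)
  moreover have "num_standard_tableaux n \<le> (\<Sum>nu\<in>components lam mu. lr_coeff lam mu nu)"
  proof -
    have "card (standard_tableaux xs) \<le> lr_coeff lam mu (\<psi> xs)" if xs: "xs \<in> partitions n" for xs
    proof -
      have "standard_tableaux xs = standard_fillings n (part xs)"
        using xs by (simp add: standard_tableaux_def standard_fillings_def skew_diagram_def
            young_diagram_def part_def[of "[]"] partitions_def)
      then show ?thesis using bound[OF xs] by (simp add: weight_def)
    qed
    then have "num_standard_tableaux n \<le> (\<Sum>xs\<in>partitions n. lr_coeff lam mu (\<psi> xs))"
      unfolding num_standard_tableaux_def by (rule sum_mono)
    also have "\<dots> = (\<Sum>nu\<in>\<psi> ` partitions n. lr_coeff lam mu nu)"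
      using sum.reindex[OF inj, of "lr_coeff lam mu"] by simp
    also have "\<dots> \<le> (\<Sum>nu\<in>components lam mu. lr_coeff lam mu nu)"
      using sub finite_components by (intro sum_mono2) auto
    finally show ?thesis .
  qed
  ultimately show ?thesis by (simp add: at_least_def cc_def num_partitions_def)
qed

end
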